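(* Let $K$ be a field and let $Q$ be a finite quiver. Then the commuting algebra $KQ/C$ of $KQ$ and the skeleton $Sk(Q)$ of $KQ$ are finite dimensional $K$-algebras with finite global dimension $\le$ the length of the longest chain of vertices of $Sk(Q)$.
   Context: Paths in $Q$ include the paths of length zero (the vertices) and are composed from left to right: a path $p$ from $v$ to $w$ satisfies $vp=p=pw$ in $KQ$. Two paths are parallel if they have the same start vertex and the same end vertex. $C$ is the two-sided ideal of $KQ$ generated by all differences $p-q$ of parallel paths $p,q$ (of any lengths $\ge 0$); $KQ/C$ is the commuting algebra of $KQ$, with canonical surjection $\rho\colon KQ\to KQ/C$. On the vertex set of $Q$ define $v\sim w$ if there are paths from $v$ to $w$ and from $w$ to $v$; the equivalence classes $D_1,\dots,D_m$ are the path connected components of $Q$. Choose a vertex $w_i\in D_i$ for each $i$. The skeleton of $KQ$ is $Sk(Q)=\mathrm{End}_{KQ/C}(P)$, where $P=\bigoplus_{i=1}^m\rho(w_i)KQ/C$ as a right $KQ/C$-module. The vertex set of $Sk(Q)$ is $\{x_1,\dots,x_m\}$, with $x_i$ corresponding to $D_i$, partially ordered by $x_i\le x_j$ if and only if there is a path in $Q$ from $w_i$ to $w_j$. In a finite partially ordered set $S$, a sequence $s_{i_1}<s_{i_2}<\cdots<s_{i_t}$ of elements of $S$ is called a chain of length $t$ (so length counts the number of elements). *)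

theory Defs
  imports
    "HOL-Algebra.QuotRing"
    "HOL-Library.Extended_Nat"
    "Jordan_Normal_Form.Missing_VectorSpace"
    "Graph_Theory.Arc_Walk"
begin

section \<open>Finite-dimensional algebras\<close>

text \<open>The library locale \<open>algebra\<close> demands a commutative multiplication; here it may be
  noncommutative. The record type \<open>module\<close> carries both the ring operations and the scalar
  multiplication.\<close>

locale fin_dim_algebra = vectorspace K A + ring A
  for K :: "('k, 'e) ring_scheme" (structure) and A :: "('k, 'a, 'f) module_scheme" (structure) +
  assumes smult_mult_left:
      "\<lbrakk>k \<in> carrier K; x \<in> carrier A; y \<in> carrier A\<rbrakk>
        \<Longrightarrow> k \<odot>\<^bsub>A\<^esub> (x \<otimes>\<^bsub>A\<^esub> y) = (k \<odot>\<^bsub>A\<^esub> x) \<otimes>\<^bsub>A\<^esub> y"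
    and smult_mult_right:
      "\<lbrakk>k \<in> carrier K; x \<in> carrier A; y \<in> carrier A\<rbrakk>
        \<Longrightarrow> k \<odot>\<^bsub>A\<^esub> (x \<otimes>\<^bsub>A\<^esub> y) = x \<otimes>\<^bsub>A\<^esub> (k \<odot>\<^bsub>A\<^esub> y)"
    and finite_dimensional: "fin_dim"


section \<open>Right modules over a noncommutative ring\<close>

text \<open>A right module is stored in the record type \<open>module\<close>, whose infix notation puts the scalar on
  the left: \<open>a \<odot>\<^bsub>M\<^esub> x\<close> stands for the product \<open>x \<sqdot> a\<close> of \<open>x \<in> M\<close> with \<open>a \<in> R\<close>, which explains the
  form of \<open>rsmult_assoc\<close>. The record fields \<open>mult\<close> and \<open>one\<close> of a module play no role.
  With this reading the library's \<open>module_hom\<close> consists of the homomorphisms of right modules.\<close>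

locale right_module = R?: ring R + M?: abelian_group M
  for R :: "('r, 'e) ring_scheme" (structure) and M :: "('r, 'm, 'f) module_scheme" (structure) +
  assumes rsmult_closed:
      "\<lbrakk>a \<in> carrier R; x \<in> carrier M\<rbrakk> \<Longrightarrow> a \<odot>\<^bsub>M\<^esub> x \<in> carrier M"
    and rsmult_distr_ring:
      "\<lbrakk>a \<in> carrier R; b \<in> carrier R; x \<in> carrier M\<rbrakk>
        \<Longrightarrow> (a \<oplus>\<^bsub>R\<^esub> b) \<odot>\<^bsub>M\<^esub> x = (a \<odot>\<^bsub>M\<^esub> x) \<oplus>\<^bsub>M\<^esub> (b \<odot>\<^bsub>M\<^esub> x)"
    and rsmult_distr_module:
      "\<lbrakk>a \<in> carrier R; x \<in> carrier M; y \<in> carrier M\<rbrakk>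
        \<Longrightarrow> a \<odot>\<^bsub>M\<^esub> (x \<oplus>\<^bsub>M\<^esub> y) = (a \<odot>\<^bsub>M\<^esub> x) \<oplus>\<^bsub>M\<^esub> (a \<odot>\<^bsub>M\<^esub> y)"
    and rsmult_assoc:
      "\<lbrakk>a \<in> carrier R; b \<in> carrier R; x \<in> carrier M\<rbrakk>
        \<Longrightarrow> (a \<otimes>\<^bsub>R\<^esub> b) \<odot>\<^bsub>M\<^esub> x = b \<odot>\<^bsub>M\<^esub> (a \<odot>\<^bsub>M\<^esub> x)"
    and rsmult_one: "x \<in> carrier M \<Longrightarrow> \<one>\<^bsub>R\<^esub> \<odot>\<^bsub>M\<^esub> x = x"

abbreviation right_hom ::
    "('r, 'e) ring_scheme \<Rightarrow> ('r, 'm, 'f) module_scheme \<Rightarrow> ('r, 'n, 'g) module_scheme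
      \<Rightarrow> ('m \<Rightarrow> 'n) set" where
  "right_hom R M N \<equiv> LinearCombinations.module_hom R M N"

definition principal_right_module :: "('r, 'e) ring_scheme \<Rightarrow> 'r \<Rightarrow> ('r, 'r) module" where
  "principal_right_module R e =
    \<lparr>carrier = e <#\<^bsub>R\<^esub> carrier R, mult = undefined, one = undefined,
     zero = \<zero>\<^bsub>R\<^esub>, add = add R, smult = (\<lambda>a x. x \<otimes>\<^bsub>R\<^esub> a)\<rparr>"

definition direct_sum_module ::
    "'i set \<Rightarrow> ('i \<Rightarrow> ('r, 'm) module) \<Rightarrow> ('r, 'i \<Rightarrow> 'm) module" where
  "direct_sum_module I M =
    \<lparr>carrier = {f \<in> (\<Pi>\<^sub>E i\<in>I. carrier (M i)). finite {i \<in> I. f i \<noteq> \<zero>\<^bsub>M i\<^esub>}},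
     mult = undefined, one = undefined,
     zero = (\<lambda>i\<in>I. \<zero>\<^bsub>M i\<^esub>),
     add = (\<lambda>f g. \<lambda>i\<in>I. f i \<oplus>\<^bsub>M i\<^esub> g i),
     smult = (\<lambda>a f. \<lambda>i\<in>I. a \<odot>\<^bsub>M i\<^esub> f i)\<rparr>"

text \<open>Endomorphisms act on the left, so the product is \<open>(f \<otimes> g) x = f (g x)\<close>. They are made
  extensional, so that equality of endomorphisms is equality of functions. A scalar \<open>k \<in> K\<close> acts on
  a right \<open>A\<close>-module as \<open>k \<sqdot> \<one>\<^bsub>A\<^esub>\<close>.\<close>

definition End_algebra :: "('k, 'a) module \<Rightarrow> ('a, 'm) module \<Rightarrow> ('k, 'm \<Rightarrow> 'm) module" where
  "End_algebra A M =
    \<lparr>carrier = right_hom A M M \<inter> extensional (carrier M),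
     mult = (\<lambda>f g. compose (carrier M) f g),
     one = (\<lambda>x\<in>carrier M. x),
     zero = (\<lambda>x\<in>carrier M. \<zero>\<^bsub>M\<^esub>),
     add = (\<lambda>f g. \<lambda>x\<in>carrier M. f x \<oplus>\<^bsub>M\<^esub> g x),
     smult = (\<lambda>k f. \<lambda>x\<in>carrier M. (k \<odot>\<^bsub>A\<^esub> \<one>\<^bsub>A\<^esub>) \<odot>\<^bsub>M\<^esub> f x)\<rparr>"


section \<open>Global dimension\<close>

text \<open>HOL has no quantifier over types inside a formula, so the test modules \<open>M\<close>, \<open>N\<close> in the lifting
  property live in the type of \<open>P\<close>. This is the usual notion of projectivity as soon as the type is
  infinite and \<open>R\<close> injects into it, because a free module mapping onto \<open>P\<close> can then be realised in
  that type.\<close>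

definition projective_module :: "('r, 'e) ring_scheme \<Rightarrow> ('r, 'u) module \<Rightarrow> bool" where
  "projective_module R P \<longleftrightarrow> right_module R P \<and>
    (\<forall>(M :: ('r, 'u) module) (N :: ('r, 'u) module) f g.
      right_module R M \<longrightarrow> right_module R N \<longrightarrow>
      f \<in> right_hom R M N \<longrightarrow> f ` carrier M = carrier N \<longrightarrow> g \<in> right_hom R P N \<longrightarrow>
      (\<exists>h \<in> right_hom R P M. \<forall>x \<in> carrier P. f (h x) = g x))"

text \<open>An exact sequence \<open>0 \<rightarrow> P n \<rightarrow> \<dots> \<rightarrow> P 1 \<rightarrow> P 0 \<rightarrow> M \<rightarrow> 0\<close>, continued by zero modules in degrees
  above \<open>n\<close>; \<open>d i\<close> maps \<open>P (i + 1)\<close> to \<open>P i\<close>, and \<open>e\<close> is the augmentation. For \<open>M\<close> with elements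
  in \<open>'m\<close>, the resolving modules are taken in the type \<open>('r \<times> 'm) list\<close>: it is infinite and both
  \<open>'r\<close> and \<open>'m\<close> inject into it, so it accommodates all (iterated) free modules needed to resolve
  \<open>M\<close>.\<close>

definition projective_resolution ::
    "('r, 'e) ring_scheme \<Rightarrow> ('r, 'm) module \<Rightarrow> nat \<Rightarrow> (nat \<Rightarrow> ('r, ('r \<times> 'm) list) module)
      \<Rightarrow> (nat \<Rightarrow> ('r \<times> 'm) list \<Rightarrow> ('r \<times> 'm) list) \<Rightarrow> (('r \<times> 'm) list \<Rightarrow> 'm) \<Rightarrow> bool" where
  "projective_resolution R M n P d e \<longleftrightarrow>
    (\<forall>i. projective_module R (P i)) \<and>
    (\<forall>i>n. carrier (P i) = {\<zero>\<^bsub>P i\<^esub>}) \<and>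
    (\<forall>i. d i \<in> right_hom R (P (Suc i)) (P i)) \<and>
    e \<in> right_hom R (P 0) M \<and>
    e ` carrier (P 0) = carrier M \<and>
    {x \<in> carrier (P 0). e x = \<zero>\<^bsub>M\<^esub>} = d 0 ` carrier (P (Suc 0)) \<and>
    (\<forall>i. {x \<in> carrier (P (Suc i)). d i x = \<zero>\<^bsub>P i\<^esub>} = d (Suc i) ` carrier (P (Suc (Suc i))))"

text \<open>\<open>\<infinity>\<close> if there is no finite resolution; the zero module gets dimension \<open>0\<close>.\<close>

definition proj_dim :: "('r, 'e) ring_scheme \<Rightarrow> ('r, 'm) module \<Rightarrow> enat" where
  "proj_dim R M = Inf {enat n | n. \<exists>P d e. projective_resolution R M n P d e}"

text \<open>The (right) global dimension, measured on all right modules with elements in \<open>'m\<close>. A theorem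
  about it that leaves the type variable \<open>'m\<close> arbitrary speaks about all right modules.\<close>

definition gl_dim :: "'m itself \<Rightarrow> ('r, 'e) ring_scheme \<Rightarrow> enat" where
  "gl_dim _ R = Sup {proj_dim R M | M :: ('r, 'm) module. right_module R M}"


section \<open>Path algebras\<close>

text \<open>A quiver is a \<open>pre_digraph\<close> (loops and parallel arrows allowed). A path is a triple of its start
  vertex, its list of arrows, and its end vertex; the path of length zero at \<open>v\<close> is
  \<open>(v, [], v)\<close>.\<close>

type_synonym ('v, 'a) qpath = "'v \<times> 'a list \<times> 'v"

definition qpaths :: "('v, 'a) pre_digraph \<Rightarrow> ('v, 'a) qpath set" where
  "qpaths Q = {(v, p, w). pre_digraph.awalk Q v p w}"

definition path_start :: "('v, 'a) qpath \<Rightarrow> 'v" where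
  "path_start p = fst p"

definition path_end :: "('v, 'a) qpath \<Rightarrow> 'v" where
  "path_end p = snd (snd p)"

definition vertex_path :: "'v \<Rightarrow> ('v, 'a) qpath" where
  "vertex_path v = (v, [], v)"

text \<open>Only meaningful if \<open>path_end p = path_start q\<close>.\<close>

definition path_comp :: "('v, 'a) qpath \<Rightarrow> ('v, 'a) qpath \<Rightarrow> ('v, 'a) qpath" where
  "path_comp p q = (path_start p, fst (snd p) @ fst (snd q), path_end q)"

definition path_algebra ::
    "('k, 'e) ring_scheme \<Rightarrow> ('v, 'a) pre_digraph \<Rightarrow> ('k, ('v, 'a) qpath \<Rightarrow> 'k) module" where
  "path_algebra K Q =
    \<lparr>carrier = {f. (\<forall>p \<in> qpaths Q. f p \<in> carrier K) \<and> (\<forall>p. p \<notin> qpaths Q \<longrightarrow> f p = \<zero>\<^bsub>K\<^esub>) \<and>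
                   finite {p. f p \<noteq> \<zero>\<^bsub>K\<^esub>}},
     mult = (\<lambda>f g r. finsum K (\<lambda>(p, q). f p \<otimes>\<^bsub>K\<^esub> g q)
               {(p, q). p \<in> qpaths Q \<and> q \<in> qpaths Q \<and> path_end p = path_start q \<and> path_comp p q = r}),
     one = (\<lambda>p. if p \<in> vertex_path ` verts Q then \<one>\<^bsub>K\<^esub> else \<zero>\<^bsub>K\<^esub>),
     zero = (\<lambda>p. \<zero>\<^bsub>K\<^esub>),
     add = (\<lambda>f g p. f p \<oplus>\<^bsub>K\<^esub> g p),
     smult = (\<lambda>k f p. k \<otimes>\<^bsub>K\<^esub> f p)\<rparr>"

definition path_elem :: "('k, 'e) ring_scheme \<Rightarrow> ('v, 'a) qpath \<Rightarrow> ('v, 'a) qpath \<Rightarrow> 'k" where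
  "path_elem K p = (\<lambda>q. if q = p then \<one>\<^bsub>K\<^esub> else \<zero>\<^bsub>K\<^esub>)"


section \<open>The commuting algebra and the skeleton\<close>

definition commuting_ideal ::
    "('k, 'e) ring_scheme \<Rightarrow> ('v, 'a) pre_digraph \<Rightarrow> (('v, 'a) qpath \<Rightarrow> 'k) set" where
  "commuting_ideal K Q =
    Idl\<^bsub>path_algebra K Q\<^esub>
      {path_elem K p \<ominus>\<^bsub>path_algebra K Q\<^esub> path_elem K q | p q.
        p \<in> qpaths Q \<and> q \<in> qpaths Q \<and> path_start p = path_start q \<and> path_end p = path_end q}"

definition commuting_proj ::
    "('k, 'e) ring_scheme \<Rightarrow> ('v, 'a) pre_digraph \<Rightarrow> (('v, 'a) qpath \<Rightarrow> 'k)
      \<Rightarrow> (('v, 'a) qpath \<Rightarrow> 'k) set" where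
  "commuting_proj K Q x = commuting_ideal K Q +>\<^bsub>path_algebra K Q\<^esub> x"

text \<open>The library's quotient ring, equipped with the induced scalar multiplication: the union below
  is the coset of \<open>k \<odot> x\<close> for any \<open>x \<in> X\<close>.\<close>

definition commuting_algebra ::
    "('k, 'e) ring_scheme \<Rightarrow> ('v, 'a) pre_digraph \<Rightarrow> ('k, (('v, 'a) qpath \<Rightarrow> 'k) set) module" where
  "commuting_algebra K Q =
    ring.extend (path_algebra K Q Quot commuting_ideal K Q)
      (module.fields (\<lambda>k X. \<Union>x\<in>X. commuting_proj K Q (k \<odot>\<^bsub>path_algebra K Q\<^esub> x)))"

definition joined_by_path :: "('v, 'a) pre_digraph \<Rightarrow> 'v \<Rightarrow> 'v \<Rightarrow> bool" where
  "joined_by_path Q v w \<longleftrightarrow> (\<exists>p \<in> qpaths Q. path_start p = v \<and> path_end p = w)"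

definition path_components :: "('v, 'a) pre_digraph \<Rightarrow> 'v set set" where
  "path_components Q =
    verts Q // {(v, w). v \<in> verts Q \<and> w \<in> verts Q \<and> joined_by_path Q v w \<and> joined_by_path Q w v}"

text \<open>The index set is the set of path connected components itself, and \<open>w D\<close> is the vertex chosen
  in the component \<open>D\<close>.\<close>

definition skeleton ::
    "('k, 'e) ring_scheme \<Rightarrow> ('v, 'a) pre_digraph \<Rightarrow> ('v set \<Rightarrow> 'v)
      \<Rightarrow> ('k, ('v set \<Rightarrow> (('v, 'a) qpath \<Rightarrow> 'k) set) \<Rightarrow> ('v set \<Rightarrow> (('v, 'a) qpath \<Rightarrow> 'k) set)) module"
  where
  "skeleton K Q w =
    End_algebra (commuting_algebra K Q)
      (direct_sum_module (path_components Q)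
        (\<lambda>D. principal_right_module (commuting_algebra K Q)
               (commuting_proj K Q (path_elem K (vertex_path (w D))))))"

text \<open>The vertex of the skeleton corresponding to a component \<open>D\<close> is represented by \<open>D\<close>.\<close>

definition skeleton_verts :: "('v, 'a) pre_digraph \<Rightarrow> 'v set set" where
  "skeleton_verts Q = path_components Q"

definition skeleton_le ::
    "('v, 'a) pre_digraph \<Rightarrow> ('v set \<Rightarrow> 'v) \<Rightarrow> 'v set \<Rightarrow> 'v set \<Rightarrow> bool" where
  "skeleton_le Q w D E \<longleftrightarrow> joined_by_path Q (w D) (w E)"

text \<open>The length of a chain is its number of elements.\<close>

definition longest_chain_length :: "'s set \<Rightarrow> ('s \<Rightarrow> 's \<Rightarrow> bool) \<Rightarrow> nat" where
  "longest_chain_length S leq =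
    Max {length xs | xs. set xs \<subseteq> S \<and> sorted_wrt (\<lambda>x y. leq x y \<and> x \<noteq> y) xs}"

end

theory Submission
  imports Defs
begin

text \<open>Both algebras are incidence algebras of finite preorders, that is, algebras of matrices over \<open>K\<close>
  whose entry at \<open>(v, w)\<close> vanishes unless \<open>v\<close> is below \<open>w\<close>. For \<open>KQ/C\<close> the preorder is
  reachability of vertices: dividing by \<open>C\<close> identifies parallel paths, so an element of \<open>KQ/C\<close> only
  remembers, for every pair \<open>(v, w)\<close>, the sum of its coefficients over all paths from \<open>v\<close> to \<open>w\<close>
  (\<open>commuting_ideal_eq_kernel\<close>, \<open>\<psi>_iso\<close>). For the skeleton it is the partial order of the components:
  a homomorphism from \<open>e\<^sub>j A\<close> to \<open>e\<^sub>i A\<close> is left multiplication by an element of \<open>e\<^sub>i A e\<^sub>j\<close>, which is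
  a copy of \<open>K\<close> or zero (\<open>\<xi>_iso\<close>). In particular both algebras are finite dimensional.

  For the global dimension let \<open>R\<close> be the incidence algebra of a finite preorder with matrix units
  \<open>E v w\<close>, choose a representative in every class of equivalent vertices, and let \<open>M\<close> be a right
  module. Write \<open>M\<^sub>d\<close> for the \<open>K\<close>-space \<open>M \<sqdot> E d d\<close>. The module \<open>\<Oplus>\<^sub>d M\<^sub>d \<otimes>\<^sub>K E d d R\<close>, with \<open>d\<close> running
  over the representatives, maps onto \<open>M\<close> by multiplication. It is projective, because a homomorphism
  out of it amounts to a family of \<open>K\<close>-linear maps out of the \<open>M\<^sub>d\<close>, and \<open>K\<close>-linear maps lift along
  surjections (\<open>right_hom_section\<close>, \<open>cover_lifting\<close>). An element of it at the vertex \<open>v\<close> is a sum of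
  terms from \<open>M\<^sub>d\<close> with \<open>d\<close> below \<open>v\<close>; the term with \<open>d\<close> equivalent to \<open>v\<close> is determined by the image
  in \<open>M\<close> and the other terms. Hence if \<open>M\<close> vanishes at all vertices of height at most \<open>k\<close>, then the
  kernel vanishes at all vertices of height at most \<open>k + 1\<close> (\<open>kernel_vanishes\<close>). Here the height of a
  vertex is the length of the longest chain of components ending at its own, so after as many steps as
  the longest chain has elements the kernel is zero, and splicing the covers gives a projective
  resolution of that length (\<open>has_resolution_lists\<close>, \<open>gl_dim_le\<close>).

  The resolving modules have to live in a fixed type of lists. An element of the cover is a finite
  family of elements of \<open>M\<close>. If these are lists of a fixed length, then concatenation encodes the family
  as one list, again of a fixed length, so the construction can be iterated within the type
  (\<open>cover_embeds_in_lists\<close>).\<close>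

section \<open>Right modules and resolutions\<close>

lemma right_homI:
  assumes "\<And>x. x \<in> carrier M \<Longrightarrow> f x \<in> carrier N"
    and "\<And>x y. x \<in> carrier M \<Longrightarrow> y \<in> carrier M \<Longrightarrow> f (x \<oplus>\<^bsub>M\<^esub> y) = f x \<oplus>\<^bsub>N\<^esub> f y"
    and "\<And>a x. a \<in> carrier R \<Longrightarrow> x \<in> carrier M \<Longrightarrow> f (a \<odot>\<^bsub>M\<^esub> x) = a \<odot>\<^bsub>N\<^esub> f x"
  shows "f \<in> right_hom R M N"
  using assms by (auto simp: LinearCombinations.module_hom_def)

lemma right_hom_closed: "f \<in> right_hom R M N \<Longrightarrow> x \<in> carrier M \<Longrightarrow> f x \<in> carrier N"
  and right_hom_add: "f \<in> right_hom R M N \<Longrightarrow> x \<in> carrier M \<Longrightarrow> y \<in> carrier M \<Longrightarrow>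
    f (x \<oplus>\<^bsub>M\<^esub> y) = f x \<oplus>\<^bsub>N\<^esub> f y"
  and right_hom_smult: "f \<in> right_hom R M N \<Longrightarrow> a \<in> carrier R \<Longrightarrow> x \<in> carrier M \<Longrightarrow>
    f (a \<odot>\<^bsub>M\<^esub> x) = a \<odot>\<^bsub>N\<^esub> f x"
  by (auto simp: LinearCombinations.module_hom_def)

lemma right_hom_comp:
  assumes "f \<in> right_hom R M N" "g \<in> right_hom R N L"
  shows "(\<lambda>x. g (f x)) \<in> right_hom R M L"
  using assms by (intro right_homI) (auto simp: right_hom_closed right_hom_add right_hom_smult)

context right_module
begin

lemma rsmult_zero_ring [simp]:
  assumes "x \<in> carrier M"
  shows "\<zero>\<^bsub>R\<^esub> \<odot>\<^bsub>M\<^esub> x = \<zero>\<^bsub>M\<^esub>"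
proof -
  have "\<zero>\<^bsub>R\<^esub> \<odot>\<^bsub>M\<^esub> x \<oplus>\<^bsub>M\<^esub> \<zero>\<^bsub>R\<^esub> \<odot>\<^bsub>M\<^esub> x = \<zero>\<^bsub>R\<^esub> \<odot>\<^bsub>M\<^esub> x \<oplus>\<^bsub>M\<^esub> \<zero>\<^bsub>M\<^esub>"
    using rsmult_distr_ring[of "\<zero>\<^bsub>R\<^esub>" "\<zero>\<^bsub>R\<^esub>" x] assms rsmult_closed by simp
  then show ?thesis using assms rsmult_closed by simp
qed

lemma rsmult_zero_module [simp]:
  assumes "a \<in> carrier R"
  shows "a \<odot>\<^bsub>M\<^esub> \<zero>\<^bsub>M\<^esub> = \<zero>\<^bsub>M\<^esub>"
proof -
  have "a \<odot>\<^bsub>M\<^esub> \<zero>\<^bsub>M\<^esub> \<oplus>\<^bsub>M\<^esub> a \<odot>\<^bsub>M\<^esub> \<zero>\<^bsub>M\<^esub> = a \<odot>\<^bsub>M\<^esub> \<zero>\<^bsub>M\<^esub> \<oplus>\<^bsub>M\<^esub> \<zero>\<^bsub>M\<^esub>"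
    using rsmult_distr_module[of a "\<zero>\<^bsub>M\<^esub>" "\<zero>\<^bsub>M\<^esub>"] assms rsmult_closed by simp
  then show ?thesis using assms rsmult_closed by simp
qed

lemma rsmult_minus_one:
  assumes "x \<in> carrier M"
  shows "(\<ominus>\<^bsub>R\<^esub> \<one>\<^bsub>R\<^esub>) \<odot>\<^bsub>M\<^esub> x = \<ominus>\<^bsub>M\<^esub> x"
proof -
  have "(\<ominus>\<^bsub>R\<^esub> \<one>\<^bsub>R\<^esub>) \<odot>\<^bsub>M\<^esub> x \<oplus>\<^bsub>M\<^esub> x = \<zero>\<^bsub>M\<^esub>"
    using rsmult_distr_ring[of "\<ominus>\<^bsub>R\<^esub> \<one>\<^bsub>R\<^esub>" "\<one>\<^bsub>R\<^esub>" x] assms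
    by (simp add: R.l_neg rsmult_one)
  then show ?thesis using assms rsmult_closed by (simp add: M.minus_equality)
qed

lemma rsmult_finsum:
  assumes "a \<in> carrier R" "f \<in> I \<rightarrow> carrier M"
  shows "a \<odot>\<^bsub>M\<^esub> (\<Oplus>\<^bsub>M\<^esub>i\<in>I. f i) = (\<Oplus>\<^bsub>M\<^esub>i\<in>I. a \<odot>\<^bsub>M\<^esub> f i)"
  using assms(2)
proof (induction I rule: infinite_finite_induct)
  case (insert i I)
  then show ?case using assms(1)
    by (simp add: Pi_iff rsmult_distr_module rsmult_closed M.finsum_closed)
qed (use assms in auto)

lemma finsum_rsmult:
  assumes "x \<in> carrier M" "f \<in> I \<rightarrow> carrier R"
  shows "(\<Oplus>\<^bsub>R\<^esub>i\<in>I. f i) \<odot>\<^bsub>M\<^esub> x = (\<Oplus>\<^bsub>M\<^esub>i\<in>I. f i \<odot>\<^bsub>M\<^esub> x)"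
  using assms(2)
proof (induction I rule: infinite_finite_induct)
  case (insert i I)
  then show ?case using assms(1)
    by (simp add: Pi_iff rsmult_distr_ring rsmult_closed R.finsum_closed)
qed (use assms in auto)

lemma right_hom_zero:
  assumes "right_module R N" "f \<in> right_hom R M N"
  shows "f \<zero>\<^bsub>M\<^esub> = \<zero>\<^bsub>N\<^esub>"
proof -
  interpret N: right_module R N by fact
  have "f (\<zero>\<^bsub>R\<^esub> \<odot>\<^bsub>M\<^esub> \<zero>\<^bsub>M\<^esub>) = \<zero>\<^bsub>R\<^esub> \<odot>\<^bsub>N\<^esub> f \<zero>\<^bsub>M\<^esub>"
    by (rule right_hom_smult[OF assms(2)]) auto
  then show ?thesis using right_hom_closed[OF assms(2)] by simp
qed

lemma right_hom_finsum:
  assumes "right_module R N" "f \<in> right_hom R M N" "g \<in> I \<rightarrow> carrier M"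
  shows "f (\<Oplus>\<^bsub>M\<^esub>i\<in>I. g i) = (\<Oplus>\<^bsub>N\<^esub>i\<in>I. f (g i))"
proof -
  interpret N: right_module R N by fact
  show ?thesis using assms(3)
  proof (induction I rule: infinite_finite_induct)
    case (insert i I)
    then show ?case using right_hom_closed[OF assms(2)] right_hom_add[OF assms(2)]
      by (simp add: Pi_iff M.finsum_closed)
  qed (auto simp: right_hom_zero[OF assms(1,2)])
qed

end

text \<open>The module axioms are equations, so they can be checked after applying an injective map into a
  module. The inverse of \<open>x\<close> is the product of \<open>x\<close> with \<open>- 1\<close>.\<close>

lemma right_module_of_embedding:
  fixes R :: "('r, 'e) ring_scheme" and M :: "('r, 'm, 'f) module_scheme" and N :: "('r, 'n, 'g) module_scheme"
  assumes "right_module R M"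
    and f: "f \<in> right_hom R N M" and inj: "inj_on f (carrier N)"
    and zero: "\<zero>\<^bsub>N\<^esub> \<in> carrier N" "f \<zero>\<^bsub>N\<^esub> = \<zero>\<^bsub>M\<^esub>"
    and add: "\<And>x y. x \<in> carrier N \<Longrightarrow> y \<in> carrier N \<Longrightarrow> x \<oplus>\<^bsub>N\<^esub> y \<in> carrier N"
    and smult: "\<And>a x. a \<in> carrier R \<Longrightarrow> x \<in> carrier N \<Longrightarrow> a \<odot>\<^bsub>N\<^esub> x \<in> carrier N"
  shows "right_module R N"
proof -
  interpret M: right_module R M by fact
  note f_simps = right_hom_closed[OF f] right_hom_add[OF f] right_hom_smult[OF f] add smult zero
  have eqI: "x = y" if "x \<in> carrier N" "y \<in> carrier N" "f x = f y" for x y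
    using inj that by (auto dest: inj_onD)
  have "abelian_group N"
  proof (rule abelian_groupI)
    fix x assume x: "x \<in> carrier N"
    have "f ((\<ominus>\<^bsub>R\<^esub> \<one>\<^bsub>R\<^esub>) \<odot>\<^bsub>N\<^esub> x \<oplus>\<^bsub>N\<^esub> x) = f \<zero>\<^bsub>N\<^esub>"
      using x by (simp add: f_simps M.rsmult_minus_one M.M.l_neg)
    then show "\<exists>y\<in>carrier N. y \<oplus>\<^bsub>N\<^esub> x = \<zero>\<^bsub>N\<^esub>"
      using x by (intro bexI[of _ "(\<ominus>\<^bsub>R\<^esub> \<one>\<^bsub>R\<^esub>) \<odot>\<^bsub>N\<^esub> x"] eqI) (simp_all add: f_simps)
  qed (auto intro!: eqI simp: f_simps M.M.a_ac)
  moreover have "right_module_axioms R N"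
    by unfold_locales
      (auto intro!: eqI simp: f_simps M.rsmult_distr_ring M.rsmult_distr_module M.rsmult_assoc
        M.rsmult_one)
  ultimately show ?thesis
    using M.R.ring_axioms by (simp add: right_module_def)
qed

lemma right_module_kernel:
  assumes "right_module R M" "right_module R N" and f: "f \<in> right_hom R M N"
  shows "right_module R (M\<lparr>carrier := {x \<in> carrier M. f x = \<zero>\<^bsub>N\<^esub>}\<rparr>)"
proof -
  interpret M: right_module R M by fact
  interpret N: right_module R N by fact
  note f_simps = right_hom_closed[OF f] right_hom_add[OF f] right_hom_smult[OF f]
  show ?thesis
    by (rule right_module_of_embedding[where M = M and f = "\<lambda>x. x"])
      (auto intro: assms right_homI simp: f_simps M.rsmult_closed M.right_hom_zero[OF assms(2,3)])
qed

text \<open>Transport of structure along an injection, used to realise a module in a prescribed type.\<close>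

definition image_module :: "('n \<Rightarrow> 'u) \<Rightarrow> ('r, 'n) module \<Rightarrow> ('r, 'u) module" where
  "image_module \<iota> M =
    \<lparr>carrier = \<iota> ` carrier M, mult = undefined, one = undefined, zero = \<iota> \<zero>\<^bsub>M\<^esub>,
     add = (\<lambda>x y. \<iota> (inv_into (carrier M) \<iota> x \<oplus>\<^bsub>M\<^esub> inv_into (carrier M) \<iota> y)),
     smult = (\<lambda>a x. \<iota> (a \<odot>\<^bsub>M\<^esub> inv_into (carrier M) \<iota> x))\<rparr>"

lemma image_module:
  assumes M: "right_module R M" and inj: "inj_on \<iota> (carrier M)"
  shows right_module_image_module: "right_module R (image_module \<iota> M)"
    and right_hom_image_module: "\<iota> \<in> right_hom R M (image_module \<iota> M)"
    and right_hom_inv_image_module: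
      "inv_into (carrier M) \<iota> \<in> right_hom R (image_module \<iota> M) M"
    and carrier_image_module: "carrier (image_module \<iota> M) = \<iota> ` carrier M"
    and zero_image_module: "\<zero>\<^bsub>image_module \<iota> M\<^esub> = \<iota> \<zero>\<^bsub>M\<^esub>"
proof -
  interpret M: right_module R M by fact
  show carrier: "carrier (image_module \<iota> M) = \<iota> ` carrier M"
    and zero: "\<zero>\<^bsub>image_module \<iota> M\<^esub> = \<iota> \<zero>\<^bsub>M\<^esub>" by (simp_all add: image_module_def)
  show "\<iota> \<in> right_hom R M (image_module \<iota> M)"
    using inj by (intro right_homI) (simp_all add: image_module_def)
  show inv: "inv_into (carrier M) \<iota> \<in> right_hom R (image_module \<iota> M) M"
    using inj by (intro right_homI) (auto simp: image_module_def M.rsmult_closed)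
  show "right_module R (image_module \<iota> M)"
    using inj by (intro right_module_of_embedding[OF M inv])
      (auto simp: image_module_def M.rsmult_closed inj_on_inv_into)
qed

text \<open>Projectivity refers to test modules in the type of the module itself. The lifting property assumed
  here relates a module in one type to test modules in another, so it can be verified for a convenient
  model of \<open>P\<close> before that model is moved into the type \<open>'u\<close>.\<close>

lemma projective_image_module:
  fixes R :: "('r, 'e) ring_scheme" and P :: "('r, 'n) module" and \<iota> :: "'n \<Rightarrow> 'u"
  assumes P: "right_module R P" and inj: "inj_on \<iota> (carrier P)"
    and lift: "\<And>(M :: ('r, 'u) module) (N :: ('r, 'u) module) f g.
      \<lbrakk>right_module R M; right_module R N; f \<in> right_hom R M N; f ` carrier M = carrier N;
        g \<in> right_hom R P N\<rbrakk> \<Longrightarrow> \<exists>h \<in> right_hom R P M. \<forall>x \<in> carrier P. f (h x) = g x"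
  shows "projective_module R (image_module \<iota> P)"
  unfolding projective_module_def
proof (intro conjI allI impI)
  note image = image_module[OF P inj]
  show "right_module R (image_module \<iota> P)" by (rule image)
  fix M N :: "('r, 'u) module" and f g
  assume "right_module R M" "right_module R N" "f \<in> right_hom R M N" "f ` carrier M = carrier N"
    and g: "g \<in> right_hom R (image_module \<iota> P) N"
  then obtain h where h: "h \<in> right_hom R P M" "\<forall>x \<in> carrier P. f (h x) = g (\<iota> x)"
    using lift[of M N f "\<lambda>x. g (\<iota> x)"] right_hom_comp[OF image(2) g] by blast
  show "\<exists>h\<in>right_hom R (image_module \<iota> P) M. \<forall>x\<in>carrier (image_module \<iota> P). f (h x) = g x"
    using right_hom_comp[OF image(3) h(1)] h(2) inj
    by (intro bexI) (auto simp: image(4))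
qed

lemma projective_zero_module:
  fixes R :: "('r, 'e) ring_scheme" and P :: "('r, 'u) module"
  assumes P: "right_module R P" and zero: "carrier P = {\<zero>\<^bsub>P\<^esub>}"
  shows "projective_module R P"
  unfolding projective_module_def
proof (intro conjI allI impI)
  interpret P: right_module R P by (rule P)
  show "right_module R P" by (rule P)
  fix M N :: "('r, 'u) module" and f g
  assume M: "right_module R M" and N: "right_module R N" and f: "f \<in> right_hom R M N"
    and g: "g \<in> right_hom R P N"
  interpret M: right_module R M by fact
  have "(\<lambda>x. \<zero>\<^bsub>M\<^esub>) \<in> right_hom R P M" by (rule right_homI) auto
  moreover have "f \<zero>\<^bsub>M\<^esub> = g x" if "x \<in> carrier P" for x
    using that zero M.right_hom_zero[OF N f] P.right_hom_zero[OF N g] by simp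
  ultimately show "\<exists>h\<in>right_hom R P M. \<forall>x\<in>carrier P. f (h x) = g x"
    by (intro bexI[of _ "\<lambda>x. \<zero>\<^bsub>M\<^esub>"] ballI)
qed

text \<open>The conditions on a projective resolution, with the type of the resolving modules left open: in
  the induction on the length it stays the same while \<open>M\<close> is replaced by a kernel, which lives in that
  type already.\<close>

definition resolves ::
    "('r, 'e) ring_scheme \<Rightarrow> ('r, 'm) module \<Rightarrow> nat \<Rightarrow> (nat \<Rightarrow> ('r, 'u) module)
      \<Rightarrow> (nat \<Rightarrow> 'u \<Rightarrow> 'u) \<Rightarrow> ('u \<Rightarrow> 'm) \<Rightarrow> bool" where
  "resolves R M n P d e \<longleftrightarrow>
    (\<forall>i. projective_module R (P i)) \<and>
    (\<forall>i>n. carrier (P i) = {\<zero>\<^bsub>P i\<^esub>}) \<and>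
    (\<forall>i. d i \<in> right_hom R (P (Suc i)) (P i)) \<and>
    e \<in> right_hom R (P 0) M \<and>
    e ` carrier (P 0) = carrier M \<and>
    {x \<in> carrier (P 0). e x = \<zero>\<^bsub>M\<^esub>} = d 0 ` carrier (P (Suc 0)) \<and>
    (\<forall>i. {x \<in> carrier (P (Suc i)). d i x = \<zero>\<^bsub>P i\<^esub>} = d (Suc i) ` carrier (P (Suc (Suc i))))"

lemma resolvesD:
  assumes "resolves R M n P d e"
  shows "projective_module R (P i)" "i > n \<Longrightarrow> carrier (P i) = {\<zero>\<^bsub>P i\<^esub>}"
    "d i \<in> right_hom R (P (Suc i)) (P i)"
    "e \<in> right_hom R (P 0) M" "e ` carrier (P 0) = carrier M"
    "{x \<in> carrier (P 0). e x = \<zero>\<^bsub>M\<^esub>} = d 0 ` carrier (P (Suc 0))"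
    "{x \<in> carrier (P (Suc i)). d i x = \<zero>\<^bsub>P i\<^esub>} = d (Suc i) ` carrier (P (Suc (Suc i)))"
proof -
  note res = assms[unfolded resolves_def]
  show "projective_module R (P i)" using res by (elim conjE) (erule spec)
  show "carrier (P i) = {\<zero>\<^bsub>P i\<^esub>}" if "i > n" using res that by (elim conjE) (drule spec, erule (1) mp)
  show "d i \<in> right_hom R (P (Suc i)) (P i)" using res by (elim conjE) (erule spec)
  show "e \<in> right_hom R (P 0) M" "e ` carrier (P 0) = carrier M"
    "{x \<in> carrier (P 0). e x = \<zero>\<^bsub>M\<^esub>} = d 0 ` carrier (P (Suc 0))"
    by (rule res[THEN conjunct2, THEN conjunct2, THEN conjunct2, THEN conjunct1],
        rule res[THEN conjunct2, THEN conjunct2, THEN conjunct2, THEN conjunct2, THEN conjunct1],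
        rule res[THEN conjunct2, THEN conjunct2, THEN conjunct2, THEN conjunct2, THEN conjunct2, THEN conjunct1])
  show "{x \<in> carrier (P (Suc i)). d i x = \<zero>\<^bsub>P i\<^esub>} = d (Suc i) ` carrier (P (Suc (Suc i)))"
    using res by (elim conjE) (erule spec)
qed

definition has_resolution ::
    "'u itself \<Rightarrow> ('r, 'e) ring_scheme \<Rightarrow> ('r, 'm) module \<Rightarrow> nat \<Rightarrow> bool" where
  "has_resolution _ R M n \<longleftrightarrow> (\<exists>(P :: nat \<Rightarrow> ('r, 'u) module) d e. resolves R M n P d e)"

lemma proj_dim_le_of_resolution:
  fixes M :: "('r, 'm) module"
  assumes "has_resolution TYPE(('r \<times> 'm) list) R M n"
  shows "proj_dim R M \<le> enat n"
proof -
  from assms obtain P d e where "projective_resolution R M n P d e"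
    unfolding has_resolution_def resolves_def projective_resolution_def[symmetric] by blast
  then show ?thesis
    unfolding proj_dim_def by (intro Inf_lower) blast
qed

lemma has_resolution_zero:
  fixes M :: "('r, 'u) module"
  assumes M: "right_module R M" and zero: "carrier M = {\<zero>\<^bsub>M\<^esub>}"
  shows "has_resolution TYPE('u) R M n"
proof -
  have id: "(\<lambda>x. x) \<in> right_hom R M M" by (rule right_homI) auto
  have "resolves R M n (\<lambda>_. M) (\<lambda>_ x. x) (\<lambda>x. x)"
    unfolding resolves_def
    using id projective_zero_module[OF assms] by (simp add: zero)
  then show ?thesis
    unfolding has_resolution_def by blast
qed

text \<open>Splicing: a resolution of the kernel of \<open>p\<close>, continued by the composite of its augmentation with the
  inclusion into \<open>P\<close>, is a resolution of \<open>M\<close> that is longer by one.\<close>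

lemma has_resolution_extend:
  fixes P :: "('r, 'u) module" and M :: "('r, 'm) module"
  assumes P: "projective_module R P" and M: "right_module R M"
    and p: "p \<in> right_hom R P M" "p ` carrier P = carrier M"
    and ker: "has_resolution TYPE('u) R (P\<lparr>carrier := {x \<in> carrier P. p x = \<zero>\<^bsub>M\<^esub>}\<rparr>) n"
  shows "has_resolution TYPE('u) R M (Suc n)"
proof -
  obtain P' :: "nat \<Rightarrow> ('r, 'u) module" and d e where
    res: "resolves R (P\<lparr>carrier := {x \<in> carrier P. p x = \<zero>\<^bsub>M\<^esub>}\<rparr>) n P' d e"
    using ker unfolding has_resolution_def by blast
  note res = resolvesD[OF res, simplified]
  define P'' where "P'' i = (case i of 0 \<Rightarrow> P | Suc j \<Rightarrow> P' j)" for i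
  define d'' where "d'' i = (case i of 0 \<Rightarrow> e | Suc j \<Rightarrow> d j)" for i
  have simps: "P'' 0 = P" "P'' (Suc i) = P' i" "d'' 0 = e" "d'' (Suc i) = d i" for i
    by (simp_all add: P''_def d''_def)
  have e': "e \<in> right_hom R (P' 0) P"
    using res(4) by (auto simp: LinearCombinations.module_hom_def)
  show ?thesis
    unfolding has_resolution_def resolves_def
  proof (rule exI[of _ P''], rule exI[of _ d''], rule exI[of _ p], intro conjI allI impI)
    fix i
    show "projective_module R (P'' i)" using P res(1) by (cases i) (auto simp: simps)
    show "carrier (P'' i) = {\<zero>\<^bsub>P'' i\<^esub>}" if "i > Suc n"
      using that res(2) by (cases i) (auto simp: simps)
    show "d'' i \<in> right_hom R (P'' (Suc i)) (P'' i)"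
      using res(3) e' by (cases i) (auto simp: simps)
    show "{x \<in> carrier (P'' (Suc i)). d'' i x = \<zero>\<^bsub>P'' i\<^esub>} = d'' (Suc i) ` carrier (P'' (Suc (Suc i)))"
      using res(6,7) by (cases i) (simp_all add: simps)
    show "p \<in> right_hom R (P'' 0) M" "p ` carrier (P'' 0) = carrier M"
      unfolding simps by (rule p)+
    show "{x \<in> carrier (P'' 0). p x = \<zero>\<^bsub>M\<^esub>} = d'' 0 ` carrier (P'' (Suc 0))"
      unfolding simps by (rule res(5)[symmetric])
  qed
qed

lemma has_resolution_iso:
  fixes R :: "('r, 'e) ring_scheme" and M :: "('r, 'm) module" and N :: "('r, 'n) module"
  assumes "right_module R M" "right_module R N" and f: "f \<in> right_hom R M N"
    and bij: "bij_betw f (carrier M) (carrier N)"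
    and res: "has_resolution TYPE('u) R M n"
  shows "has_resolution TYPE('u) R N n"
proof -
  interpret M: right_module R M by (rule assms(1))
  from res obtain P :: "nat \<Rightarrow> ('r, 'u) module" and d e where "resolves R M n P d e"
    by (auto simp: has_resolution_def)
  note res = resolvesD[OF this]
  have f_zero: "f \<zero>\<^bsub>M\<^esub> = \<zero>\<^bsub>N\<^esub>" by (rule M.right_hom_zero[OF assms(2) f])
  have "f (e x) = \<zero>\<^bsub>N\<^esub> \<longleftrightarrow> e x = \<zero>\<^bsub>M\<^esub>" if "x \<in> carrier (P 0)" for x
    using inj_on_eq_iff[OF bij_betw_imp_inj_on[OF bij] right_hom_closed[OF res(4) that] M.zero_closed]
    by (simp add: f_zero)
  then have "{x \<in> carrier (P 0). f (e x) = \<zero>\<^bsub>N\<^esub>} = d 0 ` carrier (P (Suc 0))"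
    unfolding res(6)[symmetric] by blast
  moreover have "(\<lambda>x. f (e x)) ` carrier (P 0) = carrier N"
    unfolding bij_betw_imp_surj_on[OF bij, symmetric] res(5)[symmetric] by (rule image_image[symmetric])
  ultimately have "resolves R N n P d (\<lambda>x. f (e x))"
    unfolding resolves_def using res(1-3,7) right_hom_comp[OF res(4) f] by blast
  then show ?thesis unfolding has_resolution_def by blast
qed

section \<open>Vector spaces are projective\<close>

text \<open>By Zorn's lemma there is a maximal subspace \<open>U\<close> that meets the kernel of \<open>f\<close> trivially. It is mapped
  onto \<open>Y\<close>: if \<open>f x\<close> were not in the image of \<open>U\<close>, then the span of \<open>U\<close> and \<open>x\<close> would still meet the
  kernel trivially, because \<open>f u + a \<sqdot> f x = 0\<close> with \<open>a \<noteq> 0\<close> can be solved for \<open>f x\<close>. The inverse of \<open>f\<close> on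
  \<open>U\<close> is the section.\<close>

lemma right_hom_section:
  fixes K :: "('k, 'e) ring_scheme" and X :: "('k, 'x) module" and Y :: "('k, 'y) module"
  assumes "field K" and X: "right_module K X" and Y: "right_module K Y"
    and f: "f \<in> right_hom K X Y" and surj: "f ` carrier X = carrier Y"
  shows "\<exists>s \<in> right_hom K Y X. \<forall>y \<in> carrier Y. f (s y) = y"
proof -
  interpret K: field K by fact
  interpret X: right_module K X by fact
  interpret Y: right_module K Y by fact
  note f_simps = right_hom_closed[OF f] right_hom_add[OF f] right_hom_smult[OF f]
  define \<A> where "\<A> = {U. U \<subseteq> carrier X \<and> \<zero>\<^bsub>X\<^esub> \<in> U \<and> (\<forall>x\<in>U. \<forall>y\<in>U. x \<oplus>\<^bsub>X\<^esub> y \<in> U) \<and>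
    (\<forall>a\<in>carrier K. \<forall>x\<in>U. a \<odot>\<^bsub>X\<^esub> x \<in> U) \<and> (\<forall>x\<in>U. f x = \<zero>\<^bsub>Y\<^esub> \<longrightarrow> x = \<zero>\<^bsub>X\<^esub>)}"
  have "{\<zero>\<^bsub>X\<^esub>} \<in> \<A>" by (auto simp: \<A>_def)
  then have "\<A> \<noteq> {}" by blast
  moreover have "\<Union>\<C> \<in> \<A>" if "\<C> \<noteq> {}" "subset.chain \<A> \<C>" for \<C>
  proof -
    have sub: "U \<in> \<A>" if "U \<in> \<C>" for U using that \<open>subset.chain \<A> \<C>\<close> by (auto simp: subset_chain_def)
    note subD = sub[unfolded \<A>_def, simplified]
    show ?thesis
      unfolding \<A>_def
    proof (intro CollectI conjI ballI impI)
      show "\<Union>\<C> \<subseteq> carrier X" using subD by blast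
      show "\<zero>\<^bsub>X\<^esub> \<in> \<Union>\<C>" using subD \<open>\<C> \<noteq> {}\<close> by blast
      show "a \<odot>\<^bsub>X\<^esub> x \<in> \<Union>\<C>" if "a \<in> carrier K" "x \<in> \<Union>\<C>" for a x
        using that subD by blast
      show "x = \<zero>\<^bsub>X\<^esub>" if "x \<in> \<Union>\<C>" "f x = \<zero>\<^bsub>Y\<^esub>" for x
        using that subD by blast
      fix x y assume "x \<in> \<Union>\<C>" "y \<in> \<Union>\<C>"
      then obtain U U' where U: "x \<in> U" "U \<in> \<C>" "y \<in> U'" "U' \<in> \<C>" by blast
      then have "U \<subseteq> U' \<or> U' \<subseteq> U" using \<open>subset.chain \<A> \<C>\<close> by (auto simp: subset_chain_def)
      then obtain W where "x \<in> W" "y \<in> W" "W \<in> \<C>" using U by blast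
      then show "x \<oplus>\<^bsub>X\<^esub> y \<in> \<Union>\<C>" using subD[of W] by blast
    qed
  qed
  ultimately obtain U where U: "U \<in> \<A>" and max: "\<And>U'. U' \<in> \<A> \<Longrightarrow> U \<subseteq> U' \<Longrightarrow> U' = U"
    using subset_Zorn_nonempty[of \<A>] by metis
  have U_sub: "\<And>x. x \<in> U \<Longrightarrow> x \<in> carrier X" and U_zero: "\<zero>\<^bsub>X\<^esub> \<in> U"
    and U_add: "\<And>x y. x \<in> U \<Longrightarrow> y \<in> U \<Longrightarrow> x \<oplus>\<^bsub>X\<^esub> y \<in> U"
    and U_smult: "\<And>a x. a \<in> carrier K \<Longrightarrow> x \<in> U \<Longrightarrow> a \<odot>\<^bsub>X\<^esub> x \<in> U"
    and U_ker: "\<And>x. x \<in> U \<Longrightarrow> f x = \<zero>\<^bsub>Y\<^esub> \<Longrightarrow> x = \<zero>\<^bsub>X\<^esub>"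
    using U unfolding \<A>_def by auto
  have neg: "\<ominus>\<^bsub>X\<^esub> x \<in> U" if "x \<in> U" for x
    using U_smult[of "\<ominus>\<^bsub>K\<^esub> \<one>\<^bsub>K\<^esub>" x] that U_sub by (simp add: X.rsmult_minus_one)
  have f_neg: "f (\<ominus>\<^bsub>X\<^esub> x) = \<ominus>\<^bsub>Y\<^esub> f x" if "x \<in> carrier X" for x
    using that f_simps(3)[of "\<ominus>\<^bsub>K\<^esub> \<one>\<^bsub>K\<^esub>" x] by (simp add: X.rsmult_minus_one Y.rsmult_minus_one f_simps)
  have onto: "\<exists>u\<in>U. f u = y" if "y \<in> carrier Y" for y
  proof (rule ccontr)
    assume no: "\<not> (\<exists>u\<in>U. f u = y)"
    obtain x where x: "x \<in> carrier X" "f x = y" using \<open>y \<in> carrier Y\<close> unfolding surj[symmetric] by blast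
    define U' where "U' = {u \<oplus>\<^bsub>X\<^esub> a \<odot>\<^bsub>X\<^esub> x | u a. u \<in> U \<and> a \<in> carrier K}"
    have U'I: "u \<oplus>\<^bsub>X\<^esub> a \<odot>\<^bsub>X\<^esub> x \<in> U'" if "u \<in> U" "a \<in> carrier K" for u a
      using that unfolding U'_def by blast
    \<comment> \<open>The span of \<open>U\<close> and \<open>x\<close> still meets the kernel of \<open>f\<close> trivially.\<close>
    have "U' \<in> \<A>"
      unfolding \<A>_def
    proof (intro CollectI conjI ballI impI)
      show "U' \<subseteq> carrier X" using U_sub x by (auto simp: U'_def X.rsmult_closed)
      show "\<zero>\<^bsub>X\<^esub> \<in> U'" using U'I[OF U_zero K.zero_closed] x by simp
    next
      fix z z' assume "z \<in> U'" "z' \<in> U'"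
      then obtain u a u' a' where z: "z = u \<oplus>\<^bsub>X\<^esub> a \<odot>\<^bsub>X\<^esub> x" "z' = u' \<oplus>\<^bsub>X\<^esub> a' \<odot>\<^bsub>X\<^esub> x"
        and u: "u \<in> U" "u' \<in> U" "a \<in> carrier K" "a' \<in> carrier K" unfolding U'_def by blast
      have "z \<oplus>\<^bsub>X\<^esub> z' = (u \<oplus>\<^bsub>X\<^esub> u') \<oplus>\<^bsub>X\<^esub> (a \<oplus>\<^bsub>K\<^esub> a') \<odot>\<^bsub>X\<^esub> x"
        unfolding z using u x U_sub by (simp add: X.rsmult_distr_ring X.rsmult_closed X.M.a_ac)
      then show "z \<oplus>\<^bsub>X\<^esub> z' \<in> U'" using U'I u U_add by simp
    next
      fix b z assume b: "b \<in> carrier K" and "z \<in> U'"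
      then obtain u a where z: "z = u \<oplus>\<^bsub>X\<^esub> a \<odot>\<^bsub>X\<^esub> x"
        and u: "u \<in> U" "a \<in> carrier K" unfolding U'_def by blast
      have "b \<odot>\<^bsub>X\<^esub> z = (b \<odot>\<^bsub>X\<^esub> u) \<oplus>\<^bsub>X\<^esub> (a \<otimes>\<^bsub>K\<^esub> b) \<odot>\<^bsub>X\<^esub> x"
        unfolding z using u x b U_sub by (simp add: X.rsmult_distr_module X.rsmult_closed X.rsmult_assoc)
      then show "b \<odot>\<^bsub>X\<^esub> z \<in> U'" using U'I[OF U_smult[OF b u(1)]] u b by simp
    next
      fix z assume "z \<in> U'" and fz: "f z = \<zero>\<^bsub>Y\<^esub>"
      then obtain u a where z: "z = u \<oplus>\<^bsub>X\<^esub> a \<odot>\<^bsub>X\<^esub> x"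
        and u: "u \<in> U" "a \<in> carrier K" unfolding U'_def by blast
      have sum: "f u \<oplus>\<^bsub>Y\<^esub> a \<odot>\<^bsub>Y\<^esub> y = \<zero>\<^bsub>Y\<^esub>"
        using fz u x U_sub unfolding z by (simp add: f_simps X.rsmult_closed)
      show "z = \<zero>\<^bsub>X\<^esub>"
      proof (cases "a = \<zero>\<^bsub>K\<^esub>")
        case True
        then have "z = u" using z u x U_sub by simp
        then show ?thesis using U_ker u fz by simp
      next
        case False
        then have unit: "inv\<^bsub>K\<^esub> a \<in> carrier K" "a \<otimes>\<^bsub>K\<^esub> inv\<^bsub>K\<^esub> a = \<one>\<^bsub>K\<^esub>"
          using u K.field_Units by auto
        have "a \<odot>\<^bsub>Y\<^esub> y = \<ominus>\<^bsub>Y\<^esub> f u"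
          using sum u \<open>y \<in> carrier Y\<close> U_sub
          by (intro Y.M.minus_equality[symmetric]) (simp_all add: f_simps Y.rsmult_closed Y.M.a_comm)
        then have "f (inv\<^bsub>K\<^esub> a \<odot>\<^bsub>X\<^esub> (\<ominus>\<^bsub>X\<^esub> u)) = inv\<^bsub>K\<^esub> a \<odot>\<^bsub>Y\<^esub> (a \<odot>\<^bsub>Y\<^esub> y)"
          using u unit U_sub by (simp add: f_simps f_neg)
        also have "\<dots> = y"
          using unit u \<open>y \<in> carrier Y\<close> by (simp flip: Y.rsmult_assoc add: Y.rsmult_one)
        finally show ?thesis using no U_smult[OF unit(1) neg[OF u(1)]] by blast
      qed
    qed
    moreover have "U \<subseteq> U'"
    proof
      fix u assume "u \<in> U"
      then show "u \<in> U'" using U'I[of u "\<zero>\<^bsub>K\<^esub>"] x U_sub by simp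
    qed
    ultimately have "U' = U" by (rule max)
    moreover have "x \<in> U'" using U'I[OF U_zero K.one_closed] x by (simp add: X.rsmult_one)
    ultimately show False using no x by blast
  qed
  have inj: "u = u'" if "u \<in> U" "u' \<in> U" "f u = f u'" for u u'
  proof -
    have "f (u \<oplus>\<^bsub>X\<^esub> \<ominus>\<^bsub>X\<^esub> u') = \<zero>\<^bsub>Y\<^esub>"
      using that U_sub by (simp add: f_simps f_neg Y.M.r_neg)
    then have "u \<oplus>\<^bsub>X\<^esub> \<ominus>\<^bsub>X\<^esub> u' = \<zero>\<^bsub>X\<^esub>" using U_ker U_add neg that by simp
    then show ?thesis using X.M.minus_equality[of u "\<ominus>\<^bsub>X\<^esub> u'"] that U_sub by simp
  qed
  define s where "s y = (SOME u. u \<in> U \<and> f u = y)" for y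
  have s: "s y \<in> U" "f (s y) = y" if "y \<in> carrier Y" for y
    using someI_ex[of "\<lambda>u. u \<in> U \<and> f u = y"] onto[OF that] unfolding s_def by auto
  have "s \<in> right_hom K Y X"
    by (rule right_homI)
      (auto intro!: inj U_add U_smult U_sub simp: s f_simps U_sub X.rsmult_closed Y.rsmult_closed)
  then show ?thesis using s by blast
qed

section \<open>Incidence algebras\<close>

lemma (in abelian_monoid) finsum_single:
  assumes "finite A" "i \<in> A" "f i \<in> carrier G" "\<And>j. j \<in> A \<Longrightarrow> j \<noteq> i \<Longrightarrow> f j = \<zero>"
  shows "finsum G f A = f i"
proof -
  have "finsum G f (insert i (A - {i})) = f i \<oplus> finsum G f (A - {i})"
    using assms by (intro finsum_insert) auto
  moreover have "finsum G f (A - {i}) = \<zero>"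
    using assms by (intro add.finprod_one_eqI) auto
  ultimately show ?thesis using assms by (simp add: insert_absorb)
qed

text \<open>Matrices are padded with zeros outside \<open>V\<close> and off the relation, so that equality of matrices is
  equality of functions.\<close>

definition incidence_algebra ::
    "('k, 'e) ring_scheme \<Rightarrow> 'v set \<Rightarrow> ('v \<Rightarrow> 'v \<Rightarrow> bool) \<Rightarrow> ('k, 'v \<Rightarrow> 'v \<Rightarrow> 'k) module" where
  "incidence_algebra K V leq =
    \<lparr>carrier = {f. \<forall>v w. f v w \<in> carrier K \<and> (\<not> (v \<in> V \<and> w \<in> V \<and> leq v w) \<longrightarrow> f v w = \<zero>\<^bsub>K\<^esub>)},
     mult = (\<lambda>f g v w. \<Oplus>\<^bsub>K\<^esub>x\<in>V. f v x \<otimes>\<^bsub>K\<^esub> g x w),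
     one = (\<lambda>v w. if v = w \<and> v \<in> V then \<one>\<^bsub>K\<^esub> else \<zero>\<^bsub>K\<^esub>),
     zero = (\<lambda>v w. \<zero>\<^bsub>K\<^esub>),
     add = (\<lambda>f g v w. f v w \<oplus>\<^bsub>K\<^esub> g v w),
     smult = (\<lambda>k f v w. k \<otimes>\<^bsub>K\<^esub> f v w)\<rparr>"

locale incidence = K: field K
  for K :: "('k, 'e) ring_scheme" (structure) +
  fixes V :: "'v set" and leq :: "'v \<Rightarrow> 'v \<Rightarrow> bool"
  assumes finite_V: "finite V"
    and leq_refl: "v \<in> V \<Longrightarrow> leq v v"
    and leq_trans: "\<lbrakk>u \<in> V; v \<in> V; w \<in> V; leq u v; leq v w\<rbrakk> \<Longrightarrow> leq u w"
begin

abbreviation "I \<equiv> incidence_algebra K V leq"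

definition unit_matrix :: "'v \<Rightarrow> 'v \<Rightarrow> 'v \<Rightarrow> 'v \<Rightarrow> 'k" where
  "unit_matrix v w = (\<lambda>x y. if x = v \<and> y = w \<and> v \<in> V \<and> w \<in> V \<and> leq v w then \<one> else \<zero>)"

definition scalar_matrix :: "'k \<Rightarrow> 'v \<Rightarrow> 'v \<Rightarrow> 'k" where
  "scalar_matrix k = (\<lambda>v w. if v = w \<and> v \<in> V then k else \<zero>)"

lemma I_simps:
  "\<zero>\<^bsub>I\<^esub> = (\<lambda>v w. \<zero>)"
  "\<one>\<^bsub>I\<^esub> = (\<lambda>v w. if v = w \<and> v \<in> V then \<one> else \<zero>)"
  "f \<oplus>\<^bsub>I\<^esub> g = (\<lambda>v w. f v w \<oplus> g v w)"
  "f \<otimes>\<^bsub>I\<^esub> g = (\<lambda>v w. \<Oplus>x\<in>V. f v x \<otimes> g x w)"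
  "k \<odot>\<^bsub>I\<^esub> f = (\<lambda>v w. k \<otimes> f v w)"
  by (simp_all add: incidence_algebra_def)

lemma entry_closed: "f \<in> carrier I \<Longrightarrow> f v w \<in> carrier K"
  and entry_zero: "f \<in> carrier I \<Longrightarrow> \<not> (v \<in> V \<and> w \<in> V \<and> leq v w) \<Longrightarrow> f v w = \<zero>"
  by (auto simp: incidence_algebra_def)

lemma I_memI:
  assumes "\<And>v w. f v w \<in> carrier K" "\<And>v w. \<not> (v \<in> V \<and> w \<in> V \<and> leq v w) \<Longrightarrow> f v w = \<zero>"
  shows "f \<in> carrier I"
  using assms by (auto simp: incidence_algebra_def)

lemma mult_closed: assumes "f \<in> carrier I" "g \<in> carrier I" shows "f \<otimes>\<^bsub>I\<^esub> g \<in> carrier I"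
proof (rule I_memI)
  fix v w
  note cl = entry_closed[OF assms(1)] entry_closed[OF assms(2)]
  note z = entry_zero[OF assms(1)] entry_zero[OF assms(2)]
  show "(f \<otimes>\<^bsub>I\<^esub> g) v w \<in> carrier K" by (simp add: I_simps cl K.finsum_closed)
  assume no: "\<not> (v \<in> V \<and> w \<in> V \<and> leq v w)"
  have "f v x \<otimes> g x w = \<zero>" if "x \<in> V" for x
  proof (cases "v \<in> V \<and> leq v x")
    case True
    then have "\<not> (w \<in> V \<and> leq x w)" using no that leq_trans by blast
    then show ?thesis by (simp add: z cl)
  qed (auto simp: z cl)
  then show "(f \<otimes>\<^bsub>I\<^esub> g) v w = \<zero>" by (simp add: I_simps K.add.finprod_one_eqI)
qed

lemma mult_assoc:
  assumes "f \<in> carrier I" "g \<in> carrier I" "h \<in> carrier I"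
  shows "(f \<otimes>\<^bsub>I\<^esub> g) \<otimes>\<^bsub>I\<^esub> h = f \<otimes>\<^bsub>I\<^esub> (g \<otimes>\<^bsub>I\<^esub> h)"
proof (intro ext)
  fix v w
  note cl = entry_closed[OF assms(1)] entry_closed[OF assms(2)] entry_closed[OF assms(3)]
  have left: "(\<Oplus>x\<in>V. f v x \<otimes> g x y) \<otimes> h y w = (\<Oplus>x\<in>V. f v x \<otimes> (g x y \<otimes> h y w))" for y
    using cl finite_V by (subst K.finsum_ldistr) (simp_all add: Pi_iff K.m_assoc)
  have right: "f v x \<otimes> (\<Oplus>y\<in>V. g x y \<otimes> h y w) = (\<Oplus>y\<in>V. f v x \<otimes> (g x y \<otimes> h y w))" for x
    using cl finite_V by (subst K.finsum_rdistr) (simp_all add: Pi_iff)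
  have "((f \<otimes>\<^bsub>I\<^esub> g) \<otimes>\<^bsub>I\<^esub> h) v w = (\<Oplus>y\<in>V. \<Oplus>x\<in>V. f v x \<otimes> (g x y \<otimes> h y w))"
    unfolding I_simps left ..
  also have "\<dots> = (\<Oplus>x\<in>V. \<Oplus>y\<in>V. f v x \<otimes> (g x y \<otimes> h y w))"
    using cl finite_V by (intro K.finsum_finsum_swap) simp_all
  also have "\<dots> = (f \<otimes>\<^bsub>I\<^esub> (g \<otimes>\<^bsub>I\<^esub> h)) v w"
    unfolding I_simps right ..
  finally show "((f \<otimes>\<^bsub>I\<^esub> g) \<otimes>\<^bsub>I\<^esub> h) v w = (f \<otimes>\<^bsub>I\<^esub> (g \<otimes>\<^bsub>I\<^esub> h)) v w" .
qed

lemma scalar_mult: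
  assumes "k \<in> carrier K" "f \<in> carrier I"
  shows "scalar_matrix k \<otimes>\<^bsub>I\<^esub> f = k \<odot>\<^bsub>I\<^esub> f" "f \<otimes>\<^bsub>I\<^esub> scalar_matrix k = k \<odot>\<^bsub>I\<^esub> f"
proof -
  note cl = entry_closed[OF assms(2)] and z = entry_zero[OF assms(2)]
  have "(scalar_matrix k \<otimes>\<^bsub>I\<^esub> f) v w = k \<otimes> f v w" for v w
  proof (cases "v \<in> V")
    case True
    have "(scalar_matrix k \<otimes>\<^bsub>I\<^esub> f) v w = scalar_matrix k v v \<otimes> f v w"
      unfolding I_simps using assms finite_V True
      by (intro K.finsum_single) (auto simp: scalar_matrix_def cl)
    then show ?thesis using True by (simp add: scalar_matrix_def)
  qed (use assms in \<open>simp add: I_simps scalar_matrix_def z cl K.add.finprod_one_eqI\<close>)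
  then show "scalar_matrix k \<otimes>\<^bsub>I\<^esub> f = k \<odot>\<^bsub>I\<^esub> f" by (simp add: I_simps fun_eq_iff)
  have "(f \<otimes>\<^bsub>I\<^esub> scalar_matrix k) v w = k \<otimes> f v w" for v w
  proof (cases "w \<in> V")
    case True
    have "(f \<otimes>\<^bsub>I\<^esub> scalar_matrix k) v w = f v w \<otimes> scalar_matrix k w w"
      unfolding I_simps using assms finite_V True
      by (intro K.finsum_single) (auto simp: scalar_matrix_def cl)
    then show ?thesis using True assms by (simp add: scalar_matrix_def cl K.m_comm)
  next
    case False
    then have "f v x \<otimes> scalar_matrix k x w = \<zero>" for x
      using assms by (cases "x = w") (auto simp: scalar_matrix_def z cl)
    then show ?thesis using False assms by (simp add: I_simps z K.add.finprod_one_eqI)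
  qed
  then show "f \<otimes>\<^bsub>I\<^esub> scalar_matrix k = k \<odot>\<^bsub>I\<^esub> f" by (simp add: I_simps fun_eq_iff)
qed

lemma scalar_matrix_closed: "k \<in> carrier K \<Longrightarrow> scalar_matrix k \<in> carrier I"
  by (rule I_memI) (auto simp: scalar_matrix_def leq_refl)

lemma unit_matrix_closed: "unit_matrix v w \<in> carrier I"
  by (rule I_memI) (auto simp: unit_matrix_def)

lemma one_eq_scalar: "\<one>\<^bsub>I\<^esub> = scalar_matrix \<one>"
  by (simp add: I_simps scalar_matrix_def)

lemma smult_closed: "k \<in> carrier K \<Longrightarrow> f \<in> carrier I \<Longrightarrow> k \<odot>\<^bsub>I\<^esub> f \<in> carrier I"
  by (rule I_memI) (auto simp: I_simps entry_closed entry_zero[of f])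

lemma abelian_group_I: "abelian_group I"
proof (rule abelian_groupI)
  fix f assume f: "f \<in> carrier I"
  have "(\<lambda>v w. \<ominus> f v w) \<in> carrier I" using f by (intro I_memI) (auto simp: entry_closed entry_zero[of f])
  moreover have "(\<lambda>v w. \<ominus> f v w) \<oplus>\<^bsub>I\<^esub> f = \<zero>\<^bsub>I\<^esub>" using f by (simp add: I_simps K.l_neg entry_closed)
  ultimately show "\<exists>g\<in>carrier I. g \<oplus>\<^bsub>I\<^esub> f = \<zero>\<^bsub>I\<^esub>" by blast
next
  fix f g assume "f \<in> carrier I" "g \<in> carrier I"
  then show "f \<oplus>\<^bsub>I\<^esub> g \<in> carrier I" by (intro I_memI) (simp_all add: I_simps entry_closed entry_zero[of f] entry_zero[of g])
next
  show "\<zero>\<^bsub>I\<^esub> \<in> carrier I" by (rule I_memI) (simp_all add: I_simps)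
qed (simp_all add: I_simps entry_closed K.a_assoc, simp add: entry_closed K.a_comm)

lemma ring_I: "ring I"
proof (rule ringI)
  show "abelian_group I" by (rule abelian_group_I)
  show "monoid I"
  proof (rule monoidI)
    show "\<one>\<^bsub>I\<^esub> \<in> carrier I" by (simp add: one_eq_scalar scalar_matrix_closed)
    show "\<one>\<^bsub>I\<^esub> \<otimes>\<^bsub>I\<^esub> f = f" "f \<otimes>\<^bsub>I\<^esub> \<one>\<^bsub>I\<^esub> = f" if "f \<in> carrier I" for f
      using that by (simp_all add: one_eq_scalar scalar_mult) (simp_all add: I_simps entry_closed)
  qed (simp_all add: mult_closed mult_assoc)
  fix f g h assume fgh: "f \<in> carrier I" "g \<in> carrier I" "h \<in> carrier I"
  note cl = entry_closed[OF fgh(1)] entry_closed[OF fgh(2)] entry_closed[OF fgh(3)]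
  show "(f \<oplus>\<^bsub>I\<^esub> g) \<otimes>\<^bsub>I\<^esub> h = f \<otimes>\<^bsub>I\<^esub> h \<oplus>\<^bsub>I\<^esub> g \<otimes>\<^bsub>I\<^esub> h"
    unfolding I_simps by (intro ext) (simp add: cl K.l_distr K.finsum_addf Pi_iff)
  show "h \<otimes>\<^bsub>I\<^esub> (f \<oplus>\<^bsub>I\<^esub> g) = h \<otimes>\<^bsub>I\<^esub> f \<oplus>\<^bsub>I\<^esub> h \<otimes>\<^bsub>I\<^esub> g"
    unfolding I_simps by (intro ext) (simp add: cl K.r_distr K.finsum_addf Pi_iff)
qed

lemma finsum_I:
  assumes "\<And>i. i \<in> S \<Longrightarrow> f i \<in> carrier I"
  shows "finsum I f S = (\<lambda>v w. \<Oplus>i\<in>S. f i v w)"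
proof -
  interpret I: ring I by (rule ring_I)
  show ?thesis using assms
  proof (induction S rule: infinite_finite_induct)
    case (insert i S)
    then show ?case by (subst I.finsum_insert) (auto simp: I_simps Pi_iff entry_closed)
  qed (auto simp: I_simps)
qed

lemma module_I: "Module.module K I"
  by (rule Module.moduleI)
    (simp_all add: K.is_cring abelian_group_I smult_closed,
      simp_all add: I_simps entry_closed K.l_distr K.r_distr K.m_assoc)

text \<open>The matrix units span: remove one entry of the support after the other.\<close>

lemma fin_dim_algebra_I: "fin_dim_algebra K I"
proof -
  interpret I: Module.module K I by (rule module_I)
  interpret ring_I: ring I by (rule ring_I)
  interpret VI: vectorspace K I by unfold_locales
  let ?U = "(\<lambda>(v, w). unit_matrix v w) ` (V \<times> V)"
  have U: "?U \<subseteq> carrier I" using unit_matrix_closed by auto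
  have spanned: "f \<in> I.span ?U"
    if "S \<subseteq> V \<times> V" "f \<in> carrier I" "\<And>v w. (v, w) \<notin> S \<Longrightarrow> f v w = \<zero>" for S f
  proof -
    have "finite S" using that(1) finite_V by (meson finite_SigmaI finite_subset)
    then show ?thesis using that
    proof (induction S arbitrary: f)
      case empty
      then have "f = \<zero>\<^bsub>I\<^esub>" by (auto simp: I_simps)
      then show ?case
        using LinearCombinations.submodule.zero_closed[OF I.span_is_submodule[OF U]] by simp
    next
      case (insert p S)
      obtain v w where p: "p = (v, w)" by force
      define g where "g = (\<lambda>x y. if x = v \<and> y = w then \<zero> else f x y)"
      have g: "g \<in> carrier I" using insert.prems by (intro I_memI) (auto simp: g_def entry_closed entry_zero[of f])
      have "g \<in> I.span ?U"
        using insert.prems(1,3) g by (intro insert.IH) (simp_all add: g_def p)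
      moreover have "f v w \<odot>\<^bsub>I\<^esub> unit_matrix v w \<in> I.span ?U"
        using I.span_is_submodule[OF U] I.in_own_span[OF U] insert.prems p
        by (intro LinearCombinations.submodule.smult_closed[OF I.span_is_submodule[OF U]]) (auto simp: entry_closed)
      ultimately have "g \<oplus>\<^bsub>I\<^esub> f v w \<odot>\<^bsub>I\<^esub> unit_matrix v w \<in> I.span ?U"
        using I.span_is_submodule[OF U] by (simp add: LinearCombinations.submodule.m_closed)
      moreover have "g \<oplus>\<^bsub>I\<^esub> f v w \<odot>\<^bsub>I\<^esub> unit_matrix v w = f"
        using insert.prems p
        by (auto simp: I_simps g_def unit_matrix_def fun_eq_iff entry_closed entry_zero[of f])
      ultimately show ?case by simp
    qed
  qed
  have "f \<in> I.span ?U" if "f \<in> carrier I" for f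
    by (rule spanned[OF subset_refl that]) (rule entry_zero[OF that], blast)
  then have "carrier I \<subseteq> I.span ?U" by (rule subsetI)
  then have gen: "I.gen_set ?U"
    using I.span_is_subset2[OF U] by auto
  have "VI.fin_dim"
    unfolding VI.fin_dim_def
    by (intro exI[of _ ?U] conjI finite_imageI finite_cartesian_product finite_V U gen)
  moreover have "k \<odot>\<^bsub>I\<^esub> (f \<otimes>\<^bsub>I\<^esub> g) = k \<odot>\<^bsub>I\<^esub> f \<otimes>\<^bsub>I\<^esub> g" "k \<odot>\<^bsub>I\<^esub> (f \<otimes>\<^bsub>I\<^esub> g) = f \<otimes>\<^bsub>I\<^esub> (k \<odot>\<^bsub>I\<^esub> g)"
    if k: "k \<in> carrier K" and f: "f \<in> carrier I" and g: "g \<in> carrier I" for k f g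
  proof -
    note s = scalar_matrix_closed[OF k]
    show "k \<odot>\<^bsub>I\<^esub> (f \<otimes>\<^bsub>I\<^esub> g) = k \<odot>\<^bsub>I\<^esub> f \<otimes>\<^bsub>I\<^esub> g"
      using mult_assoc[OF s f g] by (simp only: scalar_mult(1)[OF k f] scalar_mult(1)[OF k mult_closed[OF f g]])
    show "k \<odot>\<^bsub>I\<^esub> (f \<otimes>\<^bsub>I\<^esub> g) = f \<otimes>\<^bsub>I\<^esub> (k \<odot>\<^bsub>I\<^esub> g)"
      using mult_assoc[OF f g s] by (simp only: scalar_mult(2)[OF k g] scalar_mult(2)[OF k mult_closed[OF f g]])
  qed
  ultimately show ?thesis
    by (intro fin_dim_algebra.intro fin_dim_algebra_axioms.intro VI.vectorspace_axioms ring_I)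
qed

end

text \<open>A ring isomorphism speaks about sum, product and unit only, and \<open>B\<close> is not known to
  be a ring beforehand; therefore its zero and its scalar multiplication appear among the premises.\<close>

lemma fin_dim_algebra_transport:
  fixes K :: "('k, 'e) ring_scheme" and A :: "('k, 'a, 'f) module_scheme" and B :: "('k, 'b, 'g) module_scheme"
  assumes A: "fin_dim_algebra K A" and iso: "\<psi> \<in> ring_iso A B" and zero: "\<psi> \<zero>\<^bsub>A\<^esub> = \<zero>\<^bsub>B\<^esub>"
    and smult: "\<And>k x. k \<in> carrier K \<Longrightarrow> x \<in> carrier A \<Longrightarrow> \<psi> (k \<odot>\<^bsub>A\<^esub> x) = k \<odot>\<^bsub>B\<^esub> \<psi> x"
  shows "fin_dim_algebra K B"
proof -
  interpret A: fin_dim_algebra K A by fact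
  have B: "\<psi> ` carrier A = carrier B" using ring_iso_memE(5)[OF iso] by (simp add: bij_betw_def)
  note hom = ring_iso_memE(2-4)[OF iso, symmetric] smult[symmetric] zero[symmetric]
  have "ring (B\<lparr>zero := \<psi> \<zero>\<^bsub>A\<^esub>\<rparr>)" by (rule A.ring_iso_imp_img_ring[OF iso])
  then have ring: "ring B" using zero by simp
  then interpret B: ring B .
  have "Module.module K B"
    by (rule Module.moduleI)
      (auto intro: A.R.is_cring B.is_abelian_group simp flip: B
        simp: hom A.smult_l_distr A.smult_r_distr A.smult_assoc1 A.m_closed A.a_closed)
  then interpret mod_B: Module.module K B .
  interpret vs_B: vectorspace K B by unfold_locales
  have mult: "k \<odot>\<^bsub>B\<^esub> (x \<otimes>\<^bsub>B\<^esub> y) = k \<odot>\<^bsub>B\<^esub> x \<otimes>\<^bsub>B\<^esub> y" "k \<odot>\<^bsub>B\<^esub> (x \<otimes>\<^bsub>B\<^esub> y) = x \<otimes>\<^bsub>B\<^esub> (k \<odot>\<^bsub>B\<^esub> y)"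
    if k: "k \<in> carrier K" and "x \<in> carrier B" "y \<in> carrier B" for k x y
  proof -
    from that
    obtain a b where ab: "a \<in> carrier A" "b \<in> carrier A" "x = \<psi> a" "y = \<psi> b"
      unfolding B[symmetric] by blast
    show "k \<odot>\<^bsub>B\<^esub> (x \<otimes>\<^bsub>B\<^esub> y) = k \<odot>\<^bsub>B\<^esub> x \<otimes>\<^bsub>B\<^esub> y"
      using k ab by (simp add: hom A.smult_mult_left)
    show "k \<odot>\<^bsub>B\<^esub> (x \<otimes>\<^bsub>B\<^esub> y) = x \<otimes>\<^bsub>B\<^esub> (k \<odot>\<^bsub>B\<^esub> y)"
      using k ab by (simp add: hom A.smult_mult_right)
  qed
  interpret lin: linear_map K A B \<psi>
    by unfold_locales (use ring_iso_memE(1,3)[OF iso] smult in \<open>auto simp: LinearCombinations.module_hom_def\<close>)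
  have "vs_B.fin_dim" using lin.surj_fin_dim[OF A.finite_dimensional B] .
  then show ?thesis
    by (intro fin_dim_algebra.intro fin_dim_algebra_axioms.intro vs_B.vectorspace_axioms ring mult)
qed

section \<open>Rings isomorphic to an incidence algebra\<close>

definition restrict_scalars :: "('k \<Rightarrow> 'r) \<Rightarrow> ('r, 'm) module \<Rightarrow> ('k, 'm) module" where
  "restrict_scalars \<kappa> M =
    \<lparr>carrier = carrier M, mult = undefined, one = undefined, zero = \<zero>\<^bsub>M\<^esub>, add = add M,
     smult = (\<lambda>k x. \<kappa> k \<odot>\<^bsub>M\<^esub> x)\<rparr>"

lemma restrict_scalars_simps [simp]:
  "carrier (restrict_scalars \<kappa> M) = carrier M"
  "\<zero>\<^bsub>restrict_scalars \<kappa> M\<^esub> = \<zero>\<^bsub>M\<^esub>"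
  "x \<oplus>\<^bsub>restrict_scalars \<kappa> M\<^esub> y = x \<oplus>\<^bsub>M\<^esub> y"
  "k \<odot>\<^bsub>restrict_scalars \<kappa> M\<^esub> x = \<kappa> k \<odot>\<^bsub>M\<^esub> x"
  by (simp_all add: restrict_scalars_def)

lemma right_module_restrict_scalars:
  assumes "ring K" "right_module R M" and \<kappa>: "\<kappa> \<in> ring_hom K R"
  shows "right_module K (restrict_scalars \<kappa> M)"
proof -
  interpret K: ring K by fact
  interpret M: right_module R M by fact
  note hom = ring_hom_closed[OF \<kappa>] ring_hom_add[OF \<kappa>] ring_hom_mult[OF \<kappa>] ring_hom_one[OF \<kappa>]
  have "abelian_group (restrict_scalars \<kappa> M)"
  proof (rule abelian_groupI)
    fix x assume "x \<in> carrier (restrict_scalars \<kappa> M)"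
    then show "\<exists>y\<in>carrier (restrict_scalars \<kappa> M). y \<oplus>\<^bsub>restrict_scalars \<kappa> M\<^esub> x = \<zero>\<^bsub>restrict_scalars \<kappa> M\<^esub>"
      by (intro bexI[of _ "\<ominus>\<^bsub>M\<^esub> x"]) (simp_all add: M.M.l_neg)
  qed (simp_all add: M.M.a_ac)
  then show ?thesis
    by (intro right_module.intro right_module_axioms.intro)
      (simp_all add: K.ring_axioms hom M.rsmult_closed M.rsmult_distr_ring M.rsmult_distr_module
        M.rsmult_assoc M.rsmult_one)
qed

text \<open>\<open>\<psi>\<close> identifies \<open>R\<close> with the incidence algebra. Below, \<open>coef\<close> is its inverse, \<open>E\<close> denotes the matrix
  units and \<open>\<kappa>\<close> the embedding of the scalars, all as elements of \<open>R\<close>.\<close>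

locale incidence_ring = incidence K V leq + R: ring R
  for K :: "('k, 'e) ring_scheme" (structure) and V :: "'v set" and leq :: "'v \<Rightarrow> 'v \<Rightarrow> bool"
    and R :: "('r, 'f) ring_scheme" +
  fixes \<psi> :: "('v \<Rightarrow> 'v \<Rightarrow> 'k) \<Rightarrow> 'r"
  assumes \<psi>_iso: "\<psi> \<in> ring_iso (incidence_algebra K V leq) R"
begin

sublocale I: ring I by (rule ring_I)

lemma \<psi>_closed: "f \<in> carrier I \<Longrightarrow> \<psi> f \<in> carrier R"
  and \<psi>_mult: "f \<in> carrier I \<Longrightarrow> g \<in> carrier I \<Longrightarrow> \<psi> (f \<otimes>\<^bsub>I\<^esub> g) = \<psi> f \<otimes>\<^bsub>R\<^esub> \<psi> g"
  and \<psi>_add: "f \<in> carrier I \<Longrightarrow> g \<in> carrier I \<Longrightarrow> \<psi> (f \<oplus>\<^bsub>I\<^esub> g) = \<psi> f \<oplus>\<^bsub>R\<^esub> \<psi> g"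
  and \<psi>_one: "\<psi> \<one>\<^bsub>I\<^esub> = \<one>\<^bsub>R\<^esub>"
  and \<psi>_bij: "bij_betw \<psi> (carrier I) (carrier R)"
  using ring_iso_memE[OF \<psi>_iso] by auto

lemma \<psi>_zero: "\<psi> \<zero>\<^bsub>I\<^esub> = \<zero>\<^bsub>R\<^esub>"
  by (rule ring_hom_zero[OF _ ring_I R.ring_axioms]) (use \<psi>_iso in \<open>simp add: ring_iso_def\<close>)

definition coef :: "'r \<Rightarrow> 'v \<Rightarrow> 'v \<Rightarrow> 'k" where
  "coef r = inv_into (carrier I) \<psi> r"

definition E :: "'v \<Rightarrow> 'v \<Rightarrow> 'r" where
  "E v w = \<psi> (unit_matrix v w)"

definition \<kappa> :: "'k \<Rightarrow> 'r" where
  "\<kappa> k = \<psi> (scalar_matrix k)"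

lemma coef_\<psi>: "f \<in> carrier I \<Longrightarrow> coef (\<psi> f) = f"
  using \<psi>_bij by (simp add: coef_def bij_betw_def)

lemma coef_closed: "r \<in> carrier R \<Longrightarrow> coef r \<in> carrier I"
  using \<psi>_bij by (simp add: coef_def bij_betw_def inv_into_into)

lemma \<psi>_coef: "r \<in> carrier R \<Longrightarrow> \<psi> (coef r) = r"
  using \<psi>_bij by (simp add: coef_def bij_betw_def f_inv_into_f)

lemma coef_entry: "r \<in> carrier R \<Longrightarrow> coef r v w \<in> carrier K"
  by (rule entry_closed[OF coef_closed])

lemma coef_add:
  assumes "r \<in> carrier R" "s \<in> carrier R" shows "coef (r \<oplus>\<^bsub>R\<^esub> s) v w = coef r v w \<oplus> coef s v w"
proof -
  have "r \<oplus>\<^bsub>R\<^esub> s = \<psi> (coef r \<oplus>\<^bsub>I\<^esub> coef s)" using assms by (simp add: \<psi>_add coef_closed \<psi>_coef)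
  then have "coef (r \<oplus>\<^bsub>R\<^esub> s) = coef r \<oplus>\<^bsub>I\<^esub> coef s" using assms by (simp add: coef_\<psi> coef_closed)
  then show ?thesis by (simp add: I_simps)
qed

lemma coef_mult:
  assumes "r \<in> carrier R" "s \<in> carrier R"
  shows "coef (r \<otimes>\<^bsub>R\<^esub> s) v w = (\<Oplus>x\<in>V. coef r v x \<otimes> coef s x w)"
proof -
  have "r \<otimes>\<^bsub>R\<^esub> s = \<psi> (coef r \<otimes>\<^bsub>I\<^esub> coef s)" using assms by (simp add: \<psi>_mult coef_closed \<psi>_coef)
  then have "coef (r \<otimes>\<^bsub>R\<^esub> s) = coef r \<otimes>\<^bsub>I\<^esub> coef s" using assms by (simp add: coef_\<psi> coef_closed)
  then show ?thesis by (simp add: I_simps)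
qed

lemma coef_one: "coef \<one>\<^bsub>R\<^esub> = \<one>\<^bsub>I\<^esub>"
  using coef_\<psi>[OF I.one_closed] by (simp add: \<psi>_one)

lemma coef_E: "coef (E v w) = unit_matrix v w"
  by (simp add: E_def coef_\<psi> unit_matrix_closed)

lemma coef_\<kappa>: "k \<in> carrier K \<Longrightarrow> coef (\<kappa> k) = scalar_matrix k"
  by (simp add: \<kappa>_def coef_\<psi> scalar_matrix_closed)

lemma E_closed: "E v w \<in> carrier R"
  by (simp add: E_def \<psi>_closed unit_matrix_closed)

lemma E_zero: "\<not> leq v w \<Longrightarrow> E v w = \<zero>\<^bsub>R\<^esub>"
proof -
  assume "\<not> leq v w"
  then have "unit_matrix v w = \<zero>\<^bsub>I\<^esub>" by (simp add: unit_matrix_def I_simps)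
  then show ?thesis by (simp add: E_def \<psi>_zero)
qed

lemma \<kappa>_closed: "k \<in> carrier K \<Longrightarrow> \<kappa> k \<in> carrier R"
  by (simp add: \<kappa>_def \<psi>_closed scalar_matrix_closed)

lemma \<kappa>_hom: "\<kappa> \<in> ring_hom K R"
proof (rule ring_hom_memI)
  fix k l assume kl: "k \<in> carrier K" "l \<in> carrier K"
  show "\<kappa> k \<in> carrier R" using kl by (simp add: \<kappa>_closed)
  have "scalar_matrix (k \<otimes> l) = scalar_matrix k \<otimes>\<^bsub>I\<^esub> scalar_matrix l"
    unfolding scalar_mult(1)[OF kl(1) scalar_matrix_closed[OF kl(2)]]
    using kl by (auto simp: I_simps scalar_matrix_def fun_eq_iff)
  then show "\<kappa> (k \<otimes> l) = \<kappa> k \<otimes>\<^bsub>R\<^esub> \<kappa> l"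
    using kl by (simp add: \<kappa>_def \<psi>_mult scalar_matrix_closed)
  have "scalar_matrix (k \<oplus> l) = scalar_matrix k \<oplus>\<^bsub>I\<^esub> scalar_matrix l"
    using kl by (auto simp: I_simps scalar_matrix_def fun_eq_iff)
  then show "\<kappa> (k \<oplus> l) = \<kappa> k \<oplus>\<^bsub>R\<^esub> \<kappa> l"
    using kl by (simp add: \<kappa>_def \<psi>_add scalar_matrix_closed)
next
  show "\<kappa> \<one> = \<one>\<^bsub>R\<^esub>" by (simp add: \<kappa>_def \<psi>_one flip: one_eq_scalar)
qed

lemma \<kappa>_zero: "\<kappa> \<zero> = \<zero>\<^bsub>R\<^esub>"
  by (rule ring_hom_zero[OF \<kappa>_hom K.ring_axioms R.ring_axioms])

lemma \<kappa>_central: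
  assumes "k \<in> carrier K" "r \<in> carrier R" shows "\<kappa> k \<otimes>\<^bsub>R\<^esub> r = r \<otimes>\<^bsub>R\<^esub> \<kappa> k"
proof -
  have "\<kappa> k \<otimes>\<^bsub>R\<^esub> \<psi> (coef r) = \<psi> (coef r) \<otimes>\<^bsub>R\<^esub> \<kappa> k"
    using assms scalar_mult[of k "coef r"]
    by (simp add: \<kappa>_def coef_closed scalar_matrix_closed flip: \<psi>_mult)
  then show ?thesis using assms by (simp add: \<psi>_coef)
qed

lemma finsum_\<psi>:
  assumes "\<And>i. i \<in> S \<Longrightarrow> f i \<in> carrier I"
  shows "(\<Oplus>\<^bsub>R\<^esub>i\<in>S. \<psi> (f i)) = \<psi> (\<lambda>v w. \<Oplus>i\<in>S. f i v w)"
proof -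
  have "\<psi> (finsum I f S) = (\<Oplus>\<^bsub>R\<^esub>i\<in>S. \<psi> (f i))"
    using assms
  proof (induction S rule: infinite_finite_induct)
    case (insert i S)
    then show ?case
      by (subst I.finsum_insert, simp_all add: Pi_iff)
        (subst R.finsum_insert, simp_all add: Pi_iff \<psi>_closed \<psi>_add I.finsum_closed)
  qed (simp_all add: \<psi>_zero)
  then show ?thesis using finsum_I[of S f] assms by simp
qed

lemma E_mult:
  assumes "v \<in> V" "leq u v"
  shows "E u v \<otimes>\<^bsub>R\<^esub> E v w = (if leq v w then E u w else \<zero>\<^bsub>R\<^esub>)"
proof (cases "leq v w \<and> u \<in> V \<and> w \<in> V")
  case True
  have "(unit_matrix u v \<otimes>\<^bsub>I\<^esub> unit_matrix v w) x y = unit_matrix u w x y" for x y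
  proof -
    have "(unit_matrix u v \<otimes>\<^bsub>I\<^esub> unit_matrix v w) x y = unit_matrix u v x v \<otimes> unit_matrix v w v y"
      unfolding I_simps using finite_V assms by (intro K.finsum_single) (auto simp: unit_matrix_def)
    then show ?thesis using True assms leq_trans[of u v w] by (auto simp: unit_matrix_def)
  qed
  then have "unit_matrix u v \<otimes>\<^bsub>I\<^esub> unit_matrix v w = unit_matrix u w" by (intro ext)
  then have "E u v \<otimes>\<^bsub>R\<^esub> E v w = E u w"
    unfolding E_def by (simp add: unit_matrix_closed flip: \<psi>_mult)
  then show ?thesis using True by simp
next
  case False
  have zero: "E x y = \<zero>\<^bsub>R\<^esub>" if "\<not> (x \<in> V \<and> y \<in> V \<and> leq x y)" for x y
  proof -
    have "unit_matrix x y = \<zero>\<^bsub>I\<^esub>" using that by (auto simp: unit_matrix_def I_simps)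
    then show ?thesis by (simp add: E_def \<psi>_zero)
  qed
  show ?thesis
  proof (cases "u \<in> V \<and> w \<in> V")
    case True
    then show ?thesis using False zero[of v w] E_closed by simp
  next
    case False
    then have "E u v = \<zero>\<^bsub>R\<^esub> \<or> E v w = \<zero>\<^bsub>R\<^esub>" "E u w = \<zero>\<^bsub>R\<^esub>" using zero by blast+
    then show ?thesis using E_closed by auto
  qed
qed

lemma sum_E: "(\<Oplus>\<^bsub>R\<^esub>v\<in>V. E v v) = \<one>\<^bsub>R\<^esub>"
proof -
  have "(\<Oplus>i\<in>V. unit_matrix i i v w) = \<one>\<^bsub>I\<^esub> v w" for v w
  proof (cases "v = w \<and> v \<in> V")
    case True
    then have "(\<Oplus>i\<in>V. unit_matrix i i v w) = unit_matrix v v v w"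
      using finite_V by (intro K.finsum_single) (auto simp: unit_matrix_def)
    then show ?thesis using True by (simp add: I_simps unit_matrix_def leq_refl)
  next
    case False
    then have "(\<Oplus>i\<in>V. unit_matrix i i v w) = \<zero>"
      by (intro K.add.finprod_one_eqI) (auto simp: unit_matrix_def)
    then show ?thesis using False by (auto simp: I_simps)
  qed
  then show ?thesis
    unfolding E_def using finsum_\<psi>[of V "\<lambda>v. unit_matrix v v"]
    by (simp add: unit_matrix_closed \<psi>_one)
qed

text \<open>Right multiplication by \<open>r\<close> on row \<open>d\<close>, whose basis consists of the \<open>E d u\<close>.\<close>

lemma E_row_mult:
  assumes "d \<in> V" "v \<in> V" "leq d v" "r \<in> carrier R"
  shows "E d v \<otimes>\<^bsub>R\<^esub> r = (\<Oplus>\<^bsub>R\<^esub>u\<in>V. \<kappa> (coef r v u) \<otimes>\<^bsub>R\<^esub> E d u)"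
proof -
  note c = coef_entry[OF assms(4)]
  have "(\<Oplus>u\<in>V. coef r v u \<otimes> unit_matrix d u x y) = (unit_matrix d v \<otimes>\<^bsub>I\<^esub> coef r) x y" for x y
  proof -
    have "(unit_matrix d v \<otimes>\<^bsub>I\<^esub> coef r) x y = unit_matrix d v x v \<otimes> coef r v y"
      unfolding I_simps using finite_V assms c by (intro K.finsum_single) (auto simp: unit_matrix_def)
    also have "\<dots> = (if x = d then coef r v y else \<zero>)" using assms c by (simp add: unit_matrix_def)
    also have "\<dots> = (\<Oplus>u\<in>V. coef r v u \<otimes> unit_matrix d u x y)"
    proof (cases "x = d \<and> y \<in> V \<and> leq v y")
      case True
      then have "(\<Oplus>u\<in>V. coef r v u \<otimes> unit_matrix d u x y) = coef r v y \<otimes> unit_matrix d y x y"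
        using finite_V c by (intro K.finsum_single) (auto simp: unit_matrix_def)
      then show ?thesis using True assms c leq_trans[of d v y] by (simp add: unit_matrix_def)
    next
      case False
      have "coef r v u \<otimes> unit_matrix d u x y = \<zero>" for u
        using False c entry_zero[OF coef_closed[OF assms(4)], of v u] by (auto simp: unit_matrix_def)
      then have "(\<Oplus>u\<in>V. coef r v u \<otimes> unit_matrix d u x y) = \<zero>"
        by (intro K.add.finprod_one_eqI)
      then show ?thesis using False entry_zero[OF coef_closed[OF assms(4)], of v y] by auto
    qed
    finally show ?thesis ..
  qed
  moreover have "(\<Oplus>\<^bsub>R\<^esub>u\<in>V. \<psi> (coef r v u \<odot>\<^bsub>I\<^esub> unit_matrix d u))
      = \<psi> (\<lambda>x y. \<Oplus>u\<in>V. (coef r v u \<odot>\<^bsub>I\<^esub> unit_matrix d u) x y)"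
    by (rule finsum_\<psi>) (simp add: c smult_closed unit_matrix_closed)
  moreover have "\<psi> (coef r v u \<odot>\<^bsub>I\<^esub> unit_matrix d u) = \<kappa> (coef r v u) \<otimes>\<^bsub>R\<^esub> E d u" for u
    by (simp add: \<kappa>_def E_def c scalar_matrix_closed unit_matrix_closed flip: \<psi>_mult scalar_mult(1))
  ultimately have "(\<Oplus>\<^bsub>R\<^esub>u\<in>V. \<kappa> (coef r v u) \<otimes>\<^bsub>R\<^esub> E d u) = \<psi> (unit_matrix d v \<otimes>\<^bsub>I\<^esub> coef r)"
    by (simp add: I_simps)
  then show ?thesis
    using assms by (simp add: E_def \<psi>_mult \<psi>_coef unit_matrix_closed coef_closed)
qed

end

section \<open>A projective module mapping onto a given module\<close>

text \<open>Here \<open>rep v\<close> is a vertex equivalent to \<open>v\<close>, and \<open>ht\<close> grows strictly from a representative to every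
  vertex above it that it does not represent. It measures how far the syzygies of a module have been
  pushed up.\<close>

locale stratified_incidence_ring = incidence_ring K V leq R \<psi>
  for K :: "('k, 'e) ring_scheme" (structure) and V :: "'v set" and leq :: "'v \<Rightarrow> 'v \<Rightarrow> bool"
    and R :: "('r, 'f) ring_scheme" and \<psi> :: "('v \<Rightarrow> 'v \<Rightarrow> 'k) \<Rightarrow> 'r" +
  fixes rep :: "'v \<Rightarrow> 'v" and ht :: "'v \<Rightarrow> nat"
  assumes rep_mem: "v \<in> V \<Longrightarrow> rep v \<in> V"
    and leq_rep: "v \<in> V \<Longrightarrow> leq v (rep v)"
    and rep_leq: "v \<in> V \<Longrightarrow> leq (rep v) v"
    and ht_less: "\<lbrakk>d \<in> rep ` V; v \<in> V; leq d v; d \<noteq> rep v\<rbrakk> \<Longrightarrow> ht d < ht v"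
begin

text \<open>This is \<open>\<Oplus>\<^sub>d M\<^sub>d \<otimes>\<^sub>K E d d R\<close> with \<open>d\<close> ranging over the representatives and \<open>M\<^sub>d = M \<sqdot> E d d\<close>: since the
  \<open>E d v\<close> with \<open>leq d v\<close> form a \<open>K\<close>-basis of \<open>E d d R\<close>, an element is a family of coefficients
  \<open>x d v \<in> M\<^sub>d\<close> of the \<open>E d v\<close>, padded with zeros.\<close>

definition cover :: "('r, 'm) module \<Rightarrow> ('r, 'v \<Rightarrow> 'v \<Rightarrow> 'm) module" where
  "cover M =
    \<lparr>carrier = {x. (\<forall>d v. x d v \<in> carrier M \<and> E d d \<odot>\<^bsub>M\<^esub> x d v = x d v) \<and>
                   (\<forall>d v. \<not> (d \<in> rep ` V \<and> v \<in> V \<and> leq d v) \<longrightarrow> x d v = \<zero>\<^bsub>M\<^esub>)},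
     mult = undefined, one = undefined,
     zero = (\<lambda>d v. \<zero>\<^bsub>M\<^esub>),
     add = (\<lambda>x y d v. x d v \<oplus>\<^bsub>M\<^esub> y d v),
     smult = (\<lambda>r x d u. \<Oplus>\<^bsub>M\<^esub>v\<in>V. \<kappa> (coef r v u) \<odot>\<^bsub>M\<^esub> x d v)\<rparr>"

lemma cover_simps:
  "\<zero>\<^bsub>cover M\<^esub> = (\<lambda>d v. \<zero>\<^bsub>M\<^esub>)"
  "x \<oplus>\<^bsub>cover M\<^esub> y = (\<lambda>d v. x d v \<oplus>\<^bsub>M\<^esub> y d v)"
  "r \<odot>\<^bsub>cover M\<^esub> x = (\<lambda>d u. \<Oplus>\<^bsub>M\<^esub>v\<in>V. \<kappa> (coef r v u) \<odot>\<^bsub>M\<^esub> x d v)"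
  by (simp_all add: cover_def)

lemma cover_memI:
  assumes "\<And>d v. x d v \<in> carrier M" "\<And>d v. E d d \<odot>\<^bsub>M\<^esub> x d v = x d v"
    "\<And>d v. \<not> (d \<in> rep ` V \<and> v \<in> V \<and> leq d v) \<Longrightarrow> x d v = \<zero>\<^bsub>M\<^esub>"
  shows "x \<in> carrier (cover M)"
  using assms by (simp add: cover_def)

lemma cover_memD:
  assumes "x \<in> carrier (cover M)"
  shows "x d v \<in> carrier M" "E d d \<odot>\<^bsub>M\<^esub> x d v = x d v"
    "\<not> (d \<in> rep ` V \<and> v \<in> V \<and> leq d v) \<Longrightarrow> x d v = \<zero>\<^bsub>M\<^esub>"
  using assms by (auto simp: cover_def)

end

locale incidence_module = stratified_incidence_ring K V leq R \<psi> rep ht + M: right_module R M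
  for K :: "('k, 'e) ring_scheme" (structure) and V :: "'v set" and leq :: "'v \<Rightarrow> 'v \<Rightarrow> bool"
    and R :: "('r, 'f) ring_scheme" and \<psi> :: "('v \<Rightarrow> 'v \<Rightarrow> 'k) \<Rightarrow> 'r"
    and rep :: "'v \<Rightarrow> 'v" and ht :: "'v \<Rightarrow> nat" and M :: "('r, 'm) module"
begin

lemma scale_closed: "k \<in> carrier K \<Longrightarrow> m \<in> carrier M \<Longrightarrow> \<kappa> k \<odot>\<^bsub>M\<^esub> m \<in> carrier M"
  by (simp add: \<kappa>_closed M.rsmult_closed)

lemma scale_commute:
  assumes "k \<in> carrier K" "r \<in> carrier R" "m \<in> carrier M"
  shows "\<kappa> k \<odot>\<^bsub>M\<^esub> (r \<odot>\<^bsub>M\<^esub> m) = r \<odot>\<^bsub>M\<^esub> (\<kappa> k \<odot>\<^bsub>M\<^esub> m)"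
  using assms \<kappa>_central[OF assms(1,2)]
  by (simp flip: M.rsmult_assoc add: \<kappa>_closed)

lemma scale_add:
  assumes "k \<in> carrier K" "l \<in> carrier K" "m \<in> carrier M"
  shows "\<kappa> (k \<oplus> l) \<odot>\<^bsub>M\<^esub> m = \<kappa> k \<odot>\<^bsub>M\<^esub> m \<oplus>\<^bsub>M\<^esub> \<kappa> l \<odot>\<^bsub>M\<^esub> m"
  using assms by (simp add: ring_hom_add[OF \<kappa>_hom] M.rsmult_distr_ring \<kappa>_closed)

lemma scale_mult:
  assumes "k \<in> carrier K" "l \<in> carrier K" "m \<in> carrier M"
  shows "\<kappa> (k \<otimes> l) \<odot>\<^bsub>M\<^esub> m = \<kappa> l \<odot>\<^bsub>M\<^esub> (\<kappa> k \<odot>\<^bsub>M\<^esub> m)"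
  using assms by (simp add: ring_hom_mult[OF \<kappa>_hom] M.rsmult_assoc \<kappa>_closed)

lemma scale_zero: "m \<in> carrier M \<Longrightarrow> \<kappa> \<zero> \<odot>\<^bsub>M\<^esub> m = \<zero>\<^bsub>M\<^esub>"
  by (simp add: \<kappa>_zero)

lemma scale_one: "m \<in> carrier M \<Longrightarrow> \<kappa> \<one> \<odot>\<^bsub>M\<^esub> m = m"
  by (simp add: ring_hom_one[OF \<kappa>_hom] M.rsmult_one)

lemma scale_sum:
  assumes "finite S" "\<And>i. i \<in> S \<Longrightarrow> f i \<in> carrier K" "m \<in> carrier M"
  shows "\<kappa> (\<Oplus>i\<in>S. f i) \<odot>\<^bsub>M\<^esub> m = (\<Oplus>\<^bsub>M\<^esub>i\<in>S. \<kappa> (f i) \<odot>\<^bsub>M\<^esub> m)"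
  using assms(1,2)
proof (induction S)
  case empty
  then show ?case using assms(3) by (simp add: scale_zero)
next
  case (insert i S)
  then show ?case
    using assms(3) by (simp add: Pi_iff scale_add scale_closed K.finsum_closed)
qed

lemma cover_smult_closed:
  assumes r: "r \<in> carrier R" and x: "x \<in> carrier (cover M)"
  shows "r \<odot>\<^bsub>cover M\<^esub> x \<in> carrier (cover M)"
proof (rule cover_memI)
  fix d u
  note c = coef_entry[OF r] and xD = cover_memD[OF x]
  have cl: "\<kappa> (coef r v u) \<odot>\<^bsub>M\<^esub> x d v \<in> carrier M" for v by (simp add: c xD scale_closed)
  show "(r \<odot>\<^bsub>cover M\<^esub> x) d u \<in> carrier M"
    by (simp add: cover_simps cl M.finsum_closed)
  have "E d d \<odot>\<^bsub>M\<^esub> (\<kappa> (coef r v u) \<odot>\<^bsub>M\<^esub> x d v) = \<kappa> (coef r v u) \<odot>\<^bsub>M\<^esub> x d v" for v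
    by (simp add: c xD E_closed flip: scale_commute)
  then show "E d d \<odot>\<^bsub>M\<^esub> (r \<odot>\<^bsub>cover M\<^esub> x) d u = (r \<odot>\<^bsub>cover M\<^esub> x) d u"
    by (simp add: cover_simps cl M.rsmult_finsum E_closed)
  assume no: "\<not> (d \<in> rep ` V \<and> u \<in> V \<and> leq d u)"
  have "\<kappa> (coef r v u) \<odot>\<^bsub>M\<^esub> x d v = \<zero>\<^bsub>M\<^esub>" for v
  proof (cases "d \<in> rep ` V \<and> v \<in> V \<and> leq d v")
    case True
    then have "d \<in> V" using rep_mem by auto
    then have "\<not> (v \<in> V \<and> u \<in> V \<and> leq v u)" using True no leq_trans[of d v u] by blast
    then show ?thesis using entry_zero[OF coef_closed[OF r], of v u] by (simp add: scale_zero xD)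
  next
    case False
    then show ?thesis by (simp add: xD(3) \<kappa>_closed c)
  qed
  then show "(r \<odot>\<^bsub>cover M\<^esub> x) d u = \<zero>\<^bsub>M\<^esub>" by (simp add: cover_simps)
qed

lemma abelian_group_cover: "abelian_group (cover M)"
proof (rule abelian_groupI)
  fix x assume x: "x \<in> carrier (cover M)"
  note xD = cover_memD[OF x]
  have neg: "E d d \<odot>\<^bsub>M\<^esub> (\<ominus>\<^bsub>M\<^esub> x d v) = \<ominus>\<^bsub>M\<^esub> x d v" for d v
  proof -
    have "E d d \<odot>\<^bsub>M\<^esub> (\<ominus>\<^bsub>M\<^esub> x d v) \<oplus>\<^bsub>M\<^esub> x d v = E d d \<odot>\<^bsub>M\<^esub> (\<ominus>\<^bsub>M\<^esub> x d v \<oplus>\<^bsub>M\<^esub> x d v)"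
      by (simp add: M.rsmult_distr_module xD E_closed)
    then have "E d d \<odot>\<^bsub>M\<^esub> (\<ominus>\<^bsub>M\<^esub> x d v) \<oplus>\<^bsub>M\<^esub> x d v = \<zero>\<^bsub>M\<^esub>"
      by (simp add: M.M.l_neg xD E_closed)
    then show ?thesis by (intro M.M.minus_equality[symmetric]) (simp_all add: xD E_closed M.rsmult_closed)
  qed
  then have "(\<lambda>d v. \<ominus>\<^bsub>M\<^esub> x d v) \<in> carrier (cover M)"
    by (intro cover_memI) (simp_all add: xD)
  moreover have "(\<lambda>d v. \<ominus>\<^bsub>M\<^esub> x d v) \<oplus>\<^bsub>cover M\<^esub> x = \<zero>\<^bsub>cover M\<^esub>"
    by (simp add: cover_simps M.M.l_neg xD)
  ultimately show "\<exists>y\<in>carrier (cover M). y \<oplus>\<^bsub>cover M\<^esub> x = \<zero>\<^bsub>cover M\<^esub>"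
    by (intro bexI[of _ "\<lambda>d v. \<ominus>\<^bsub>M\<^esub> x d v"])
next
  fix x y assume "x \<in> carrier (cover M)" "y \<in> carrier (cover M)"
  note D = cover_memD[OF this(1)] cover_memD[OF this(2)]
  show "x \<oplus>\<^bsub>cover M\<^esub> y \<in> carrier (cover M)"
    by (rule cover_memI) (simp_all add: cover_simps D(1,2,4,5) D(3)[of _ _] D(6)[of _ _] M.rsmult_distr_module E_closed)
  show "x \<oplus>\<^bsub>cover M\<^esub> y = y \<oplus>\<^bsub>cover M\<^esub> x"
    by (simp add: cover_simps D M.M.a_comm)
  fix z assume "z \<in> carrier (cover M)"
  note D' = cover_memD[OF this]
  show "x \<oplus>\<^bsub>cover M\<^esub> y \<oplus>\<^bsub>cover M\<^esub> z = x \<oplus>\<^bsub>cover M\<^esub> (y \<oplus>\<^bsub>cover M\<^esub> z)"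
    by (simp add: cover_simps D D' M.M.a_assoc)
next
  show "\<zero>\<^bsub>cover M\<^esub> \<in> carrier (cover M)"
    by (rule cover_memI) (simp_all add: cover_simps E_closed)
next
  fix x assume "x \<in> carrier (cover M)"
  note D = cover_memD[OF this]
  show "\<zero>\<^bsub>cover M\<^esub> \<oplus>\<^bsub>cover M\<^esub> x = x" by (simp add: cover_simps D)
qed

lemma right_module_cover: "right_module R (cover M)"
proof (intro right_module.intro right_module_axioms.intro abelian_group_cover R.ring_axioms)
  fix r x assume "r \<in> carrier R" "x \<in> carrier (cover M)"
  then show "r \<odot>\<^bsub>cover M\<^esub> x \<in> carrier (cover M)" by (rule cover_smult_closed)
next
  fix r s x assume r: "r \<in> carrier R" and s: "s \<in> carrier R" and x: "x \<in> carrier (cover M)"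
  note cr = coef_entry[OF r] and cs = coef_entry[OF s] and xD = cover_memD(1)[OF x]
  show "(r \<oplus>\<^bsub>R\<^esub> s) \<odot>\<^bsub>cover M\<^esub> x = r \<odot>\<^bsub>cover M\<^esub> x \<oplus>\<^bsub>cover M\<^esub> s \<odot>\<^bsub>cover M\<^esub> x"
    by (simp add: cover_simps coef_add[OF r s] scale_add cr cs xD scale_closed M.finsum_addf)
  show "(r \<otimes>\<^bsub>R\<^esub> s) \<odot>\<^bsub>cover M\<^esub> x = s \<odot>\<^bsub>cover M\<^esub> (r \<odot>\<^bsub>cover M\<^esub> x)"
  proof (intro ext)
    fix d u
    have "((r \<otimes>\<^bsub>R\<^esub> s) \<odot>\<^bsub>cover M\<^esub> x) d u
        = (\<Oplus>\<^bsub>M\<^esub>v\<in>V. \<Oplus>\<^bsub>M\<^esub>w\<in>V. \<kappa> (coef s w u) \<odot>\<^bsub>M\<^esub> (\<kappa> (coef r v w) \<odot>\<^bsub>M\<^esub> x d v))"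
      by (simp add: cover_simps coef_mult[OF r s] scale_sum finite_V cr cs xD scale_mult)
    also have "\<dots> = (\<Oplus>\<^bsub>M\<^esub>w\<in>V. \<Oplus>\<^bsub>M\<^esub>v\<in>V. \<kappa> (coef s w u) \<odot>\<^bsub>M\<^esub> (\<kappa> (coef r v w) \<odot>\<^bsub>M\<^esub> x d v))"
      by (intro M.M.add.finprod_finprod_swap) (simp_all add: finite_V scale_closed cr cs xD)
    also have "\<dots> = (s \<odot>\<^bsub>cover M\<^esub> (r \<odot>\<^bsub>cover M\<^esub> x)) d u"
      by (simp add: cover_simps M.rsmult_finsum \<kappa>_closed cs cr xD scale_closed)
    finally show "((r \<otimes>\<^bsub>R\<^esub> s) \<odot>\<^bsub>cover M\<^esub> x) d u = (s \<odot>\<^bsub>cover M\<^esub> (r \<odot>\<^bsub>cover M\<^esub> x)) d u" .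
  qed
next
  fix r x y assume r: "r \<in> carrier R" and x: "x \<in> carrier (cover M)" and y: "y \<in> carrier (cover M)"
  show "r \<odot>\<^bsub>cover M\<^esub> (x \<oplus>\<^bsub>cover M\<^esub> y) = r \<odot>\<^bsub>cover M\<^esub> x \<oplus>\<^bsub>cover M\<^esub> r \<odot>\<^bsub>cover M\<^esub> y"
    by (simp add: cover_simps M.rsmult_distr_module \<kappa>_closed coef_entry[OF r] cover_memD(1)[OF x]
        cover_memD(1)[OF y] M.finsum_addf scale_closed)
next
  fix x assume x: "x \<in> carrier (cover M)"
  note xD = cover_memD[OF x]
  have "(\<Oplus>\<^bsub>M\<^esub>v\<in>V. \<kappa> (\<one>\<^bsub>I\<^esub> v u) \<odot>\<^bsub>M\<^esub> x d v) = x d u" for d u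
  proof (cases "u \<in> V")
    case True
    then have "(\<Oplus>\<^bsub>M\<^esub>v\<in>V. \<kappa> (\<one>\<^bsub>I\<^esub> v u) \<odot>\<^bsub>M\<^esub> x d v) = \<kappa> (\<one>\<^bsub>I\<^esub> u u) \<odot>\<^bsub>M\<^esub> x d u"
      by (intro M.M.finsum_single) (simp_all add: finite_V I_simps scale_one scale_zero xD)
    then show ?thesis using True by (simp add: I_simps scale_one xD)
  next
    case False
    then have "(\<Oplus>\<^bsub>M\<^esub>v\<in>V. \<kappa> (\<one>\<^bsub>I\<^esub> v u) \<odot>\<^bsub>M\<^esub> x d v) = \<zero>\<^bsub>M\<^esub>"
      by (intro M.M.add.finprod_one_eqI) (auto simp: I_simps scale_zero xD)
    then show ?thesis using False xD(3) by simp
  qed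
  then show "\<one>\<^bsub>R\<^esub> \<odot>\<^bsub>cover M\<^esub> x = x" by (simp add: cover_simps coef_one)
qed

text \<open>Families of \<open>K\<close>-linear maps \<open>\<alpha> d : M\<^sub>d \<rightarrow> X\<close>.\<close>

definition linear_family :: "('r, 'x) module \<Rightarrow> ('v \<Rightarrow> 'm \<Rightarrow> 'x) \<Rightarrow> bool" where
  "linear_family X \<alpha> \<longleftrightarrow> (\<forall>d m. m \<in> carrier M \<and> E d d \<odot>\<^bsub>M\<^esub> m = m \<longrightarrow> \<alpha> d m \<in> carrier X \<and>
    (\<forall>m'. m' \<in> carrier M \<and> E d d \<odot>\<^bsub>M\<^esub> m' = m' \<longrightarrow> \<alpha> d (m \<oplus>\<^bsub>M\<^esub> m') = \<alpha> d m \<oplus>\<^bsub>X\<^esub> \<alpha> d m') \<and>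
    (\<forall>k\<in>carrier K. \<alpha> d (\<kappa> k \<odot>\<^bsub>M\<^esub> m) = \<kappa> k \<odot>\<^bsub>X\<^esub> \<alpha> d m))"

text \<open>The homomorphism that sends \<open>m \<otimes> E d v\<close> to \<open>\<alpha> d m \<sqdot> E d v\<close>.\<close>

definition from_cover :: "('r, 'x) module \<Rightarrow> ('v \<Rightarrow> 'm \<Rightarrow> 'x) \<Rightarrow> ('v \<Rightarrow> 'v \<Rightarrow> 'm) \<Rightarrow> 'x" where
  "from_cover X \<alpha> x = (\<Oplus>\<^bsub>X\<^esub>d\<in>rep ` V. \<Oplus>\<^bsub>X\<^esub>v\<in>V. E d v \<odot>\<^bsub>X\<^esub> \<alpha> d (x d v))"

text \<open>The universal property of the cover: \<open>K\<close>-linear maps on the spaces \<open>M\<^sub>d\<close> extend to a homomorphism of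
  \<open>R\<close>-modules. Both the augmentation onto \<open>M\<close> and the liftings for projectivity are of this form.\<close>

lemma right_hom_from_cover:
  fixes X :: "('r, 'x) module"
  assumes X: "right_module R X" and \<alpha>: "linear_family X \<alpha>"
  shows "from_cover X \<alpha> \<in> right_hom R (cover M) X"
proof -
  interpret X: right_module R X by fact
  interpret iX: incidence_module K V leq R \<psi> rep ht X by unfold_locales
  have \<alpha>_closed: "\<alpha> d m \<in> carrier X" if "m \<in> carrier M" "E d d \<odot>\<^bsub>M\<^esub> m = m" for d m
    using \<alpha> that unfolding linear_family_def by simp
  have \<alpha>_add: "\<alpha> d (m \<oplus>\<^bsub>M\<^esub> m') = \<alpha> d m \<oplus>\<^bsub>X\<^esub> \<alpha> d m'"
    if "m \<in> carrier M" "E d d \<odot>\<^bsub>M\<^esub> m = m" "m' \<in> carrier M" "E d d \<odot>\<^bsub>M\<^esub> m' = m'" for d m m'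
    using \<alpha> that unfolding linear_family_def by simp
  have \<alpha>_scale: "\<alpha> d (\<kappa> k \<odot>\<^bsub>M\<^esub> m) = \<kappa> k \<odot>\<^bsub>X\<^esub> \<alpha> d m"
    if "m \<in> carrier M" "E d d \<odot>\<^bsub>M\<^esub> m = m" "k \<in> carrier K" for d m k
    using \<alpha> that unfolding linear_family_def by simp
  have \<alpha>_zero: "\<alpha> d \<zero>\<^bsub>M\<^esub> = \<zero>\<^bsub>X\<^esub>" for d
    using \<alpha>_scale[of "\<zero>\<^bsub>M\<^esub>" d \<zero>] \<alpha>_closed[of "\<zero>\<^bsub>M\<^esub>" d] by (simp add: E_closed \<kappa>_zero)
  have \<alpha>_sum: "\<alpha> d (\<Oplus>\<^bsub>M\<^esub>i\<in>S. f i) = (\<Oplus>\<^bsub>X\<^esub>i\<in>S. \<alpha> d (f i))"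
    if "\<And>i. f i \<in> carrier M" "\<And>i. E d d \<odot>\<^bsub>M\<^esub> f i = f i" for d f and S :: "'v set"
  proof (induction S rule: infinite_finite_induct)
    case (insert i S)
    have "E d d \<odot>\<^bsub>M\<^esub> (\<Oplus>\<^bsub>M\<^esub>i\<in>S. f i) = (\<Oplus>\<^bsub>M\<^esub>i\<in>S. f i)"
      using that by (simp add: M.rsmult_finsum E_closed)
    then show ?case using insert that by (simp add: \<alpha>_add \<alpha>_closed M.finsum_closed)
  qed (simp_all add: \<alpha>_zero)
  show ?thesis
  proof (rule right_homI)
    fix x assume x: "x \<in> carrier (cover M)"
    note xD = cover_memD[OF x]
    have a: "\<alpha> d (x d v) \<in> carrier X" for d v by (simp add: \<alpha>_closed xD)
    show "from_cover X \<alpha> x \<in> carrier X"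
      by (simp add: from_cover_def X.finsum_closed X.rsmult_closed a E_closed)
    fix r assume r: "r \<in> carrier R"
    note c = coef_entry[OF r]
    have term_closed: "E d u \<odot>\<^bsub>X\<^esub> (\<kappa> (coef r v u) \<odot>\<^bsub>X\<^esub> \<alpha> d (x d v)) \<in> carrier X" for d u v
      by (simp add: a c X.rsmult_closed E_closed \<kappa>_closed)
    have act: "r \<odot>\<^bsub>X\<^esub> (E d v \<odot>\<^bsub>X\<^esub> \<alpha> d (x d v))
        = (\<Oplus>\<^bsub>X\<^esub>u\<in>V. E d u \<odot>\<^bsub>X\<^esub> (\<kappa> (coef r v u) \<odot>\<^bsub>X\<^esub> \<alpha> d (x d v)))" for d v
    proof (cases "d \<in> rep ` V \<and> v \<in> V \<and> leq d v")
      case True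
      then have "d \<in> V" using rep_mem by auto
      have "r \<odot>\<^bsub>X\<^esub> (E d v \<odot>\<^bsub>X\<^esub> \<alpha> d (x d v)) = (E d v \<otimes>\<^bsub>R\<^esub> r) \<odot>\<^bsub>X\<^esub> \<alpha> d (x d v)"
        by (simp add: X.rsmult_assoc E_closed r a)
      also have "\<dots> = (\<Oplus>\<^bsub>X\<^esub>u\<in>V. (\<kappa> (coef r v u) \<otimes>\<^bsub>R\<^esub> E d u) \<odot>\<^bsub>X\<^esub> \<alpha> d (x d v))"
        using True \<open>d \<in> V\<close> r
        by (simp add: E_row_mult X.finsum_rsmult a E_closed \<kappa>_closed c)
      finally show ?thesis by (simp add: X.rsmult_assoc E_closed \<kappa>_closed c a)
    next
      case False
      then show ?thesis using xD(3)[OF False] r by (simp add: \<alpha>_zero E_closed \<kappa>_closed c)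
    qed
    have "from_cover X \<alpha> (r \<odot>\<^bsub>cover M\<^esub> x)
        = (\<Oplus>\<^bsub>X\<^esub>d\<in>rep ` V. \<Oplus>\<^bsub>X\<^esub>u\<in>V. \<Oplus>\<^bsub>X\<^esub>v\<in>V. E d u \<odot>\<^bsub>X\<^esub> (\<kappa> (coef r v u) \<odot>\<^bsub>X\<^esub> \<alpha> d (x d v)))"
    proof -
      have "\<alpha> d ((r \<odot>\<^bsub>cover M\<^esub> x) d u) = (\<Oplus>\<^bsub>X\<^esub>v\<in>V. \<kappa> (coef r v u) \<odot>\<^bsub>X\<^esub> \<alpha> d (x d v))" for d u
        unfolding cover_simps using xD
        by (subst \<alpha>_sum) (simp_all add: scale_closed c \<alpha>_scale E_closed flip: scale_commute)
      then show ?thesis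
        by (simp add: from_cover_def X.rsmult_finsum E_closed a c X.rsmult_closed \<kappa>_closed)
    qed
    also have "\<dots> = (\<Oplus>\<^bsub>X\<^esub>d\<in>rep ` V. \<Oplus>\<^bsub>X\<^esub>v\<in>V. \<Oplus>\<^bsub>X\<^esub>u\<in>V. E d u \<odot>\<^bsub>X\<^esub> (\<kappa> (coef r v u) \<odot>\<^bsub>X\<^esub> \<alpha> d (x d v)))"
      by (subst X.M.add.finprod_finprod_swap[OF finite_V finite_V]) (simp_all add: term_closed)
    also have "\<dots> = r \<odot>\<^bsub>X\<^esub> from_cover X \<alpha> x"
      by (simp add: from_cover_def X.rsmult_finsum r act[symmetric] X.finsum_closed X.rsmult_closed a E_closed)
    finally show "from_cover X \<alpha> (r \<odot>\<^bsub>cover M\<^esub> x) = r \<odot>\<^bsub>X\<^esub> from_cover X \<alpha> x" .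
  next
    fix x y assume x: "x \<in> carrier (cover M)" and y: "y \<in> carrier (cover M)"
    note D = cover_memD(1,2)[OF x] cover_memD(1,2)[OF y]
    show "from_cover X \<alpha> (x \<oplus>\<^bsub>cover M\<^esub> y) = from_cover X \<alpha> x \<oplus>\<^bsub>X\<^esub> from_cover X \<alpha> y"
      by (simp add: from_cover_def cover_simps \<alpha>_add \<alpha>_closed D X.rsmult_distr_module E_closed
          X.rsmult_closed X.finsum_addf X.finsum_closed)
  qed
qed

end

text \<open>\<open>M\<close> is zero at every vertex of height at most \<open>k\<close>; the elements of \<open>M\<close> at \<open>v\<close> are those fixed by
  \<open>E v v\<close>.\<close>

definition (in stratified_incidence_ring) vanishes_to :: "('r, 'm) module \<Rightarrow> nat \<Rightarrow> bool" where
  "vanishes_to M k \<longleftrightarrow>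
    (\<forall>v\<in>V. \<forall>m\<in>carrier M. ht v \<le> k \<longrightarrow> E v v \<odot>\<^bsub>M\<^esub> m = m \<longrightarrow> m = \<zero>\<^bsub>M\<^esub>)"

context incidence_module
begin

lemma rep_image_V: "d \<in> rep ` V \<Longrightarrow> d \<in> V"
  using rep_mem by auto

text \<open>The element \<open>m \<otimes> E d d\<close> of the cover.\<close>

definition single :: "'v \<Rightarrow> 'm \<Rightarrow> 'v \<Rightarrow> 'v \<Rightarrow> 'm" where
  "single d m = (\<lambda>d' v. if d' = d \<and> v = d \<and> d \<in> rep ` V then m else \<zero>\<^bsub>M\<^esub>)"

lemma single_closed:
  assumes "m \<in> carrier M" "E d d \<odot>\<^bsub>M\<^esub> m = m"
  shows "single d m \<in> carrier (cover M)"
  using assms rep_image_V leq_refl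
  by (intro cover_memI) (auto simp: single_def E_closed)

lemma E_smult_single:
  assumes "m \<in> carrier M" "d \<in> rep ` V" "v \<in> V"
  shows "(E d v \<odot>\<^bsub>cover M\<^esub> single d m) d' u = (if d' = d \<and> u = v \<and> leq d v then m else \<zero>\<^bsub>M\<^esub>)"
proof -
  have d: "d \<in> V" using assms rep_image_V by simp
  have K: "unit_matrix d v x y \<in> carrier K" for x y by (simp add: unit_matrix_def)
  have s: "single d m d' w \<in> carrier M" for w using assms by (simp add: single_def)
  have "(E d v \<odot>\<^bsub>cover M\<^esub> single d m) d' u = \<kappa> (unit_matrix d v d u) \<odot>\<^bsub>M\<^esub> single d m d' d"
    unfolding cover_simps coef_E using finite_V d s assms(1)
    by (intro M.M.finsum_single) (simp_all add: single_def scale_closed K \<kappa>_closed)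
  then show ?thesis
    using assms d by (auto simp: single_def unit_matrix_def scale_one scale_zero \<kappa>_closed)
qed

text \<open>The cover is generated by the elements \<open>m \<otimes> E d d\<close>: its element with coefficients \<open>x d v\<close> is the sum of
  all \<open>(x d v \<otimes> E d d) \<sqdot> E d v\<close>. So a homomorphism on the cover is determined by its values on these
  generators.\<close>

lemma cover_expansion:
  assumes x: "x \<in> carrier (cover M)"
  shows "from_cover (cover M) single x = x"
proof -
  note xD = cover_memD[OF x]
  interpret C: right_module R "cover M" by (rule right_module_cover)
  let ?t = "\<lambda>d v. E d v \<odot>\<^bsub>cover M\<^esub> single d (x d v)"
  have cl: "?t d v \<in> carrier (cover M)" for d v
    by (simp add: C.rsmult_closed E_closed single_closed xD)
  have eval: "(finsum (cover M) f S) d u = (\<Oplus>\<^bsub>M\<^esub>i\<in>S. f i d u)"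
    if "\<And>i. i \<in> S \<Longrightarrow> f i \<in> carrier (cover M)" for f :: "'v \<Rightarrow> _" and S d u
    using that
  proof (induction S rule: infinite_finite_induct)
    case (insert i S)
    then have "f i d u \<in> carrier M" "\<And>j. j \<in> S \<Longrightarrow> f j d u \<in> carrier M"
      using cover_memD(1) by blast+
    then show ?case using insert by (simp add: Pi_iff cover_simps)
  qed (simp_all add: cover_simps)
  have "from_cover (cover M) single x d' u = x d' u" for d' u
  proof -
    have "from_cover (cover M) single x d' u = (\<Oplus>\<^bsub>M\<^esub>d\<in>rep ` V. \<Oplus>\<^bsub>M\<^esub>v\<in>V. ?t d v d' u)"
      by (simp add: from_cover_def eval cl C.finsum_closed)
    also have "\<dots> = (\<Oplus>\<^bsub>M\<^esub>d\<in>rep ` V. \<Oplus>\<^bsub>M\<^esub>v\<in>V. if d' = d \<and> u = v \<and> leq d v then x d v else \<zero>\<^bsub>M\<^esub>)"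
      by (intro M.M.finsum_cong') (auto simp: E_smult_single xD intro!: M.M.finsum_cong' M.M.finsum_closed)
    also have "\<dots> = x d' u"
    proof (cases "d' \<in> rep ` V \<and> u \<in> V \<and> leq d' u")
      case True
      have "(\<Oplus>\<^bsub>M\<^esub>d\<in>rep ` V. \<Oplus>\<^bsub>M\<^esub>v\<in>V. if d' = d \<and> u = v \<and> leq d v then x d v else \<zero>\<^bsub>M\<^esub>)
          = (\<Oplus>\<^bsub>M\<^esub>v\<in>V. if d' = d' \<and> u = v \<and> leq d' v then x d' v else \<zero>\<^bsub>M\<^esub>)"
        using True finite_V by (intro M.M.finsum_single) (auto simp: xD intro!: M.M.finsum_closed)
      also have "\<dots> = (if d' = d' \<and> u = u \<and> leq d' u then x d' u else \<zero>\<^bsub>M\<^esub>)"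
        using True finite_V by (intro M.M.finsum_single) (auto simp: xD)
      finally show ?thesis using True by simp
    next
      case False
      then have "(if d' = d \<and> u = v \<and> leq d v then x d v else \<zero>\<^bsub>M\<^esub>) = \<zero>\<^bsub>M\<^esub>"
        if "d \<in> rep ` V" "v \<in> V" for d v using that by auto
      then have "(\<Oplus>\<^bsub>M\<^esub>d\<in>rep ` V. \<Oplus>\<^bsub>M\<^esub>v\<in>V. if d' = d \<and> u = v \<and> leq d v then x d v else \<zero>\<^bsub>M\<^esub>) = \<zero>\<^bsub>M\<^esub>"
        by (intro M.M.add.finprod_one_eqI)
      then show ?thesis using xD(3)[OF False] by simp
    qed
    finally show ?thesis .
  qed
  then show ?thesis by (intro ext)
qed

text \<open>Lift the values of \<open>g\<close> on the generators \<open>m \<otimes> E d d\<close> by a \<open>K\<close>-linear section of \<open>f\<close>, and extend by the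
  universal property.\<close>

lemma cover_lifting:
  fixes X :: "('r, 'x) module" and Y :: "('r, 'y) module"
  assumes X: "right_module R X" and Y: "right_module R Y"
    and f: "f \<in> right_hom R X Y" and surj: "f ` carrier X = carrier Y"
    and g: "g \<in> right_hom R (cover M) Y"
  shows "\<exists>h \<in> right_hom R (cover M) X. \<forall>x \<in> carrier (cover M). f (h x) = g x"
proof -
  interpret C: right_module R "cover M" by (rule right_module_cover)
  interpret X: right_module R X by fact
  interpret Y: right_module R Y by fact
  note f_simps = right_hom_closed[OF f] right_hom_add[OF f] right_hom_smult[OF f]
  note g_simps = right_hom_closed[OF g] right_hom_add[OF g] right_hom_smult[OF g]
  let ?X = "restrict_scalars \<kappa> X" and ?Y = "restrict_scalars \<kappa> Y"
  have "f \<in> right_hom K ?X ?Y"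
    by (rule right_homI) (simp_all add: f_simps \<kappa>_closed)
  then obtain s where s: "s \<in> right_hom K ?Y ?X" and fs: "\<And>y. y \<in> carrier Y \<Longrightarrow> f (s y) = y"
    using right_hom_section[OF K.field_axioms
        right_module_restrict_scalars[OF K.ring_axioms X \<kappa>_hom]
        right_module_restrict_scalars[OF K.ring_axioms Y \<kappa>_hom], of f] surj by auto
  note s_simps = right_hom_closed[OF s, simplified] right_hom_add[OF s, simplified]
    right_hom_smult[OF s, simplified]
  have single_add: "single d (m \<oplus>\<^bsub>M\<^esub> m') = single d m \<oplus>\<^bsub>cover M\<^esub> single d m'" for d m m'
    by (auto simp: single_def cover_simps fun_eq_iff)
  have single_scale: "single d (\<kappa> k \<odot>\<^bsub>M\<^esub> m) = \<kappa> k \<odot>\<^bsub>cover M\<^esub> single d m"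
    if "k \<in> carrier K" "m \<in> carrier M" for d k m
  proof (intro ext)
    fix d' u
    have s: "single d m d' w \<in> carrier M" for w using that by (simp add: single_def)
    have k: "scalar_matrix k v u \<in> carrier K" for v using that by (simp add: scalar_matrix_def)
    show "single d (\<kappa> k \<odot>\<^bsub>M\<^esub> m) d' u = (\<kappa> k \<odot>\<^bsub>cover M\<^esub> single d m) d' u"
    proof (cases "u \<in> V")
      case True
      have "(\<kappa> k \<odot>\<^bsub>cover M\<^esub> single d m) d' u = \<kappa> (scalar_matrix k u u) \<odot>\<^bsub>M\<^esub> single d m d' u"
        unfolding cover_simps coef_\<kappa>[OF that(1)] using finite_V True s k
        by (intro M.M.finsum_single) (simp_all add: scale_closed, simp add: scalar_matrix_def scale_zero)
      then show ?thesis using True that by (auto simp: scalar_matrix_def single_def \<kappa>_closed)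
    next
      case False
      have "(\<kappa> k \<odot>\<^bsub>cover M\<^esub> single d m) d' u = \<zero>\<^bsub>M\<^esub>"
        unfolding cover_simps coef_\<kappa>[OF that(1)] using False s
        by (intro M.M.add.finprod_one_eqI) (auto simp: scalar_matrix_def scale_zero)
      then show ?thesis using False rep_image_V by (auto simp: single_def)
    qed
  qed
  \<comment> \<open>The lifted values on the generators.\<close>
  define \<alpha> where "\<alpha> d m = s (g (single d m))" for d m
  have "linear_family X \<alpha>"
    unfolding linear_family_def \<alpha>_def
    by (simp add: single_add single_scale single_closed g_simps s_simps \<kappa>_closed)
  then have h: "from_cover X \<alpha> \<in> right_hom R (cover M) X"
    by (rule right_hom_from_cover[OF X])
  have "f (from_cover X \<alpha> x) = g x" if x: "x \<in> carrier (cover M)" for x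
  proof -
    note xD = cover_memD[OF x]
    have cl: "single d (x d v) \<in> carrier (cover M)" for d v by (simp add: single_closed xD)
    have \<alpha>cl: "\<alpha> d (x d v) \<in> carrier X" for d v by (simp add: \<alpha>_def cl g_simps s_simps)
    have "f (from_cover X \<alpha> x) = (\<Oplus>\<^bsub>Y\<^esub>d\<in>rep ` V. \<Oplus>\<^bsub>Y\<^esub>v\<in>V. E d v \<odot>\<^bsub>Y\<^esub> g (single d (x d v)))"
    proof -
      have "f (\<alpha> d (x d v)) = g (single d (x d v))" for d v
        by (simp add: \<alpha>_def fs cl g_simps)
      then show ?thesis
        by (simp add: from_cover_def X.right_hom_finsum[OF Y f] X.finsum_closed X.rsmult_closed
            E_closed \<alpha>cl f_simps)
    qed
    also have "\<dots> = g (from_cover (cover M) single x)"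
      by (simp add: from_cover_def C.right_hom_finsum[OF Y g] C.finsum_closed C.rsmult_closed
          E_closed cl g_simps)
    finally show ?thesis using cover_expansion[OF x] by simp
  qed
  with h show ?thesis by (intro bexI[of _ "from_cover X \<alpha>"] ballI) simp_all
qed

definition augmentation :: "('v \<Rightarrow> 'v \<Rightarrow> 'm) \<Rightarrow> 'm" where
  "augmentation = from_cover M (\<lambda>d m. m)"

lemma right_hom_augmentation: "augmentation \<in> right_hom R (cover M) M"
  unfolding augmentation_def
  by (rule right_hom_from_cover[OF M.right_module_axioms]) (simp add: linear_family_def)

text \<open>In \<open>M\<close> one has \<open>m = \<Sum>\<^sub>v m \<sqdot> E v v\<close>, and with \<open>d = rep v\<close> the summand \<open>m \<sqdot> E v v\<close> is
  \<open>(m \<sqdot> E v d) \<sqdot> E d v\<close>, the image of \<open>(m \<sqdot> E v d) \<otimes> E d v\<close>.\<close>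

lemma augmentation_surj: "augmentation ` carrier (cover M) = carrier M"
proof (intro equalityI subsetI)
  fix m assume m: "m \<in> carrier M"
  define x where "x d v = (if v \<in> V \<and> d = rep v then E v d \<odot>\<^bsub>M\<^esub> m else \<zero>\<^bsub>M\<^esub>)" for d v
  have x: "x \<in> carrier (cover M)"
  proof (rule cover_memI)
    fix d v
    show "x d v \<in> carrier M" by (simp add: x_def m E_closed M.rsmult_closed)
    show "E d d \<odot>\<^bsub>M\<^esub> x d v = x d v"
    proof (cases "v \<in> V \<and> d = rep v")
      case True
      then have "E v d \<otimes>\<^bsub>R\<^esub> E d d = E v d" by (simp add: E_mult rep_mem leq_rep leq_refl)
      then show ?thesis using True m by (simp add: x_def E_closed flip: M.rsmult_assoc)
    next
      case False
      then show ?thesis by (auto simp: x_def E_closed)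
    qed
    show "x d v = \<zero>\<^bsub>M\<^esub>" if "\<not> (d \<in> rep ` V \<and> v \<in> V \<and> leq d v)"
      using that rep_leq by (auto simp: x_def)
  qed
  note xD = cover_memD[OF x]
  have "augmentation x = (\<Oplus>\<^bsub>M\<^esub>v\<in>V. \<Oplus>\<^bsub>M\<^esub>d\<in>rep ` V. E d v \<odot>\<^bsub>M\<^esub> x d v)"
    unfolding augmentation_def from_cover_def
    by (rule M.M.add.finprod_finprod_swap) (simp_all add: finite_V xD E_closed M.rsmult_closed)
  also have "\<dots> = (\<Oplus>\<^bsub>M\<^esub>v\<in>V. E v v \<odot>\<^bsub>M\<^esub> m)"
  proof (rule M.M.finsum_cong')
    fix v assume v: "v \<in> V"
    have "(\<Oplus>\<^bsub>M\<^esub>d\<in>rep ` V. E d v \<odot>\<^bsub>M\<^esub> x d v) = E (rep v) v \<odot>\<^bsub>M\<^esub> x (rep v) v"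
      using v finite_V by (intro M.M.finsum_single) (simp_all add: xD E_closed M.rsmult_closed, simp add: x_def E_closed)
    also have "\<dots> = (E v (rep v) \<otimes>\<^bsub>R\<^esub> E (rep v) v) \<odot>\<^bsub>M\<^esub> m"
      using v m by (simp add: x_def E_closed M.rsmult_assoc)
    also have "E v (rep v) \<otimes>\<^bsub>R\<^esub> E (rep v) v = E v v"
      using v by (simp add: E_mult rep_mem leq_rep rep_leq)
    finally show "(\<Oplus>\<^bsub>M\<^esub>d\<in>rep ` V. E d v \<odot>\<^bsub>M\<^esub> x d v) = E v v \<odot>\<^bsub>M\<^esub> m" .
  qed (simp_all add: m E_closed M.rsmult_closed)
  also have "\<dots> = m"
    using M.finsum_rsmult[OF m, of "\<lambda>v. E v v" V] m by (simp add: E_closed sum_E M.rsmult_one)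
  finally show "m \<in> augmentation ` carrier (cover M)" using x by (metis imageI)
qed (use right_hom_closed[OF right_hom_augmentation] in auto)

text \<open>An element of the cover at \<open>v\<close> has coefficients \<open>x d v\<close> only. Those with \<open>d \<noteq> rep v\<close> belong to a vertex
  of height below \<open>ht v\<close> and vanish by assumption. The last one is determined by its image \<open>x d v \<sqdot> E d v\<close>
  in \<open>M\<close>, as multiplication by \<open>E v d\<close> recovers it; on the kernel it is zero.\<close>

lemma kernel_vanishes:
  assumes van: "vanishes_to M k" and x: "x \<in> carrier (cover M)" and ker: "augmentation x = \<zero>\<^bsub>M\<^esub>"
    and v: "v \<in> V" "ht v \<le> Suc k" and fixed: "E v v \<odot>\<^bsub>cover M\<^esub> x = x"
  shows "x = \<zero>\<^bsub>cover M\<^esub>"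
proof -
  note xD = cover_memD[OF x]
  have other: "x d u = \<zero>\<^bsub>M\<^esub>" if "u \<noteq> v" for d u
  proof -
    have "(E v v \<odot>\<^bsub>cover M\<^esub> x) d u = \<zero>\<^bsub>M\<^esub>"
      unfolding cover_simps coef_E using that
      by (intro M.M.add.finprod_one_eqI) (simp add: unit_matrix_def scale_zero xD)
    then show ?thesis by (simp add: fixed)
  qed
  have other': "x d v = \<zero>\<^bsub>M\<^esub>" if "d \<noteq> rep v" for d
  proof (cases "d \<in> rep ` V \<and> v \<in> V \<and> leq d v")
    case True
    then have "ht d < ht v" using that by (intro ht_less) auto
    then have "ht d \<le> k" using v by simp
    then show ?thesis
      using van[unfolded vanishes_to_def, THEN bspec, THEN bspec, OF rep_image_V xD(1)] True xD(2)
      by blast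
  next
    case False
    then show ?thesis by (rule xD(3))
  qed
  let ?m = "x (rep v) v"
  have cl: "E d u \<odot>\<^bsub>M\<^esub> x d u \<in> carrier M" for d u by (simp add: xD E_closed M.rsmult_closed)
  have "augmentation x = (\<Oplus>\<^bsub>M\<^esub>u\<in>V. E (rep v) u \<odot>\<^bsub>M\<^esub> x (rep v) u)"
    unfolding augmentation_def from_cover_def using v finite_V
    by (intro M.M.finsum_single)
      (simp_all add: cl M.M.finsum_closed, intro M.M.add.finprod_one_eqI,
        metis other other' M.rsmult_zero_module E_closed)
  also have "\<dots> = E (rep v) v \<odot>\<^bsub>M\<^esub> ?m"
    using v finite_V
    by (intro M.M.finsum_single) (simp_all add: cl, simp add: other E_closed)
  finally have "E (rep v) v \<odot>\<^bsub>M\<^esub> ?m = \<zero>\<^bsub>M\<^esub>"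
    using ker by simp
  then have "E v (rep v) \<odot>\<^bsub>M\<^esub> (E (rep v) v \<odot>\<^bsub>M\<^esub> ?m) = \<zero>\<^bsub>M\<^esub>"
    by (simp add: E_closed)
  moreover have "E (rep v) v \<otimes>\<^bsub>R\<^esub> E v (rep v) = E (rep v) (rep v)"
    using v by (simp add: E_mult rep_mem leq_rep rep_leq)
  ultimately have "?m = \<zero>\<^bsub>M\<^esub>"
    using xD by (simp add: E_closed flip: M.rsmult_assoc)
  then have "x d u = \<zero>\<^bsub>M\<^esub>" for d u
    using other other' by (cases "u = v"; cases "d = rep v") simp_all
  then show ?thesis by (simp add: cover_simps fun_eq_iff)
qed

lemma zero_if_vanishes:
  assumes "vanishes_to M k" "\<And>v. v \<in> V \<Longrightarrow> ht v \<le> k"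
  shows "carrier M = {\<zero>\<^bsub>M\<^esub>}"
proof -
  \<comment> \<open>\<open>m\<close> is the sum of its products with the \<open>E v v\<close>, and each of these is zero.\<close>
  have "m = \<zero>\<^bsub>M\<^esub>" if m: "m \<in> carrier M" for m
  proof -
    have "E v v \<odot>\<^bsub>M\<^esub> m = \<zero>\<^bsub>M\<^esub>" if "v \<in> V" for v
    proof -
      have "E v v \<odot>\<^bsub>M\<^esub> (E v v \<odot>\<^bsub>M\<^esub> m) = E v v \<odot>\<^bsub>M\<^esub> m"
        using that m by (simp add: E_closed E_mult leq_refl flip: M.rsmult_assoc)
      then show ?thesis
        using assms that m M.rsmult_closed[OF E_closed m] unfolding vanishes_to_def by simp
    qed
    then have "(\<Oplus>\<^bsub>M\<^esub>v\<in>V. E v v \<odot>\<^bsub>M\<^esub> m) = \<zero>\<^bsub>M\<^esub>" by (intro M.M.add.finprod_one_eqI)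
    then show ?thesis
      using M.finsum_rsmult[OF m, of "\<lambda>v. E v v" V] m by (simp add: E_closed sum_E M.rsmult_one)
  qed
  then show ?thesis by auto
qed

end

section \<open>Global dimension of an incidence algebra\<close>

lemma concat_map_inj:
  assumes "concat (map f ps) = concat (map g ps)"
    and "\<And>p. p \<in> set ps \<Longrightarrow> length (f p) = L" "\<And>p. p \<in> set ps \<Longrightarrow> length (g p) = L"
    and "p \<in> set ps"
  shows "f p = g p"
  using assms by (induction ps) auto

context stratified_incidence_ring
begin

text \<open>The family of the \<open>x d v\<close>, enumerated in a fixed order, can be read off from the concatenation of
  its members because they all have the same length.\<close>

lemma cover_embeds_in_lists:
  fixes M :: "('r, 'u list) module"
  assumes M: "right_module R M" and len: "\<And>m. m \<in> carrier M \<Longrightarrow> length m = L"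
  obtains \<iota> :: "('v \<Rightarrow> 'v \<Rightarrow> 'u list) \<Rightarrow> 'u list" and L' where
    "inj_on \<iota> (carrier (cover M))" "\<And>x. x \<in> carrier (cover M) \<Longrightarrow> length (\<iota> x) = L'"
proof -
  obtain ps where ps: "set ps = V \<times> V" using finite_list[of "V \<times> V"] finite_V by auto
  define \<iota> where "\<iota> x = concat (map (\<lambda>p. x (fst p) (snd p)) ps)" for x :: "'v \<Rightarrow> 'v \<Rightarrow> 'u list"
  have len_x: "length (x d v) = L" if "x \<in> carrier (cover M)" for x d v
    using cover_memD(1)[OF that] len by simp
  have "inj_on \<iota> (carrier (cover M))"
  proof (rule inj_onI, intro ext)
    fix x y d v assume x: "x \<in> carrier (cover M)" and y: "y \<in> carrier (cover M)" and eq: "\<iota> x = \<iota> y"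
    show "x d v = y d v"
    proof (cases "(d, v) \<in> V \<times> V")
      case True
      then show ?thesis
        using concat_map_inj[of "\<lambda>p. x (fst p) (snd p)" ps "\<lambda>p. y (fst p) (snd p)" L "(d, v)"]
          eq len_x[OF x] len_x[OF y] ps by (simp add: \<iota>_def)
    next
      case False
      then have "\<not> (d \<in> rep ` V \<and> v \<in> V \<and> leq d v)" using rep_mem by auto
      then show ?thesis using cover_memD(3)[OF x] cover_memD(3)[OF y] by simp
    qed
  qed
  moreover have "length (\<iota> x) = (\<Sum>p\<leftarrow>ps. L)" if "x \<in> carrier (cover M)" for x
    by (simp add: \<iota>_def length_concat comp_def len_x[OF that])
  ultimately show thesis by (rule that)
qed

text \<open>Replacing \<open>M\<close> by the kernel of its cover raises the bound \<open>k\<close> by one and lowers the number \<open>n\<close> of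
  remaining heights by one; for \<open>n = 0\<close> the module is zero.\<close>

lemma has_resolution_lists:
  fixes M :: "('r, 'u list) module"
  assumes "right_module R M" and "\<And>m. m \<in> carrier M \<Longrightarrow> length m = L"
    and "vanishes_to M k" and "\<And>v. v \<in> V \<Longrightarrow> ht v \<le> k + n"
  shows "has_resolution TYPE('u list) R M n"
  using assms
proof (induction n arbitrary: M k L)
  case 0
  interpret iM: incidence_module K V leq R \<psi> rep ht M
    using 0(1) by (intro incidence_module.intro stratified_incidence_ring_axioms)
  show ?case using iM.zero_if_vanishes[of k] 0 by (intro has_resolution_zero) auto
next
  case (Suc n)
  interpret iM: incidence_module K V leq R \<psi> rep ht M
    using Suc.prems(1) by (intro incidence_module.intro stratified_incidence_ring_axioms)
  obtain \<iota> :: "('v \<Rightarrow> 'v \<Rightarrow> 'u list) \<Rightarrow> 'u list" and L' where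
    inj: "inj_on \<iota> (carrier (cover M))" and L': "\<And>x. x \<in> carrier (cover M) \<Longrightarrow> length (\<iota> x) = L'"
    using cover_embeds_in_lists[OF Suc.prems(1,2)] by metis
  note image = image_module[OF iM.right_module_cover inj]
  define P where "P = image_module \<iota> (cover M)"
  define p where "p y = iM.augmentation (inv_into (carrier (cover M)) \<iota> y)" for y
  have P: "right_module R P" unfolding P_def by (rule image)
  have proj: "projective_module R P"
    unfolding P_def using iM.right_module_cover inj
  proof (rule projective_image_module)
    show "\<exists>h\<in>right_hom R (cover M) X. \<forall>x\<in>carrier (cover M). f (h x) = g x"
      if "right_module R X" "right_module R Y" "f \<in> right_hom R X Y" "f ` carrier X = carrier Y"
        "g \<in> right_hom R (cover M) Y" for X Y :: "('r, 'u list) module" and f g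
      by (rule iM.cover_lifting[OF that])
  qed
  have p: "p \<in> right_hom R P M"
    unfolding p_def P_def by (rule right_hom_comp[OF image(3) iM.right_hom_augmentation])
  have p_\<iota>: "p (\<iota> x) = iM.augmentation x" if "x \<in> carrier (cover M)" for x
    using that inj by (simp add: p_def)
  have carrier_P: "carrier P = \<iota> ` carrier (cover M)" unfolding P_def by (rule image)
  have "p ` carrier P = iM.augmentation ` carrier (cover M)"
    unfolding carrier_P image_image by (rule image_cong) (simp_all add: p_\<iota>)
  then have surj: "p ` carrier P = carrier M" by (simp add: iM.augmentation_surj)
  let ?N = "P\<lparr>carrier := {x \<in> carrier P. p x = \<zero>\<^bsub>M\<^esub>}\<rparr>"
  have "has_resolution TYPE('u list) R ?N n"
  proof (rule Suc.IH[of _ L' "Suc k"])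
    show "right_module R ?N" by (rule right_module_kernel[OF P Suc.prems(1) p])
    show "length m = L'" if "m \<in> carrier ?N" for m
      using that L' by (auto simp: carrier_P)
    show "ht v \<le> Suc k + n" if "v \<in> V" for v using Suc.prems(4)[OF that] by simp
    show "vanishes_to ?N (Suc k)"
      unfolding vanishes_to_def
    proof (intro ballI impI)
      fix v y assume v: "v \<in> V" "ht v \<le> Suc k" and y: "y \<in> carrier ?N"
        and fixed: "E v v \<odot>\<^bsub>?N\<^esub> y = y"
      obtain x where x: "x \<in> carrier (cover M)" "y = \<iota> x" using y by (auto simp: carrier_P)
      have "\<iota> (E v v \<odot>\<^bsub>cover M\<^esub> x) = \<iota> x"
        using fixed right_hom_smult[OF image(2) E_closed x(1)] by (simp add: x(2) P_def)
      then have "E v v \<odot>\<^bsub>cover M\<^esub> x = x"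
        using inj_onD[OF inj] iM.cover_smult_closed[OF E_closed x(1)] x(1) by blast
      moreover have "iM.augmentation x = \<zero>\<^bsub>M\<^esub>" using y x by (simp add: p_\<iota>)
      ultimately have "x = \<zero>\<^bsub>cover M\<^esub>"
        using iM.kernel_vanishes[OF Suc.prems(3) x(1) _ v] by blast
      then show "y = \<zero>\<^bsub>?N\<^esub>" by (simp add: x(2) P_def image(5))
    qed
  qed
  then show ?case by (rule has_resolution_extend[OF proj Suc.prems(1) p surj])
qed

theorem gl_dim_le:
  assumes "\<And>v. v \<in> V \<Longrightarrow> 0 < ht v" and "\<And>v. v \<in> V \<Longrightarrow> ht v \<le> n"
  shows "gl_dim TYPE('m) R \<le> enat n"
  unfolding gl_dim_def
proof (rule Sup_least)
  fix b assume "b \<in> {proj_dim R M | M :: ('r, 'm) module. right_module R M}"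
  then obtain M :: "('r, 'm) module" where M: "right_module R M" and b: "b = proj_dim R M" by blast
  \<comment> \<open>Elements of \<open>M\<close> become lists of length one. The element type is a product, whence the dummy first component.\<close>
  define \<iota> :: "'m \<Rightarrow> ('r \<times> 'm) list" where "\<iota> m = [(undefined, m)]" for m
  have inj: "inj_on \<iota> (carrier M)" by (auto simp: \<iota>_def inj_on_def)
  note image = image_module[OF M inj]
  have "has_resolution TYPE(('r \<times> 'm) list) R (image_module \<iota> M) n"
  proof (rule has_resolution_lists[of _ 1 0])
    show "right_module R (image_module \<iota> M)" by (rule image)
    show "length m = 1" if "m \<in> carrier (image_module \<iota> M)" for m
      using that by (auto simp: image(4) \<iota>_def)
    show "vanishes_to (image_module \<iota> M) 0"
      by (auto simp: vanishes_to_def dest!: assms(1))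
  qed (simp add: assms(2))
  moreover have "bij_betw (inv_into (carrier M) \<iota>) (carrier (image_module \<iota> M)) (carrier M)"
    unfolding image(4) using inj by (intro bij_betw_inv_into inj_on_imp_bij_betw)
  ultimately have "has_resolution TYPE(('r \<times> 'm) list) R M n"
    using has_resolution_iso[OF image(1) M image(3)] by blast
  then show "b \<le> enat n" unfolding b by (rule proj_dim_le_of_resolution)
qed

end

section \<open>Chains and heights\<close>

definition chains :: "'s set \<Rightarrow> ('s \<Rightarrow> 's \<Rightarrow> bool) \<Rightarrow> 's list set" where
  "chains S leq = {xs. set xs \<subseteq> S \<and> sorted_wrt (\<lambda>x y. leq x y \<and> x \<noteq> y) xs}"

lemma longest_chain_length_eq: "longest_chain_length S leq = Max (length ` chains S leq)"
  unfolding longest_chain_length_def chains_def by (rule arg_cong[of _ _ Max]) blast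

lemma finite_chain_lengths:
  assumes "finite S"
  shows "finite (length ` chains S leq)"
proof (rule finite_subset[of _ "{..card S}"])
  have "length xs \<le> card S" if "xs \<in> chains S leq" for xs
  proof -
    have "sorted_wrt (\<lambda>x y. leq x y \<and> x \<noteq> y) xs" "set xs \<subseteq> S" using that by (simp_all add: chains_def)
    from this(1) have "distinct xs" by (induction xs) auto
    then show ?thesis using card_mono[OF assms \<open>set xs \<subseteq> S\<close>] by (simp add: distinct_card)
  qed
  then show "length ` chains S leq \<subseteq> {..card S}" by auto
qed simp

lemma chain_length_le:
  assumes "finite S" "xs \<in> chains S leq"
  shows "length xs \<le> longest_chain_length S leq"
  unfolding longest_chain_length_eq using assms by (intro Max_ge finite_chain_lengths imageI)

lemma longest_chain_exists:
  assumes "finite S"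
  obtains xs where "xs \<in> chains S leq" "length xs = longest_chain_length S leq"
proof -
  have "[] \<in> chains S leq" by (simp add: chains_def)
  then have "length ` chains S leq \<noteq> {}" by blast
  from Max_in[OF finite_chain_lengths[OF assms] this] obtain xs
    where "xs \<in> chains S leq" "Max (length ` chains S leq) = length xs" by (rule imageE)
  then show thesis using that by (simp add: longest_chain_length_eq)
qed

definition height :: "'s set \<Rightarrow> ('s \<Rightarrow> 's \<Rightarrow> bool) \<Rightarrow> 's \<Rightarrow> nat" where
  "height S leq x = longest_chain_length {y \<in> S. leq y x} leq"

lemma height_le:
  assumes "finite S"
  shows "height S leq x \<le> longest_chain_length S leq"
proof -
  have "finite {y \<in> S. leq y x}" using assms by simp
  then obtain xs where xs: "xs \<in> chains {y \<in> S. leq y x} leq" "length xs = height S leq x"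
    unfolding height_def by (rule longest_chain_exists)
  then have "xs \<in> chains S leq" by (auto simp: chains_def)
  then show ?thesis using chain_length_le[OF assms] xs(2) by metis
qed

lemma height_pos:
  assumes "finite S" "x \<in> S" "leq x x"
  shows "0 < height S leq x"
  unfolding height_def using chain_length_le[of "{y \<in> S. leq y x}" "[x]" leq] assms
  by (simp add: chains_def)

text \<open>A longest chain below \<open>x\<close> can be extended by \<open>y\<close>.\<close>

lemma height_less:
  assumes "finite S" "x \<in> S" "y \<in> S" "leq x y" "x \<noteq> y" "leq y y"
    and trans: "\<And>x y z. \<lbrakk>x \<in> S; y \<in> S; z \<in> S; leq x y; leq y z\<rbrakk> \<Longrightarrow> leq x z"
    and antisym: "\<And>x y. \<lbrakk>x \<in> S; y \<in> S; leq x y; leq y x\<rbrakk> \<Longrightarrow> x = y"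
  shows "height S leq x < height S leq y"
proof -
  have fin: "finite {z \<in> S. leq z u}" for u using assms(1) by simp
  obtain xs where xs: "xs \<in> chains {z \<in> S. leq z x} leq" "length xs = height S leq x"
    unfolding height_def by (rule longest_chain_exists[OF fin])
  have below: "z \<in> S \<and> leq z y \<and> z \<noteq> y" if "z \<in> set xs" for z
  proof -
    have z: "z \<in> S" "leq z x" using that xs(1) by (auto simp: chains_def)
    show ?thesis using trans[OF z(1) assms(2,3) z(2) assms(4)] antisym[OF assms(2,3,4)] z assms(5) by blast
  qed
  have "sorted_wrt (\<lambda>x y. leq x y \<and> x \<noteq> y) (xs @ [y])"
    using xs(1) below by (simp add: chains_def sorted_wrt_append)
  then have "xs @ [y] \<in> chains {z \<in> S. leq z y} leq"
    using below assms(3,6) by (auto simp: chains_def)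
  from chain_length_le[OF fin this] show ?thesis unfolding height_def[symmetric] using xs(2) by simp
qed

section \<open>The path algebra is a ring\<close>

locale finite_quiver = K: field K + Q: fin_digraph Q
  for K :: "('k, 'e) ring_scheme" (structure) and Q :: "('v, 'a) pre_digraph"
begin

abbreviation "KQ \<equiv> path_algebra K Q"

lemma path_comp_closed:
  "\<lbrakk>p \<in> qpaths Q; q \<in> qpaths Q; path_end p = path_start q\<rbrakk> \<Longrightarrow> path_comp p q \<in> qpaths Q"
  by (auto simp: qpaths_def path_comp_def path_start_def path_end_def intro: Q.awalk_appendI)

lemma path_comp_ends [simp]:
  "path_start (path_comp p q) = path_start p" "path_end (path_comp p q) = path_end q"
  by (simp_all add: path_comp_def path_start_def path_end_def)

lemma path_comp_assoc: "path_comp (path_comp p q) r = path_comp p (path_comp q r)"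
  by (simp add: path_comp_def path_start_def path_end_def)

lemma path_comp_vertex_path:
  "path_comp (vertex_path (path_start p)) p = p" "path_comp p (vertex_path (path_end p)) = p"
  by (simp_all add: path_comp_def path_start_def path_end_def vertex_path_def)

lemma vertex_path_ends [simp]: "path_start (vertex_path v) = v" "path_end (vertex_path v) = v"
  by (simp_all add: path_start_def path_end_def vertex_path_def)

lemma vertex_path_mem: "v \<in> verts Q \<Longrightarrow> vertex_path v \<in> qpaths Q"
  by (simp add: qpaths_def vertex_path_def Q.awalk_Nil_iff)

lemma path_ends_mem: "p \<in> qpaths Q \<Longrightarrow> path_start p \<in> verts Q" "p \<in> qpaths Q \<Longrightarrow> path_end p \<in> verts Q"
  by (auto simp: qpaths_def path_start_def path_end_def dest: Q.awalk_hd_in_verts Q.awalk_last_in_verts)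

text \<open>The index set of the convolution sum that defines the product in the path algebra.\<close>

definition factorizations :: "('v, 'a) qpath \<Rightarrow> (('v, 'a) qpath \<times> ('v, 'a) qpath) set" where
  "factorizations r = {(p, q). p \<in> qpaths Q \<and> q \<in> qpaths Q \<and> path_end p = path_start q \<and> path_comp p q = r}"

text \<open>A factorization is determined by the length of its first factor and the vertex where it is cut.\<close>

lemma finite_factorizations: "finite (factorizations r)"
proof -
  obtain u l w where r: "r = (u, l, w)" by (cases r)
  have "factorizations r \<subseteq> (\<lambda>(i, x). ((u, take i l, x), (x, drop i l, w))) ` ({..length l} \<times> verts Q)"
  proof (rule subsetI)
    fix z assume "z \<in> factorizations r"
    then obtain p q where z: "z = (p, q)" "p \<in> qpaths Q" "path_end p = path_start q" "path_comp p q = r"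
      by (auto simp: factorizations_def)
    obtain a b c where p: "p = (a, b, c)" by (cases p)
    obtain a' b' c' where q: "q = (a', b', c')" by (cases q)
    have "z = (\<lambda>(i, x). ((u, take i l, x), (x, drop i l, w))) (length b, c)"
      using z(1,3,4) by (simp add: r p q path_comp_def path_start_def path_end_def)
        (auto simp: path_comp_def)
    moreover have "(length b, c) \<in> {..length l} \<times> verts Q"
      using z path_ends_mem(2)[OF z(2)] by (auto simp: r p q path_comp_def path_start_def path_end_def)
    ultimately show "z \<in> (\<lambda>(i, x). ((u, take i l, x), (x, drop i l, w))) ` ({..length l} \<times> verts Q)"
      by (rule image_eqI)
  qed
  then show ?thesis by (rule finite_subset) simp
qed

definition monomial :: "'k \<Rightarrow> ('v, 'a) qpath \<Rightarrow> ('v, 'a) qpath \<Rightarrow> 'k" where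
  "monomial k p = (\<lambda>q. if q = p then k else \<zero>)"

lemma KQ_simps:
  "\<zero>\<^bsub>KQ\<^esub> = (\<lambda>p. \<zero>)"
  "\<one>\<^bsub>KQ\<^esub> = (\<lambda>p. if p \<in> vertex_path ` verts Q then \<one> else \<zero>)"
  "f \<oplus>\<^bsub>KQ\<^esub> g = (\<lambda>p. f p \<oplus> g p)"
  "f \<otimes>\<^bsub>KQ\<^esub> g = (\<lambda>r. \<Oplus>pq\<in>factorizations r. f (fst pq) \<otimes> g (snd pq))"
  "k \<odot>\<^bsub>KQ\<^esub> f = (\<lambda>p. k \<otimes> f p)"
  by (simp_all add: path_algebra_def factorizations_def split_def)

lemma KQ_memI:
  assumes "\<And>p. f p \<in> carrier K" "\<And>p. p \<notin> qpaths Q \<Longrightarrow> f p = \<zero>" "finite {p. f p \<noteq> \<zero>}"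
  shows "f \<in> carrier KQ"
  using assms by (simp add: path_algebra_def)

lemma KQ_memD:
  assumes "f \<in> carrier KQ"
  shows "f p \<in> carrier K" "p \<notin> qpaths Q \<Longrightarrow> f p = \<zero>" "finite {p. f p \<noteq> \<zero>}"
proof -
  have D: "\<forall>p\<in>qpaths Q. f p \<in> carrier K" "\<forall>p. p \<notin> qpaths Q \<longrightarrow> f p = \<zero>" "finite {p. f p \<noteq> \<zero>}"
    using assms unfolding path_algebra_def by simp_all
  show zero: "p \<notin> qpaths Q \<Longrightarrow> f p = \<zero>" using D(2) by blast
  show "f p \<in> carrier K"
  proof (cases "p \<in> qpaths Q")
    case True
    then show ?thesis using D(1) by blast
  next
    case False
    then show ?thesis unfolding zero[OF False] by simp
  qed
  show "finite {p. f p \<noteq> \<zero>}" by (rule D(3))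
qed

lemma monomial_closed: "k \<in> carrier K \<Longrightarrow> p \<in> qpaths Q \<Longrightarrow> monomial k p \<in> carrier KQ"
  by (rule KQ_memI) (auto simp: monomial_def)

lemma KQ_add_closed:
  assumes "f \<in> carrier KQ" "g \<in> carrier KQ"
  shows "f \<oplus>\<^bsub>KQ\<^esub> g \<in> carrier KQ"
proof (rule KQ_memI)
  note D = KQ_memD[OF assms(1)] KQ_memD[OF assms(2)]
  show "(f \<oplus>\<^bsub>KQ\<^esub> g) p \<in> carrier K" "p \<notin> qpaths Q \<Longrightarrow> (f \<oplus>\<^bsub>KQ\<^esub> g) p = \<zero>" for p
    using D by (simp_all add: KQ_simps)
  have "{p. (f \<oplus>\<^bsub>KQ\<^esub> g) p \<noteq> \<zero>} \<subseteq> {p. f p \<noteq> \<zero>} \<union> {p. g p \<noteq> \<zero>}" by (auto simp: KQ_simps)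
  then show "finite {p. (f \<oplus>\<^bsub>KQ\<^esub> g) p \<noteq> \<zero>}" by (rule finite_subset) (simp add: D(3,6))
qed

lemma KQ_mult_closed:
  assumes "f \<in> carrier KQ" "g \<in> carrier KQ"
  shows "f \<otimes>\<^bsub>KQ\<^esub> g \<in> carrier KQ"
proof (rule KQ_memI)
  note D = KQ_memD[OF assms(1)] KQ_memD[OF assms(2)]
  show "(f \<otimes>\<^bsub>KQ\<^esub> g) r \<in> carrier K" for r
    unfolding KQ_simps(4) by (rule K.finsum_closed) (simp add: D(1,4))
  show "(f \<otimes>\<^bsub>KQ\<^esub> g) r = \<zero>" if "r \<notin> qpaths Q" for r
  proof -
    have "factorizations r = {}" using that path_comp_closed by (auto simp: factorizations_def)
    then show ?thesis by (simp add: KQ_simps)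
  qed
  have "{r. (f \<otimes>\<^bsub>KQ\<^esub> g) r \<noteq> \<zero>} \<subseteq> (\<lambda>z. path_comp (fst z) (snd z)) ` ({p. f p \<noteq> \<zero>} \<times> {q. g q \<noteq> \<zero>})"
  proof (rule subsetI, rule ccontr)
    fix r assume r: "r \<in> {r. (f \<otimes>\<^bsub>KQ\<^esub> g) r \<noteq> \<zero>}"
      and no: "r \<notin> (\<lambda>z. path_comp (fst z) (snd z)) ` ({p. f p \<noteq> \<zero>} \<times> {q. g q \<noteq> \<zero>})"
    have "f (fst pq) \<otimes> g (snd pq) = \<zero>" if "pq \<in> factorizations r" for pq
    proof -
      have "r = path_comp (fst pq) (snd pq)" using that by (auto simp: factorizations_def)
      then have "pq \<notin> {p. f p \<noteq> \<zero>} \<times> {q. g q \<noteq> \<zero>}"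
        using no by (metis (no_types, lifting) image_eqI)
      then have "f (fst pq) = \<zero> \<or> g (snd pq) = \<zero>" by (cases pq) simp
      then show ?thesis using D(1,4) by (elim disjE) simp_all
    qed
    then have "(f \<otimes>\<^bsub>KQ\<^esub> g) r = \<zero>" unfolding KQ_simps by (rule K.add.finprod_one_eqI)
    then show False using r by simp
  qed
  then show "finite {r. (f \<otimes>\<^bsub>KQ\<^esub> g) r \<noteq> \<zero>}"
    by (rule finite_subset) (intro finite_imageI finite_cartesian_product D(3,6))
qed

lemma abelian_group_KQ: "abelian_group KQ"
proof (rule abelian_groupI)
  show "\<zero>\<^bsub>KQ\<^esub> \<in> carrier KQ" by (rule KQ_memI) (simp_all add: KQ_simps)
next
  fix f assume f: "f \<in> carrier KQ"
  note D = KQ_memD[OF f]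
  have "{p. \<ominus> f p \<noteq> \<zero>} \<subseteq> {p. f p \<noteq> \<zero>}" by auto
  then have "(\<lambda>p. \<ominus> f p) \<in> carrier KQ"
    using D finite_subset[OF _ D(3)] by (intro KQ_memI) simp_all
  moreover have "(\<lambda>p. \<ominus> f p) \<oplus>\<^bsub>KQ\<^esub> f = \<zero>\<^bsub>KQ\<^esub>" by (simp add: KQ_simps K.l_neg D)
  ultimately show "\<exists>g\<in>carrier KQ. g \<oplus>\<^bsub>KQ\<^esub> f = \<zero>\<^bsub>KQ\<^esub>" by (intro bexI[of _ "\<lambda>p. \<ominus> f p"])
  show "\<zero>\<^bsub>KQ\<^esub> \<oplus>\<^bsub>KQ\<^esub> f = f" by (simp add: KQ_simps D)
next
  fix f g assume fg: "f \<in> carrier KQ" "g \<in> carrier KQ"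
  then show "f \<oplus>\<^bsub>KQ\<^esub> g \<in> carrier KQ" by (rule KQ_add_closed)
  note D = KQ_memD(1)[OF fg(1)] KQ_memD(1)[OF fg(2)]
  show "f \<oplus>\<^bsub>KQ\<^esub> g = g \<oplus>\<^bsub>KQ\<^esub> f" by (simp add: KQ_simps K.a_comm D)
  fix h assume "h \<in> carrier KQ"
  note D' = KQ_memD(1)[OF this]
  show "f \<oplus>\<^bsub>KQ\<^esub> g \<oplus>\<^bsub>KQ\<^esub> h = f \<oplus>\<^bsub>KQ\<^esub> (g \<oplus>\<^bsub>KQ\<^esub> h)" by (simp add: KQ_simps K.a_assoc D D')
qed

text \<open>Elements of the path algebra are sums of multiples of paths. Multiplicativity and associativity are
  thereby reduced, one factor at a time, to products of paths.\<close>

lemma KQ_induct [consumes 1, case_names zero add]: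
  assumes f: "f \<in> carrier KQ"
    and zero: "P \<zero>\<^bsub>KQ\<^esub>"
    and add: "\<And>g k p. \<lbrakk>g \<in> carrier KQ; k \<in> carrier K; p \<in> qpaths Q; P g\<rbrakk> \<Longrightarrow> P (g \<oplus>\<^bsub>KQ\<^esub> monomial k p)"
  shows "P f"
proof -
  have "P f" if "finite S" "f \<in> carrier KQ" "{p. f p \<noteq> \<zero>} \<subseteq> S" for S f
    using that
  proof (induction S arbitrary: f)
    case empty
    then have "f = \<zero>\<^bsub>KQ\<^esub>" by (auto simp: KQ_simps)
    then show ?case using zero by simp
  next
    case (insert p S)
    note D = KQ_memD[OF insert.prems(1)]
    show ?case
    proof (cases "p \<in> qpaths Q")
      case True
      define g where "g q = (if q = p then \<zero> else f q)" for q
      have "{q. g q \<noteq> \<zero>} \<subseteq> {q. f q \<noteq> \<zero>}" by (auto simp: g_def)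
      then have g: "g \<in> carrier KQ"
        using D finite_subset[OF _ D(3)] by (intro KQ_memI) (simp_all add: g_def)
      have "{q. g q \<noteq> \<zero>} \<subseteq> S" using insert.prems(2) by (auto simp: g_def)
      then have "P g" by (rule insert.IH[OF g])
      then have "P (g \<oplus>\<^bsub>KQ\<^esub> monomial (f p) p)" using add[OF g D(1) True] by blast
      moreover have "g \<oplus>\<^bsub>KQ\<^esub> monomial (f p) p = f"
        by (rule ext) (simp add: KQ_simps g_def monomial_def D(1))
      ultimately show ?thesis by simp
    next
      case False
      then have "{q. f q \<noteq> \<zero>} \<subseteq> S" using insert.prems(2) D(2)[of p] by auto
      then show ?thesis by (rule insert.IH[OF insert.prems(1)])
    qed
  qed
  from this[OF KQ_memD(3)[OF f] f] show ?thesis by simp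
qed

lemma KQ_l_distr:
  assumes "f \<in> carrier KQ" "f' \<in> carrier KQ" "g \<in> carrier KQ"
  shows "(f \<oplus>\<^bsub>KQ\<^esub> f') \<otimes>\<^bsub>KQ\<^esub> g = f \<otimes>\<^bsub>KQ\<^esub> g \<oplus>\<^bsub>KQ\<^esub> f' \<otimes>\<^bsub>KQ\<^esub> g"
  using assms[THEN KQ_memD(1)] by (simp add: KQ_simps K.l_distr K.finsum_addf Pi_iff)

lemma KQ_r_distr:
  assumes "f \<in> carrier KQ" "f' \<in> carrier KQ" "g \<in> carrier KQ"
  shows "g \<otimes>\<^bsub>KQ\<^esub> (f \<oplus>\<^bsub>KQ\<^esub> f') = g \<otimes>\<^bsub>KQ\<^esub> f \<oplus>\<^bsub>KQ\<^esub> g \<otimes>\<^bsub>KQ\<^esub> f'"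
  using assms[THEN KQ_memD(1)] by (simp add: KQ_simps K.r_distr K.finsum_addf Pi_iff)

lemma KQ_mult_zero:
  assumes "f \<in> carrier KQ"
  shows "\<zero>\<^bsub>KQ\<^esub> \<otimes>\<^bsub>KQ\<^esub> f = \<zero>\<^bsub>KQ\<^esub>" "f \<otimes>\<^bsub>KQ\<^esub> \<zero>\<^bsub>KQ\<^esub> = \<zero>\<^bsub>KQ\<^esub>"
  using assms[THEN KQ_memD(1)] by (simp_all add: KQ_simps)

lemma monomial_mult:
  assumes "k \<in> carrier K" "l \<in> carrier K" "p \<in> qpaths Q" "q \<in> qpaths Q"
  shows "monomial k p \<otimes>\<^bsub>KQ\<^esub> monomial l q
    = (if path_end p = path_start q then monomial (k \<otimes> l) (path_comp p q) else \<zero>\<^bsub>KQ\<^esub>)"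
proof
  fix r
  show "(monomial k p \<otimes>\<^bsub>KQ\<^esub> monomial l q) r
    = (if path_end p = path_start q then monomial (k \<otimes> l) (path_comp p q) else \<zero>\<^bsub>KQ\<^esub>) r"
  proof (cases "(p, q) \<in> factorizations r")
    case True
    have "(monomial k p \<otimes>\<^bsub>KQ\<^esub> monomial l q) r
        = monomial k p (fst (p, q)) \<otimes> monomial l q (snd (p, q))"
      unfolding KQ_simps using assms
      by (intro K.finsum_single[OF finite_factorizations True]) (auto simp: monomial_def)
    moreover have "path_end p = path_start q" "path_comp p q = r"
      using True by (simp_all add: factorizations_def)
    ultimately show ?thesis by (simp add: monomial_def)
  next
    case False
    have "monomial k p (fst z) \<otimes> monomial l q (snd z) = \<zero>" if "z \<in> factorizations r" for z
    proof -
      have "z \<noteq> (p, q)" using that False by blast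
      then have "fst z \<noteq> p \<or> snd z \<noteq> q" by (auto simp: prod_eq_iff)
      then show ?thesis using assms by (auto simp: monomial_def)
    qed
    then have "(monomial k p \<otimes>\<^bsub>KQ\<^esub> monomial l q) r = \<zero>"
      unfolding KQ_simps by (rule K.add.finprod_one_eqI)
    moreover have "\<not> (path_end p = path_start q \<and> path_comp p q = r)"
      using False assms by (simp add: factorizations_def)
    ultimately show ?thesis by (auto simp: monomial_def KQ_simps)
  qed
qed

lemma KQ_mult_assoc:
  assumes f: "f \<in> carrier KQ" and g: "g \<in> carrier KQ" and h: "h \<in> carrier KQ"
  shows "f \<otimes>\<^bsub>KQ\<^esub> g \<otimes>\<^bsub>KQ\<^esub> h = f \<otimes>\<^bsub>KQ\<^esub> (g \<otimes>\<^bsub>KQ\<^esub> h)"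
proof -
  note closed = KQ_mult_closed KQ_add_closed monomial_closed
  have paths: "monomial k p \<otimes>\<^bsub>KQ\<^esub> monomial l q \<otimes>\<^bsub>KQ\<^esub> monomial m r
      = monomial k p \<otimes>\<^bsub>KQ\<^esub> (monomial l q \<otimes>\<^bsub>KQ\<^esub> monomial m r)"
    if "k \<in> carrier K" "l \<in> carrier K" "m \<in> carrier K" "p \<in> qpaths Q" "q \<in> qpaths Q" "r \<in> qpaths Q"
    for k l m p q r
    using that
    by (simp add: monomial_mult path_comp_closed path_comp_assoc K.m_assoc KQ_mult_zero monomial_closed)
  have two: "monomial k p \<otimes>\<^bsub>KQ\<^esub> monomial l q \<otimes>\<^bsub>KQ\<^esub> h = monomial k p \<otimes>\<^bsub>KQ\<^esub> (monomial l q \<otimes>\<^bsub>KQ\<^esub> h)"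
    if "k \<in> carrier K" "l \<in> carrier K" "p \<in> qpaths Q" "q \<in> qpaths Q" for k l p q
    using h
  proof (induction h rule: KQ_induct)
    case zero
    show ?case using that by (simp add: KQ_mult_zero closed)
  next
    case (add h' m r)
    then show ?case using that by (simp add: KQ_r_distr closed paths)
  qed
  have one: "monomial k p \<otimes>\<^bsub>KQ\<^esub> g \<otimes>\<^bsub>KQ\<^esub> h = monomial k p \<otimes>\<^bsub>KQ\<^esub> (g \<otimes>\<^bsub>KQ\<^esub> h)"
    if "k \<in> carrier K" "p \<in> qpaths Q" for k p
    using g
  proof (induction g rule: KQ_induct)
    case zero
    show ?case using that h by (simp add: KQ_mult_zero closed)
  next
    case (add g' m r)
    then show ?case using that h by (simp add: KQ_r_distr KQ_l_distr closed two)
  qed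
  show ?thesis
    using f
  proof (induction f rule: KQ_induct)
    case zero
    show ?case using g h by (simp add: KQ_mult_zero closed)
  next
    case (add f' m r)
    then show ?case using g h by (simp add: KQ_l_distr closed one)
  qed
qed

lemma KQ_one_closed: "\<one>\<^bsub>KQ\<^esub> \<in> carrier KQ"
proof (rule KQ_memI)
  show "\<one>\<^bsub>KQ\<^esub> p \<in> carrier K" "p \<notin> qpaths Q \<Longrightarrow> \<one>\<^bsub>KQ\<^esub> p = \<zero>" for p
    using vertex_path_mem by (auto simp: KQ_simps)
  have "{p. \<one>\<^bsub>KQ\<^esub> p \<noteq> \<zero>} \<subseteq> vertex_path ` verts Q" by (auto simp: KQ_simps)
  then show "finite {p. \<one>\<^bsub>KQ\<^esub> p \<noteq> \<zero>}" by (rule finite_subset) simp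
qed

lemma KQ_one:
  assumes f: "f \<in> carrier KQ"
  shows "\<one>\<^bsub>KQ\<^esub> \<otimes>\<^bsub>KQ\<^esub> f = f" "f \<otimes>\<^bsub>KQ\<^esub> \<one>\<^bsub>KQ\<^esub> = f"
proof -
  note D = KQ_memD[OF f]
  have empty: "factorizations r = {}" if "r \<notin> qpaths Q" for r
    using that path_comp_closed by (auto simp: factorizations_def)
  have "(\<one>\<^bsub>KQ\<^esub> \<otimes>\<^bsub>KQ\<^esub> f) r = f r" for r
  proof (cases "r \<in> qpaths Q")
    case True
    let ?z = "(vertex_path (path_start r), r)"
    have z: "?z \<in> factorizations r"
      using True path_ends_mem vertex_path_mem by (simp add: factorizations_def path_comp_vertex_path)
    define t where "t x = \<one>\<^bsub>KQ\<^esub> (fst x) \<otimes> f (snd x)" for x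
    have "(\<Oplus>x\<in>factorizations r. t x) = t ?z"
    proof (rule K.finsum_single[OF finite_factorizations z])
      fix x assume x: "x \<in> factorizations r" "x \<noteq> ?z"
      have "fst x \<notin> vertex_path ` verts Q"
      proof
        assume "fst x \<in> vertex_path ` verts Q"
        then obtain v where v: "fst x = vertex_path v" by blast
        then have "path_start (snd x) = v" "path_comp (fst x) (snd x) = r"
          using x(1) by (auto simp: factorizations_def)
        then have "snd x = r" "v = path_start r" using v path_comp_vertex_path(1)[of "snd x"] by auto
        then show False using x(2) v by (simp add: prod_eq_iff)
      qed
      then show "t x = \<zero>" by (simp add: t_def KQ_simps D)
    qed (simp add: t_def KQ_simps D)
    then have "(\<one>\<^bsub>KQ\<^esub> \<otimes>\<^bsub>KQ\<^esub> f) r = \<one>\<^bsub>KQ\<^esub> (fst ?z) \<otimes> f (snd ?z)"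
      by (simp add: KQ_simps(4) t_def)
    then show ?thesis using True path_ends_mem(1) by (simp add: KQ_simps D)
  qed (simp add: KQ_simps(4) empty D)
  then show "\<one>\<^bsub>KQ\<^esub> \<otimes>\<^bsub>KQ\<^esub> f = f" by (intro ext)
  have "(f \<otimes>\<^bsub>KQ\<^esub> \<one>\<^bsub>KQ\<^esub>) r = f r" for r
  proof (cases "r \<in> qpaths Q")
    case True
    let ?z = "(r, vertex_path (path_end r))"
    have z: "?z \<in> factorizations r"
      using True path_ends_mem vertex_path_mem by (simp add: factorizations_def path_comp_vertex_path)
    define t where "t x = f (fst x) \<otimes> \<one>\<^bsub>KQ\<^esub> (snd x)" for x
    have "(\<Oplus>x\<in>factorizations r. t x) = t ?z"
    proof (rule K.finsum_single[OF finite_factorizations z])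
      fix x assume x: "x \<in> factorizations r" "x \<noteq> ?z"
      have "snd x \<notin> vertex_path ` verts Q"
      proof
        assume "snd x \<in> vertex_path ` verts Q"
        then obtain v where v: "snd x = vertex_path v" by blast
        then have "path_end (fst x) = v" "path_comp (fst x) (snd x) = r"
          using x(1) by (auto simp: factorizations_def)
        then have "fst x = r" "v = path_end r" using v path_comp_vertex_path(2)[of "fst x"] by auto
        then show False using x(2) v by (simp add: prod_eq_iff)
      qed
      then show "t x = \<zero>" by (simp add: t_def KQ_simps D)
    qed (simp add: t_def KQ_simps D)
    then have "(f \<otimes>\<^bsub>KQ\<^esub> \<one>\<^bsub>KQ\<^esub>) r = f (fst ?z) \<otimes> \<one>\<^bsub>KQ\<^esub> (snd ?z)"
      by (simp add: KQ_simps(4) t_def)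
    then show ?thesis using True path_ends_mem(2) by (simp add: KQ_simps D)
  qed (simp add: KQ_simps(4) empty D)
  then show "f \<otimes>\<^bsub>KQ\<^esub> \<one>\<^bsub>KQ\<^esub> = f" by (intro ext)
qed

lemma ring_KQ: "ring KQ"
  by (intro ringI abelian_group_KQ monoidI)
    (simp_all add: KQ_mult_closed KQ_one_closed KQ_mult_assoc KQ_one KQ_l_distr KQ_r_distr)

end

section \<open>Summing coefficients over parallel paths\<close>

context finite_quiver
begin

lemma joined_by_path_refl: "v \<in> verts Q \<Longrightarrow> joined_by_path Q v v"
  unfolding joined_by_path_def using vertex_path_mem by (intro bexI[of _ "vertex_path v"]) simp_all

lemma joined_by_path_trans:
  assumes "joined_by_path Q u v" "joined_by_path Q v w"
  shows "joined_by_path Q u w"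
proof -
  obtain p q where "p \<in> qpaths Q" "path_start p = u" "path_end p = v"
    "q \<in> qpaths Q" "path_start q = v" "path_end q = w"
    using assms unfolding joined_by_path_def by blast
  then show ?thesis
    unfolding joined_by_path_def
    by (intro bexI[of _ "path_comp p q"]) (simp_all add: path_comp_closed)
qed

sublocale inc: incidence K "verts Q" "joined_by_path Q"
  by unfold_locales (auto intro: joined_by_path_refl joined_by_path_trans)

text \<open>The matrix of sums of coefficients over parallel paths; its kernel turns out to be the commuting
  ideal.\<close>

definition path_sums :: "(('v, 'a) qpath \<Rightarrow> 'k) \<Rightarrow> 'v \<Rightarrow> 'v \<Rightarrow> 'k" where
  "path_sums f v w = (\<Oplus>p\<in>{p. f p \<noteq> \<zero> \<and> path_start p = v \<and> path_end p = w}. f p)"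

text \<open>Any finite set containing the support may serve as index set, which makes sums for different
  elements comparable.\<close>

lemma path_sums_eq:
  assumes f: "f \<in> carrier KQ" and T: "finite T" "{p. f p \<noteq> \<zero>} \<subseteq> T"
  shows "path_sums f v w = (\<Oplus>p\<in>T. if path_start p = v \<and> path_end p = w then f p else \<zero>)"
  unfolding path_sums_def
proof (rule K.add.finprod_mono_neutral_cong_left[OF T(1)])
  show "{p. f p \<noteq> \<zero> \<and> path_start p = v \<and> path_end p = w} \<subseteq> T" using T(2) by blast
  show "(\<lambda>p. if path_start p = v \<and> path_end p = w then f p else \<zero>) \<in> T \<rightarrow> carrier K"
    by (simp add: KQ_memD(1)[OF f])
qed auto

lemma path_sums_monomial:
  assumes "k \<in> carrier K" "p \<in> qpaths Q"
  shows "path_sums (monomial k p) v w = (if path_start p = v \<and> path_end p = w then k else \<zero>)"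
proof -
  have "path_sums (monomial k p) v w
      = (\<Oplus>q\<in>{p}. if path_start q = v \<and> path_end q = w then monomial k p q else \<zero>)"
    using assms by (intro path_sums_eq monomial_closed) (auto simp: monomial_def)
  then show ?thesis using assms by (simp add: monomial_def)
qed

lemma path_sums_add:
  assumes f: "f \<in> carrier KQ" and g: "g \<in> carrier KQ"
  shows "path_sums (f \<oplus>\<^bsub>KQ\<^esub> g) v w = path_sums f v w \<oplus> path_sums g v w"
proof -
  let ?T = "{p. f p \<noteq> \<zero>} \<union> {p. g p \<noteq> \<zero>}"
  let ?on = "\<lambda>h p. if path_start p = v \<and> path_end p = w then h p else \<zero>"
  have fin: "finite ?T" using KQ_memD(3)[OF f] KQ_memD(3)[OF g] by simp
  have "{p. (f \<oplus>\<^bsub>KQ\<^esub> g) p \<noteq> \<zero>} \<subseteq> ?T" by (auto simp: KQ_simps(3))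
  then have "path_sums (f \<oplus>\<^bsub>KQ\<^esub> g) v w = (\<Oplus>p\<in>?T. ?on (f \<oplus>\<^bsub>KQ\<^esub> g) p)"
    by (rule path_sums_eq[OF KQ_add_closed[OF f g] fin])
  also have "\<dots> = (\<Oplus>p\<in>?T. ?on f p \<oplus> ?on g p)"
    by (rule K.finsum_cong') (simp_all add: KQ_simps(3) KQ_memD(1)[OF f] KQ_memD(1)[OF g])
  also have "\<dots> = (\<Oplus>p\<in>?T. ?on f p) \<oplus> (\<Oplus>p\<in>?T. ?on g p)"
    by (rule K.finsum_addf) (simp_all add: KQ_memD(1)[OF f] KQ_memD(1)[OF g])
  also have "\<dots> = path_sums f v w \<oplus> path_sums g v w"
    using path_sums_eq[OF f fin] path_sums_eq[OF g fin] by simp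
  finally show ?thesis .
qed

lemma path_sums_zero: "path_sums \<zero>\<^bsub>KQ\<^esub> = \<zero>\<^bsub>inc.I\<^esub>"
  by (intro ext) (simp add: path_sums_def KQ_simps(1) inc.I_simps(1))

lemma path_sums_add':
  assumes "f \<in> carrier KQ" "g \<in> carrier KQ"
  shows "path_sums (f \<oplus>\<^bsub>KQ\<^esub> g) = path_sums f \<oplus>\<^bsub>inc.I\<^esub> path_sums g"
  by (intro ext) (simp add: path_sums_add[OF assms] inc.I_simps(3))

lemma path_sums_closed:
  assumes f: "f \<in> carrier KQ"
  shows "path_sums f \<in> carrier inc.I"
proof (rule inc.I_memI)
  show "path_sums f v w \<in> carrier K" for v w
    unfolding path_sums_def by (rule K.finsum_closed) (simp add: KQ_memD(1)[OF f])
  fix v w assume no: "\<not> (v \<in> verts Q \<and> w \<in> verts Q \<and> joined_by_path Q v w)"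
  have "{p. f p \<noteq> \<zero> \<and> path_start p = v \<and> path_end p = w} = {}"
  proof (rule equals0I)
    fix p assume p: "p \<in> {p. f p \<noteq> \<zero> \<and> path_start p = v \<and> path_end p = w}"
    then have "p \<in> qpaths Q" using KQ_memD(2)[OF f, of p] by auto
    then show False using no p path_ends_mem[of p] unfolding joined_by_path_def by blast
  qed
  then show "path_sums f v w = \<zero>" unfolding path_sums_def by (simp only: K.finsum_empty)
qed

lemma path_sums_mult:
  assumes f: "f \<in> carrier KQ" and g: "g \<in> carrier KQ"
  shows "path_sums (f \<otimes>\<^bsub>KQ\<^esub> g) = path_sums f \<otimes>\<^bsub>inc.I\<^esub> path_sums g"
proof -
  interpret KQ: ring KQ by (rule ring_KQ)
  interpret I: ring inc.I by (rule inc.ring_I)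
  have paths: "path_sums (monomial k p \<otimes>\<^bsub>KQ\<^esub> monomial l q)
      = path_sums (monomial k p) \<otimes>\<^bsub>inc.I\<^esub> path_sums (monomial l q)"
    if kl: "k \<in> carrier K" "l \<in> carrier K" and pq: "p \<in> qpaths Q" "q \<in> qpaths Q" for k l p q
  proof (intro ext)
    fix v w
    have cl: "path_sums (monomial k p) v x \<otimes> path_sums (monomial l q) x w \<in> carrier K" for x
      using kl pq by (simp add: path_sums_monomial)
    have "(path_sums (monomial k p) \<otimes>\<^bsub>inc.I\<^esub> path_sums (monomial l q)) v w
        = path_sums (monomial k p) v (path_end p) \<otimes> path_sums (monomial l q) (path_end p) w"
      unfolding inc.I_simps(4) using kl pq path_ends_mem[OF pq(1)] cl
      by (intro K.finsum_single[where i = "path_end p"]) (simp_all, simp add: path_sums_monomial)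
    also have "\<dots> = path_sums (monomial k p \<otimes>\<^bsub>KQ\<^esub> monomial l q) v w"
      using kl pq
      by (simp add: monomial_mult path_sums_monomial path_comp_closed path_sums_zero inc.I_simps(1))
    finally show "path_sums (monomial k p \<otimes>\<^bsub>KQ\<^esub> monomial l q) v w
      = (path_sums (monomial k p) \<otimes>\<^bsub>inc.I\<^esub> path_sums (monomial l q)) v w" ..
  qed
  note closed = path_sums_closed monomial_closed
  have one: "path_sums (monomial k p \<otimes>\<^bsub>KQ\<^esub> g) = path_sums (monomial k p) \<otimes>\<^bsub>inc.I\<^esub> path_sums g"
    if "k \<in> carrier K" "p \<in> qpaths Q" for k p
    using g
  proof (induction g rule: KQ_induct)
    case zero
    show ?case using that by (simp add: path_sums_zero closed)
  next
    case (add g' l q)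
    then show ?case
      using that by (simp add: path_sums_add' KQ.r_distr I.r_distr closed paths)
  qed
  show ?thesis
    using f
  proof (induction f rule: KQ_induct)
    case zero
    show ?case using g by (simp add: path_sums_zero closed)
  next
    case (add f' l q)
    then show ?case
      using g by (simp add: path_sums_add' KQ.l_distr I.l_distr closed one)
  qed
qed

lemma path_sums_one: "path_sums \<one>\<^bsub>KQ\<^esub> = \<one>\<^bsub>inc.I\<^esub>"
proof (intro ext)
  fix v w
  let ?p = "vertex_path v :: ('v, 'a) qpath"
  have "path_sums \<one>\<^bsub>KQ\<^esub> v w = (\<Oplus>p\<in>vertex_path ` verts Q.
      if path_start p = v \<and> path_end p = w then \<one>\<^bsub>KQ\<^esub> p else \<zero>)"
    by (rule path_sums_eq[OF KQ_one_closed]) (auto simp: KQ_simps(2))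
  also have "\<dots> = \<one>\<^bsub>inc.I\<^esub> v w"
  proof (cases "v = w \<and> v \<in> verts Q")
    case True
    then have "(\<Oplus>p\<in>vertex_path ` verts Q. if path_start p = v \<and> path_end p = w then \<one>\<^bsub>KQ\<^esub> p else \<zero>)
        = (if path_start ?p = v \<and> path_end ?p = w then \<one>\<^bsub>KQ\<^esub> ?p else \<zero>)"
      by (intro K.finsum_single) (auto simp: KQ_simps(2))
    then show ?thesis using True by (auto simp: KQ_simps(2) inc.I_simps(2))
  next
    case False
    then have "(\<Oplus>p\<in>vertex_path ` verts Q. if path_start p = v \<and> path_end p = w then \<one>\<^bsub>KQ\<^esub> p else \<zero>) = \<zero>"
      by (intro K.add.finprod_one_eqI) auto
    then show ?thesis using False by (auto simp: inc.I_simps(2))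
  qed
  finally show "path_sums \<one>\<^bsub>KQ\<^esub> v w = \<one>\<^bsub>inc.I\<^esub> v w" .
qed

text \<open>A matrix is hit by placing each of its entries on one chosen path between the two vertices.\<close>

lemma path_sums_surj:
  assumes m: "m \<in> carrier inc.I"
  shows "\<exists>f \<in> carrier KQ. path_sums f = m"
proof -
  define c where "c v w = (SOME p. p \<in> qpaths Q \<and> path_start p = v \<and> path_end p = w)" for v w
  have c: "c v w \<in> qpaths Q" "path_start (c v w) = v" "path_end (c v w) = w" if "joined_by_path Q v w" for v w
    using someI_ex[of "\<lambda>p. p \<in> qpaths Q \<and> path_start p = v \<and> path_end p = w"] that
    unfolding joined_by_path_def c_def by blast+
  define f where "f p = (if p = c (path_start p) (path_end p) then m (path_start p) (path_end p) else \<zero>)" for p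
  have support: "p \<in> qpaths Q \<and> p = c (path_start p) (path_end p)" if "f p \<noteq> \<zero>" for p
  proof -
    have p: "p = c (path_start p) (path_end p)" "m (path_start p) (path_end p) \<noteq> \<zero>"
      using that unfolding f_def by (metis, metis)
    then have "joined_by_path Q (path_start p) (path_end p)" using inc.entry_zero[OF m] by blast
    then show ?thesis using c(1) p(1) by metis
  qed
  have "f \<in> carrier KQ"
  proof (rule KQ_memI)
    show "f p \<in> carrier K" for p using inc.entry_closed[OF m] by (simp add: f_def)
    show "f p = \<zero>" if "p \<notin> qpaths Q" for p using support that by blast
    have "{p. f p \<noteq> \<zero>} \<subseteq> (\<lambda>(v, w). c v w) ` (verts Q \<times> verts Q)"
    proof
      fix p assume "p \<in> {p. f p \<noteq> \<zero>}"
      then have "p \<in> qpaths Q" "p = (\<lambda>(v, w). c v w) (path_start p, path_end p)" using support by auto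
      then show "p \<in> (\<lambda>(v, w). c v w) ` (verts Q \<times> verts Q)" using path_ends_mem[of p] by blast
    qed
    then show "finite {p. f p \<noteq> \<zero>}" by (rule finite_subset) simp
  qed
  moreover have "path_sums f v w = m v w" for v w
  proof (cases "m v w = \<zero>")
    case True
    then have "{p. f p \<noteq> \<zero> \<and> path_start p = v \<and> path_end p = w} = {}" by (auto simp: f_def)
    then show ?thesis unfolding path_sums_def True by (simp only: K.finsum_empty)
  next
    case False
    then have "joined_by_path Q v w" using inc.entry_zero[OF m] by blast
    note cvw = c[OF this]
    have fc: "f (c v w) = m v w" by (simp add: f_def cvw)
    have "{p. f p \<noteq> \<zero> \<and> path_start p = v \<and> path_end p = w} = {c v w}"
      using support cvw fc False by (auto simp del: split_paired_All)
    then show ?thesis using inc.entry_closed[OF m] by (simp add: path_sums_def fc)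
  qed
  ultimately show ?thesis by (intro bexI[of _ f] ext) simp_all
qed

lemma ring_hom_path_sums: "ring_hom_ring KQ inc.I path_sums"
  by (intro ring_hom_ringI ring_KQ inc.ring_I)
    (simp_all add: path_sums_closed path_sums_mult path_sums_add' path_sums_one)

end

section \<open>The commuting algebra is an incidence algebra\<close>

context finite_quiver
begin

abbreviation "C \<equiv> commuting_ideal K Q"
abbreviation "A \<equiv> commuting_algebra K Q"

lemma path_elem_eq: "path_elem K p = monomial \<one> p"
  by (simp add: path_elem_def monomial_def)

lemma monomial_neg: "k \<in> carrier K \<Longrightarrow> p \<in> qpaths Q \<Longrightarrow> \<ominus>\<^bsub>KQ\<^esub> monomial k p = monomial (\<ominus> k) p"
proof -
  assume kp: "k \<in> carrier K" "p \<in> qpaths Q"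
  interpret KQ: ring KQ by (rule ring_KQ)
  have "monomial (\<ominus> k) p \<oplus>\<^bsub>KQ\<^esub> monomial k p = \<zero>\<^bsub>KQ\<^esub>"
    using kp by (auto simp: KQ_simps monomial_def K.l_neg)
  then show ?thesis using kp by (intro KQ.minus_equality) (simp_all add: monomial_closed)
qed

lemma path_sums_minus:
  assumes x: "x \<in> carrier KQ" and y: "y \<in> carrier KQ"
  shows "path_sums (x \<ominus>\<^bsub>KQ\<^esub> y) = path_sums x \<ominus>\<^bsub>inc.I\<^esub> path_sums y"
proof -
  interpret KQ: ring KQ by (rule ring_KQ)
  interpret I: ring inc.I by (rule inc.ring_I)
  have "x = (x \<ominus>\<^bsub>KQ\<^esub> y) \<oplus>\<^bsub>KQ\<^esub> y"
    using x y by (simp add: a_minus_def KQ.a_assoc KQ.l_neg)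
  then have "path_sums x = path_sums (x \<ominus>\<^bsub>KQ\<^esub> y) \<oplus>\<^bsub>inc.I\<^esub> path_sums y"
    using path_sums_add'[of "x \<ominus>\<^bsub>KQ\<^esub> y" y] x y by simp
  then show ?thesis
    using path_sums_closed[of "x \<ominus>\<^bsub>KQ\<^esub> y"] path_sums_closed[OF y] x y
    by (simp add: a_minus_def I.a_assoc I.r_neg)
qed

lemma path_sums_smult:
  assumes k: "k \<in> carrier K" and x: "x \<in> carrier KQ"
  shows "k \<odot>\<^bsub>KQ\<^esub> x \<in> carrier KQ" "path_sums (k \<odot>\<^bsub>KQ\<^esub> x) = k \<odot>\<^bsub>inc.I\<^esub> path_sums x"
proof -
  note D = KQ_memD[OF x]
  have sub: "{p. (k \<odot>\<^bsub>KQ\<^esub> x) p \<noteq> \<zero>} \<subseteq> {p. x p \<noteq> \<zero>}" using k by (auto simp: KQ_simps(5))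
  show closed: "k \<odot>\<^bsub>KQ\<^esub> x \<in> carrier KQ"
  proof (rule KQ_memI)
    show "(k \<odot>\<^bsub>KQ\<^esub> x) p \<in> carrier K" for p using k D(1) by (simp add: KQ_simps(5))
    show "(k \<odot>\<^bsub>KQ\<^esub> x) p = \<zero>" if "p \<notin> qpaths Q" for p
      using k D(2)[OF that] by (simp add: KQ_simps(5))
    show "finite {p. (k \<odot>\<^bsub>KQ\<^esub> x) p \<noteq> \<zero>}" by (rule finite_subset[OF sub D(3)])
  qed
  have "path_sums (k \<odot>\<^bsub>KQ\<^esub> x) v w = k \<otimes> path_sums x v w" for v w
  proof -
    let ?on = "\<lambda>p. if path_start p = v \<and> path_end p = w then x p else \<zero>"
    have "path_sums (k \<odot>\<^bsub>KQ\<^esub> x) v w = (\<Oplus>p\<in>{p. x p \<noteq> \<zero>}. k \<otimes> ?on p)"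
      unfolding path_sums_eq[OF closed D(3) sub]
      by (rule K.finsum_cong') (simp_all add: k D(1) KQ_simps(5))
    also have "\<dots> = k \<otimes> (\<Oplus>p\<in>{p. x p \<noteq> \<zero>}. ?on p)"
      by (rule K.finsum_rdistr[OF D(3) k, symmetric]) (simp add: D(1))
    finally show ?thesis using path_sums_eq[OF x D(3) subset_refl] by simp
  qed
  then show "path_sums (k \<odot>\<^bsub>KQ\<^esub> x) = k \<odot>\<^bsub>inc.I\<^esub> path_sums x"
    by (intro ext) (simp add: inc.I_simps(5))
qed

text \<open>Clearly \<open>C\<close> lies in the kernel. Conversely let \<open>f\<close> be in the kernel and \<open>p\<close> in its support. The
  coefficients of the paths parallel to \<open>p\<close> add up to zero, so some \<open>q \<noteq> p\<close> among them is in the support as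
  well, and subtracting \<open>f p \<sqdot> (p - q) \<in> C\<close> removes \<open>p\<close> from the support without enlarging it.\<close>

lemma commuting_ideal_eq_kernel: "C = a_kernel KQ inc.I path_sums"
proof
  interpret KQ: ring KQ by (rule ring_KQ)
  interpret h: ring_hom_ring KQ inc.I path_sums by (rule ring_hom_path_sums)
  interpret I: ring inc.I by (rule inc.ring_I)
  let ?G = "{path_elem K p \<ominus>\<^bsub>KQ\<^esub> path_elem K q | p q.
    p \<in> qpaths Q \<and> q \<in> qpaths Q \<and> path_start p = path_start q \<and> path_end p = path_end q}"
  have ker: "x \<in> a_kernel KQ inc.I path_sums \<longleftrightarrow> x \<in> carrier KQ \<and> path_sums x = \<zero>\<^bsub>inc.I\<^esub>" for x
    unfolding a_kernel_def' by (rule mem_Collect_eq)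
  have G_ker: "?G \<subseteq> a_kernel KQ inc.I path_sums"
  proof
    fix x assume "x \<in> ?G"
    then obtain p q where x: "x = path_elem K p \<ominus>\<^bsub>KQ\<^esub> path_elem K q"
      and pq: "p \<in> qpaths Q" "q \<in> qpaths Q" "path_start p = path_start q" "path_end p = path_end q"
      by blast
    have cl: "monomial \<one> p \<in> carrier KQ" "monomial \<one> q \<in> carrier KQ" using pq by (simp_all add: monomial_closed)
    have "path_sums (monomial \<one> p) = path_sums (monomial \<one> q)"
      by (intro ext) (simp add: path_sums_monomial pq)
    then have "path_sums (monomial \<one> p) \<ominus>\<^bsub>inc.I\<^esub> path_sums (monomial \<one> q) = \<zero>\<^bsub>inc.I\<^esub>"
      using path_sums_closed[OF cl(2)] by simp
    then show "x \<in> a_kernel KQ inc.I path_sums"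
      unfolding ker x path_elem_eq using cl by (simp add: path_sums_minus)
  qed
  then have G_carrier: "?G \<subseteq> carrier KQ" using ker by blast
  show "C \<subseteq> a_kernel KQ inc.I path_sums"
    unfolding commuting_ideal_def by (rule KQ.genideal_minimal[OF h.kernel_is_ideal G_ker])
  interpret C: ideal C KQ
    unfolding commuting_ideal_def by (rule KQ.genideal_ideal[OF G_carrier])
  have diff: "monomial k p \<oplus>\<^bsub>KQ\<^esub> monomial (\<ominus> k) q \<in> C"
    if k: "k \<in> carrier K" and pq: "p \<in> qpaths Q" "q \<in> qpaths Q" "path_start p = path_start q" "path_end p = path_end q"
    for k p q
  proof -
    \<comment> \<open>The ideal is a subspace: a scalar multiple of a difference of paths is its product with the
      scalar multiple of the start vertex.\<close>
    let ?v = "vertex_path (path_start p) :: ('v, 'a) qpath"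
    have v: "?v \<in> qpaths Q" using pq path_ends_mem vertex_path_mem by blast
    have "path_elem K p \<ominus>\<^bsub>KQ\<^esub> path_elem K q \<in> C"
      unfolding commuting_ideal_def using pq by (intro subsetD[OF KQ.genideal_self[OF G_carrier]]) blast
    then have "monomial k ?v \<otimes>\<^bsub>KQ\<^esub> (monomial \<one> p \<ominus>\<^bsub>KQ\<^esub> monomial \<one> q) \<in> C"
      unfolding path_elem_eq by (rule C.I_l_closed) (rule monomial_closed[OF k v])
    also have "monomial k ?v \<otimes>\<^bsub>KQ\<^esub> (monomial \<one> p \<ominus>\<^bsub>KQ\<^esub> monomial \<one> q)
        = monomial k ?v \<otimes>\<^bsub>KQ\<^esub> monomial \<one> p \<oplus>\<^bsub>KQ\<^esub> monomial k ?v \<otimes>\<^bsub>KQ\<^esub> monomial (\<ominus> \<one>) q"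
      using k v pq by (simp add: a_minus_def monomial_neg KQ.r_distr monomial_closed)
    also have "\<dots> = monomial k p \<oplus>\<^bsub>KQ\<^esub> monomial (\<ominus> k) q"
      using k v pq path_comp_vertex_path(1)[of p] path_comp_vertex_path(1)[of q]
      by (simp add: monomial_mult K.r_minus)
    finally show ?thesis .
  qed
  have "f \<in> C" if "finite S" "f \<in> carrier KQ" "path_sums f = \<zero>\<^bsub>inc.I\<^esub>" "{p. f p \<noteq> \<zero>} \<subseteq> S" for S f
    using that
  proof (induction S arbitrary: f)
    case empty
    then have "f = \<zero>\<^bsub>KQ\<^esub>" by (auto simp: KQ_simps)
    then show ?case by simp
  next
    case (insert p S)
    note D = KQ_memD[OF insert.prems(1)]
    show ?case
    proof (cases "f p = \<zero>")
      case True
      then have "{q. f q \<noteq> \<zero>} \<subseteq> S" using insert.prems(3) by auto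
      then show ?thesis by (rule insert.IH[OF insert.prems(1,2)])
    next
      case False
      then have p: "p \<in> qpaths Q" using D(2) by blast
      have "\<exists>q. q \<noteq> p \<and> f q \<noteq> \<zero> \<and> path_start q = path_start p \<and> path_end q = path_end p"
      proof (rule ccontr)
        assume no: "\<not> ?thesis"
        have "{q. f q \<noteq> \<zero> \<and> path_start q = path_start p \<and> path_end q = path_end p} = {p}"
        proof (intro equalityI subsetI)
          fix q assume "q \<in> {q. f q \<noteq> \<zero> \<and> path_start q = path_start p \<and> path_end q = path_end p}"
          then show "q \<in> {p}" using no by blast
        qed (use False in simp)
        then have "path_sums f (path_start p) (path_end p) = (\<Oplus>q\<in>{p}. f q)"
          unfolding path_sums_def by simp
        then have "path_sums f (path_start p) (path_end p) = f p" using D(1)[of p] by simp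
        then show False using False insert.prems(2) by (simp add: inc.I_simps(1))
      qed
      then obtain q where q: "q \<noteq> p" "f q \<noteq> \<zero>" "path_start q = path_start p" "path_end q = path_end p" by blast
      have q_mem: "q \<in> qpaths Q" using D(2) q(2) by blast
      define d where "d = monomial (f p) p \<oplus>\<^bsub>KQ\<^esub> monomial (\<ominus> f p) q"
      have d: "d \<in> C" unfolding d_def using p q q_mem D(1) by (intro diff) simp_all
      have d_carrier: "d \<in> carrier KQ" by (rule C.a_Hcarr[OF d])
      have d_ker: "path_sums d = \<zero>\<^bsub>inc.I\<^esub>"
        using d \<open>C \<subseteq> a_kernel KQ inc.I path_sums\<close> ker by blast
      define g where "g = f \<ominus>\<^bsub>KQ\<^esub> d"
      have g: "g \<in> carrier KQ" using insert.prems(1) d_carrier by (simp add: g_def)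
      have g_ker: "path_sums g = \<zero>\<^bsub>inc.I\<^esub>"
        using insert.prems(1,2) d_carrier d_ker by (simp add: g_def path_sums_minus)
      have f_eq: "f = g \<oplus>\<^bsub>KQ\<^esub> d"
        using insert.prems(1) d_carrier
        by (simp add: g_def a_minus_def KQ.a_assoc KQ.l_neg)
      have "{r. g r \<noteq> \<zero>} \<subseteq> S"
      proof
        fix r assume r: "r \<in> {r. g r \<noteq> \<zero>}"
        note G = KQ_memD(1)[OF g]
        have f_r: "f r = g r \<oplus> d r" using fun_cong[OF f_eq, of r] by (simp add: KQ_simps(3))
        show "r \<in> S"
        proof (cases "r = p \<or> r = q")
          case True
          have "g p = \<zero>"
          proof -
            have "f p = g p \<oplus> f p" using fun_cong[OF f_eq, of p] q(1) D(1)
              by (simp add: KQ_simps(3) d_def monomial_def)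
            then show ?thesis using G D(1) by (metis K.add.r_cancel_one')
          qed
          then have "r = q" using True r by auto
          then show ?thesis using insert.prems(3) q by auto
        next
          case False
          then have "d r = \<zero>" by (simp add: d_def KQ_simps(3) monomial_def)
          then have "f r = g r" using f_r G by simp
          then have "r \<in> {p. f p \<noteq> \<zero>}" using r by simp
          then have "r \<in> insert p S" using insert.prems(3) by (rule rev_subsetD)
          then show ?thesis using False by blast
        qed
      qed
      then have "g \<in> C" by (rule insert.IH[OF g g_ker])
      then show ?thesis unfolding f_eq using d by (rule C.a_closed)
    qed
  qed
  then have "f \<in> C" if "f \<in> carrier KQ" "path_sums f = \<zero>\<^bsub>inc.I\<^esub>" for f
    using KQ_memD(3)[OF that(1)] that by blast
  then show "a_kernel KQ inc.I path_sums \<subseteq> C" using ker by blast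
qed

text \<open>The isomorphism induced by \<open>path_sums\<close>, which is constant on every coset.\<close>

definition \<theta> :: "(('v, 'a) qpath \<Rightarrow> 'k) set \<Rightarrow> 'v \<Rightarrow> 'v \<Rightarrow> 'k" where
  "\<theta> X = the_elem (path_sums ` X)"

lemma A_simps:
  "carrier A = carrier (KQ Quot C)" "mult A = mult (KQ Quot C)" "add A = add (KQ Quot C)"
  "\<one>\<^bsub>A\<^esub> = \<one>\<^bsub>KQ Quot C\<^esub>" "\<zero>\<^bsub>A\<^esub> = \<zero>\<^bsub>KQ Quot C\<^esub>"
  "k \<odot>\<^bsub>A\<^esub> X = (\<Union>x\<in>X. commuting_proj K Q (k \<odot>\<^bsub>KQ\<^esub> x))"
  by (simp_all add: commuting_algebra_def ring.defs module.defs)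

lemma \<theta>_commuting_proj: "x \<in> carrier KQ \<Longrightarrow> \<theta> (commuting_proj K Q x) = path_sums x"
  unfolding \<theta>_def commuting_proj_def commuting_ideal_eq_kernel
  by (rule ring_hom_ring.the_elem_simp[OF ring_hom_path_sums])

lemma commuting_proj_closed: "x \<in> carrier KQ \<Longrightarrow> commuting_proj K Q x \<in> carrier A"
  unfolding A_simps FactRing_def A_RCOSETS_def' commuting_proj_def by auto

lemma \<theta>_iso: "\<theta> \<in> ring_iso A inc.I"
proof -
  interpret h: ring_hom_ring KQ inc.I path_sums by (rule ring_hom_path_sums)
  have "path_sums ` carrier KQ = carrier inc.I"
  proof (intro equalityI subsetI)
    fix m assume "m \<in> carrier inc.I"
    then show "m \<in> path_sums ` carrier KQ" using path_sums_surj by blast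
  qed (use path_sums_closed in blast)
  from h.FactRing_iso_set[OF this] have "(\<lambda>X. the_elem (path_sums ` X)) \<in> ring_iso (KQ Quot C) inc.I"
    by (simp add: commuting_ideal_eq_kernel)
  moreover have "(\<lambda>X. the_elem (path_sums ` X)) = \<theta>" by (simp add: \<theta>_def fun_eq_iff)
  ultimately have "\<theta> \<in> ring_iso (KQ Quot C) inc.I" by simp
  then show ?thesis
    unfolding ring_iso_def ring_hom_def by (simp add: A_simps)
qed

lemma ring_A: "ring A"
proof -
  interpret h: ring_hom_ring KQ inc.I path_sums by (rule ring_hom_path_sums)
  interpret Quot: ring "KQ Quot C"
    unfolding commuting_ideal_eq_kernel by (intro ideal.quotient_is_ring h.kernel_is_ideal)
  have "abelian_group A"
  proof (rule abelian_groupI)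
    show "\<exists>y\<in>carrier A. y \<oplus>\<^bsub>A\<^esub> x = \<zero>\<^bsub>A\<^esub>" if "x \<in> carrier A" for x
      using that unfolding A_simps by (intro bexI[of _ "\<ominus>\<^bsub>KQ Quot C\<^esub> x"] Quot.l_neg Quot.a_inv_closed)
  qed (unfold A_simps, simp_all add: Quot.a_ac)
  moreover have "monoid A"
    by (rule monoidI; unfold A_simps) (simp_all add: Quot.m_assoc)
  ultimately show ?thesis
    by (rule ringI; unfold A_simps) (simp_all add: Quot.l_distr Quot.r_distr)
qed

lemma commuting_proj_eqI:
  assumes "x \<in> carrier KQ" "y \<in> carrier KQ" "path_sums x = path_sums y"
  shows "commuting_proj K Q x = commuting_proj K Q y"
proof -
  have "inj_on \<theta> (carrier A)" using ring_iso_memE(5)[OF \<theta>_iso] by (rule bij_betw_imp_inj_on)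
  moreover have "\<theta> (commuting_proj K Q x) = \<theta> (commuting_proj K Q y)"
    unfolding \<theta>_commuting_proj[OF assms(1)] \<theta>_commuting_proj[OF assms(2)] by (rule assms(3))
  ultimately show ?thesis
    by (rule inj_onD) (intro commuting_proj_closed assms)+
qed

text \<open>All members of a coset have the same path sums, so the union that defines the scalar multiplication
  consists of a single coset.\<close>

lemma A_smult:
  assumes k: "k \<in> carrier K" and x: "x \<in> carrier KQ"
  shows "k \<odot>\<^bsub>A\<^esub> commuting_proj K Q x = commuting_proj K Q (k \<odot>\<^bsub>KQ\<^esub> x)"
proof -
  interpret KQ: ring KQ by (rule ring_KQ)
  interpret h: ring_hom_ring KQ inc.I path_sums by (rule ring_hom_path_sums)
  interpret C: ideal C KQ unfolding commuting_ideal_eq_kernel by (rule h.kernel_is_ideal)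
  have "commuting_proj K Q (k \<odot>\<^bsub>KQ\<^esub> y) = commuting_proj K Q (k \<odot>\<^bsub>KQ\<^esub> x)"
    if y_mem: "y \<in> commuting_proj K Q x" for y
  proof -
    obtain c where c: "c \<in> C" "y = c \<oplus>\<^bsub>KQ\<^esub> x"
      using y_mem unfolding commuting_proj_def a_r_coset_def' by blast
    have c_ker: "c \<in> carrier KQ" "path_sums c = \<zero>\<^bsub>inc.I\<^esub>"
      using c(1) unfolding commuting_ideal_eq_kernel a_kernel_def' by simp_all
    have y: "y \<in> carrier KQ" using c_ker(1) x unfolding c(2) by (rule KQ.a_closed)
    have "path_sums y = path_sums x"
      unfolding c(2) path_sums_add'[OF c_ker(1) x] c_ker(2) by (rule h.S.l_zero[OF path_sums_closed[OF x]])
    then show ?thesis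
      by (intro commuting_proj_eqI) (simp_all add: path_sums_smult k x y)
  qed
  then have "k \<odot>\<^bsub>A\<^esub> commuting_proj K Q x
      = (\<Union>y\<in>commuting_proj K Q x. commuting_proj K Q (k \<odot>\<^bsub>KQ\<^esub> x))"
    unfolding A_simps by (rule SUP_cong[OF refl])
  moreover have "x \<in> commuting_proj K Q x"
    unfolding commuting_proj_def by (rule C.a_rcos_self[OF x])
  then have "commuting_proj K Q x \<noteq> {}" by blast
  ultimately show ?thesis by simp
qed

definition \<psi> :: "('v \<Rightarrow> 'v \<Rightarrow> 'k) \<Rightarrow> (('v, 'a) qpath \<Rightarrow> 'k) set" where
  "\<psi> = inv_into (carrier A) \<theta>"

lemma \<psi>_iso: "\<psi> \<in> ring_iso inc.I A"
  unfolding \<psi>_def by (rule ring_iso_set_sym[OF ring_A \<theta>_iso])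

lemma \<psi>_path_sums:
  assumes "x \<in> carrier KQ"
  shows "\<psi> (path_sums x) = commuting_proj K Q x"
proof -
  have "inj_on \<theta> (carrier A)" using ring_iso_memE(5)[OF \<theta>_iso] by (rule bij_betw_imp_inj_on)
  then show ?thesis
    unfolding \<psi>_def using inv_into_f_f[OF _ commuting_proj_closed[OF assms], of \<theta>]
    by (simp add: \<theta>_commuting_proj[OF assms])
qed

lemma \<psi>_smult:
  assumes k: "k \<in> carrier K" and m: "m \<in> carrier inc.I"
  shows "\<psi> (k \<odot>\<^bsub>inc.I\<^esub> m) = k \<odot>\<^bsub>A\<^esub> \<psi> m"
proof -
  obtain x where x: "x \<in> carrier KQ" "m = path_sums x" using path_sums_surj[OF m] by blast
  show ?thesis
    using \<psi>_path_sums[OF path_sums_smult(1)[OF k x(1)]] A_smult[OF k x(1)]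
    by (simp add: x(2) path_sums_smult(2)[OF k x(1)] \<psi>_path_sums[OF x(1)])
qed

lemma \<psi>_unit_matrix:
  assumes "v \<in> verts Q"
  shows "\<psi> (inc.unit_matrix v v) = commuting_proj K Q (path_elem K (vertex_path v))"
proof -
  let ?p = "vertex_path v :: ('v, 'a) qpath"
  have p: "?p \<in> qpaths Q" by (rule vertex_path_mem[OF assms])
  have "path_sums (monomial \<one> ?p) v' w' = inc.unit_matrix v v v' w'" for v' w'
    unfolding path_sums_monomial[OF K.one_closed p] vertex_path_ends inc.unit_matrix_def
    using assms joined_by_path_refl[OF assms] by (simp add: eq_commute)
  then have eq: "path_sums (monomial \<one> ?p) = inc.unit_matrix v v" by (intro ext)
  show ?thesis
    using \<psi>_path_sums[OF monomial_closed[OF K.one_closed p]] unfolding path_elem_eq eq .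
qed

theorem fin_dim_algebra_A: "fin_dim_algebra K A"
proof (rule fin_dim_algebra_transport[OF inc.fin_dim_algebra_I \<psi>_iso])
  show "\<psi> \<zero>\<^bsub>inc.I\<^esub> = \<zero>\<^bsub>A\<^esub>"
    by (rule ring_hom_zero[OF _ inc.ring_I ring_A]) (use \<psi>_iso in \<open>simp add: ring_iso_def\<close>)
qed (rule \<psi>_smult)

end

section \<open>Direct sums of principal modules\<close>

definition regular_module :: "('r, 'e) ring_scheme \<Rightarrow> ('r, 'r) module" where
  "regular_module R =
    \<lparr>carrier = carrier R, mult = undefined, one = undefined,
     zero = \<zero>\<^bsub>R\<^esub>, add = add R, smult = (\<lambda>a x. x \<otimes>\<^bsub>R\<^esub> a)\<rparr>"

lemma regular_module_simps:
  "carrier (regular_module R) = carrier R" "\<zero>\<^bsub>regular_module R\<^esub> = \<zero>\<^bsub>R\<^esub>"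
  "x \<oplus>\<^bsub>regular_module R\<^esub> y = x \<oplus>\<^bsub>R\<^esub> y" "a \<odot>\<^bsub>regular_module R\<^esub> x = x \<otimes>\<^bsub>R\<^esub> a"
  by (simp_all add: regular_module_def)

lemma right_module_regular:
  assumes "ring R"
  shows "right_module R (regular_module R)"
proof -
  interpret R: ring R by fact
  have "abelian_group (regular_module R)"
  proof (rule abelian_groupI)
    show "\<exists>y\<in>carrier (regular_module R). y \<oplus>\<^bsub>regular_module R\<^esub> x = \<zero>\<^bsub>regular_module R\<^esub>"
      if "x \<in> carrier (regular_module R)" for x
      using that unfolding regular_module_simps by (intro bexI[of _ "\<ominus>\<^bsub>R\<^esub> x"] R.l_neg R.a_inv_closed)
  qed (simp_all add: regular_module_simps R.a_ac)
  then show ?thesis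
    by (intro right_module.intro right_module_axioms.intro R.ring_axioms)
      (simp_all add: regular_module_simps R.l_distr R.r_distr R.m_assoc)
qed

lemma principal_right_module_simps:
  "carrier (principal_right_module R e) = {e \<otimes>\<^bsub>R\<^esub> a | a. a \<in> carrier R}"
  "\<zero>\<^bsub>principal_right_module R e\<^esub> = \<zero>\<^bsub>R\<^esub>"
  "x \<oplus>\<^bsub>principal_right_module R e\<^esub> y = x \<oplus>\<^bsub>R\<^esub> y"
  "a \<odot>\<^bsub>principal_right_module R e\<^esub> x = x \<otimes>\<^bsub>R\<^esub> a"
  by (auto simp: principal_right_module_def l_coset_def)

lemma right_module_principal:
  assumes "ring R" and e: "e \<in> carrier R"
  shows "right_module R (principal_right_module R e)"
proof (rule right_module_of_embedding[OF right_module_regular[OF assms(1)], where f = "\<lambda>x. x"])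
  interpret R: ring R by fact
  show "(\<lambda>x. x) \<in> right_hom R (principal_right_module R e) (regular_module R)"
    using e by (intro right_homI) (auto simp: principal_right_module_simps regular_module_simps)
  show "\<zero>\<^bsub>principal_right_module R e\<^esub> \<in> carrier (principal_right_module R e)"
    unfolding principal_right_module_simps using R.r_null[OF e] by (metis (mono_tags) R.zero_closed mem_Collect_eq)
  show "\<zero>\<^bsub>principal_right_module R e\<^esub> = \<zero>\<^bsub>regular_module R\<^esub>"
    by (simp add: principal_right_module_simps regular_module_simps)
  fix x assume "x \<in> carrier (principal_right_module R e)"
  then obtain a where a: "a \<in> carrier R" "x = e \<otimes>\<^bsub>R\<^esub> a" unfolding principal_right_module_simps by blast
  show "r \<odot>\<^bsub>principal_right_module R e\<^esub> x \<in> carrier (principal_right_module R e)" if "r \<in> carrier R" for r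
    unfolding principal_right_module_simps a(2) R.m_assoc[OF e a(1) that]
    using R.m_closed[OF a(1) that] by blast
  fix y assume "y \<in> carrier (principal_right_module R e)"
  then obtain b where b: "b \<in> carrier R" "y = e \<otimes>\<^bsub>R\<^esub> b" unfolding principal_right_module_simps by blast
  show "x \<oplus>\<^bsub>principal_right_module R e\<^esub> y \<in> carrier (principal_right_module R e)"
    unfolding principal_right_module_simps a(2) b(2) R.r_distr[OF a(1) b(1) e, symmetric]
    using R.a_closed[OF a(1) b(1)] by blast
qed simp

lemma direct_sum_module_simps:
  assumes "finite I"
  shows "carrier (direct_sum_module I M) = (\<Pi>\<^sub>E i\<in>I. carrier (M i))"
    "\<zero>\<^bsub>direct_sum_module I M\<^esub> = (\<lambda>i\<in>I. \<zero>\<^bsub>M i\<^esub>)"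
    "f \<oplus>\<^bsub>direct_sum_module I M\<^esub> g = (\<lambda>i\<in>I. f i \<oplus>\<^bsub>M i\<^esub> g i)"
    "a \<odot>\<^bsub>direct_sum_module I M\<^esub> f = (\<lambda>i\<in>I. a \<odot>\<^bsub>M i\<^esub> f i)"
  using assms by (auto simp: direct_sum_module_def)

lemma right_module_direct_sum:
  fixes I :: "'i set"
  assumes "ring R" and fin: "finite I" and M: "\<And>i. i \<in> I \<Longrightarrow> right_module R (M i)"
  shows "right_module R (direct_sum_module I M)"
proof -
  let ?S = "direct_sum_module I M"
  interpret R: ring R by fact
  note simps = direct_sum_module_simps[OF fin]
  have ab: "abelian_group (M i)" if "i \<in> I" for i using M[OF that] by (simp add: right_module_def)
  have mem: "f i \<in> carrier (M i)" if "f \<in> carrier (?S)" "i \<in> I" for f i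
    using that unfolding simps by blast
  have eqI: "f = g" if "f \<in> carrier (?S)" "g \<in> carrier (?S)"
    "\<And>i. i \<in> I \<Longrightarrow> f i = g i" for f g
    using that unfolding simps by (rule PiE_ext)
  have add: "f \<oplus>\<^bsub>?S\<^esub> g \<in> carrier (?S)"
    if "f \<in> carrier (?S)" "g \<in> carrier (?S)" for f g
    unfolding simps using mem[OF that(1)] mem[OF that(2)]
    by (auto intro!: abelian_monoid.a_closed abelian_group.axioms(1)[OF ab])
  have smult: "a \<odot>\<^bsub>?S\<^esub> f \<in> carrier (?S)"
    if "a \<in> carrier R" "f \<in> carrier (?S)" for a f
    unfolding simps using mem[OF that(2)] that(1) by (auto intro!: right_module.rsmult_closed[OF M])
  have zero: "\<zero>\<^bsub>?S\<^esub> \<in> carrier (?S)"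
    unfolding simps by (auto intro!: abelian_monoid.zero_closed abelian_group.axioms(1)[OF ab])
  have "abelian_group (?S)"
  proof (rule abelian_groupI)
    fix f assume f: "f \<in> carrier (?S)"
    define g where "g = (\<lambda>i\<in>I. \<ominus>\<^bsub>M i\<^esub> f i)"
    have g: "g \<in> carrier (?S)"
      unfolding simps g_def using mem[OF f] by (auto intro!: abelian_group.a_inv_closed[OF ab])
    have "g \<oplus>\<^bsub>?S\<^esub> f = \<zero>\<^bsub>?S\<^esub>"
      by (rule eqI[OF add[OF g f] zero])
        (simp add: simps(2,3) g_def abelian_group.l_neg[OF ab] mem[OF f])
    with g show "\<exists>g\<in>carrier (?S). g \<oplus>\<^bsub>?S\<^esub> f = \<zero>\<^bsub>?S\<^esub>"
      by blast
    show "\<zero>\<^bsub>?S\<^esub> \<oplus>\<^bsub>?S\<^esub> f = f"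
      by (rule eqI[OF add[OF zero f] f])
        (simp add: simps(2,3) abelian_monoid.l_zero[OF abelian_group.axioms(1)[OF ab]] mem[OF f])
  next
    fix f g assume f: "f \<in> carrier (?S)" and g: "g \<in> carrier (?S)"
    show "f \<oplus>\<^bsub>?S\<^esub> g = g \<oplus>\<^bsub>?S\<^esub> f"
      by (rule eqI[OF add[OF f g] add[OF g f]])
        (simp add: simps(3) abelian_monoid.a_comm[OF abelian_group.axioms(1)[OF ab]] mem[OF f] mem[OF g])
    fix h assume h: "h \<in> carrier (?S)"
    show "f \<oplus>\<^bsub>?S\<^esub> g \<oplus>\<^bsub>?S\<^esub> h
        = f \<oplus>\<^bsub>?S\<^esub> (g \<oplus>\<^bsub>?S\<^esub> h)"
      by (rule eqI[OF add[OF add[OF f g] h] add[OF f add[OF g h]]])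
        (simp add: simps(3) abelian_monoid.a_assoc[OF abelian_group.axioms(1)[OF ab]] mem[OF f] mem[OF g] mem[OF h])
  qed (simp_all add: add zero)
  then show ?thesis
  proof (intro right_module.intro right_module_axioms.intro R.ring_axioms)
    fix a f assume a: "a \<in> carrier R" and f: "f \<in> carrier (?S)"
    show "a \<odot>\<^bsub>?S\<^esub> f \<in> carrier (?S)" by (rule smult[OF a f])
    fix b assume b: "b \<in> carrier R"
    show "(a \<oplus>\<^bsub>R\<^esub> b) \<odot>\<^bsub>?S\<^esub> f
        = a \<odot>\<^bsub>?S\<^esub> f \<oplus>\<^bsub>?S\<^esub> b \<odot>\<^bsub>?S\<^esub> f"
      by (rule eqI[OF smult[OF R.a_closed[OF a b] f] add[OF smult[OF a f] smult[OF b f]]])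
        (simp add: simps(3,4) right_module.rsmult_distr_ring[OF M] mem[OF f] a b)
    show "(a \<otimes>\<^bsub>R\<^esub> b) \<odot>\<^bsub>?S\<^esub> f
        = b \<odot>\<^bsub>?S\<^esub> (a \<odot>\<^bsub>?S\<^esub> f)"
      by (rule eqI[OF smult[OF R.m_closed[OF a b] f] smult[OF b smult[OF a f]]])
        (simp add: simps(4) right_module.rsmult_assoc[OF M] mem[OF f] a b)
  next
    fix a f g assume a: "a \<in> carrier R" and f: "f \<in> carrier (?S)"
      and g: "g \<in> carrier (?S)"
    show "a \<odot>\<^bsub>?S\<^esub> (f \<oplus>\<^bsub>?S\<^esub> g)
        = a \<odot>\<^bsub>?S\<^esub> f \<oplus>\<^bsub>?S\<^esub> a \<odot>\<^bsub>?S\<^esub> g"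
      by (rule eqI[OF smult[OF a add[OF f g]] add[OF smult[OF a f] smult[OF a g]]])
        (simp add: simps(3,4) right_module.rsmult_distr_module[OF M] mem[OF f] mem[OF g] a)
  next
    fix f assume f: "f \<in> carrier (?S)"
    show "\<one>\<^bsub>R\<^esub> \<odot>\<^bsub>?S\<^esub> f = f"
      by (rule eqI[OF smult[OF R.one_closed f] f])
        (simp add: simps(4) right_module.rsmult_one[OF M] mem[OF f])
  qed
qed

lemma finsum_direct_sum_module:
  assumes "ring R" and fin: "finite I" and M: "\<And>i. i \<in> I \<Longrightarrow> right_module R (M i)"
    and i: "i \<in> I" and g: "\<And>s. s \<in> S \<Longrightarrow> g s \<in> carrier (direct_sum_module I M)"
  shows "(finsum (direct_sum_module I M) g S) i = (\<Oplus>\<^bsub>M i\<^esub>s\<in>S. g s i)"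
proof -
  interpret P: right_module R "direct_sum_module I M" by (rule right_module_direct_sum[OF assms(1-3)])
  interpret Mi: right_module R "M i" by (rule M[OF i])
  note simps = direct_sum_module_simps[OF fin]
  show ?thesis using g
  proof (induction S rule: infinite_finite_induct)
    case (insert s S)
    have "g s' i \<in> carrier (M i)" if "s' \<in> insert s S" for s'
      using insert.prems[OF that] i unfolding simps by blast
    then show ?case using insert i by (simp add: Pi_iff simps(3))
  qed (simp_all add: i simps(2))
qed

section \<open>Endomorphisms of a sum of principal modules\<close>

text \<open>A finite sum refers to the carrier in which it is formed; here the submodule \<open>e R\<close> is compared with \<open>R\<close>.\<close>

lemma finsum_principal_right_module:
  assumes "ring R" "e \<in> carrier R" and g: "\<And>s. s \<in> S \<Longrightarrow> g s \<in> carrier (principal_right_module R e)"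
  shows "finsum (principal_right_module R e) g S = finsum R g S"
proof -
  interpret R: ring R by fact
  interpret P: right_module R "principal_right_module R e" by (rule right_module_principal[OF assms(1,2)])
  show ?thesis using g
  proof (induction S rule: infinite_finite_induct)
    case (insert s S)
    have "g s' \<in> carrier R" if "s' \<in> insert s S" for s'
      using insert.prems[OF that] assms(2) by (auto simp: principal_right_module_simps)
    then show ?case using insert by (simp add: Pi_iff principal_right_module_simps(3))
  qed (simp_all add: principal_right_module_simps)
qed

text \<open>The idempotents are a parameter \<open>e\<close> of their own, so that they may be given by another term than
  \<open>E (w D) (w D)\<close>, for instance as classes of vertices of a quiver.\<close>

locale idempotent_family = incidence_ring K V leq A \<psi>
  for K :: "('k, 'e) ring_scheme" (structure) and V :: "'v set" and leq :: "'v \<Rightarrow> 'v \<Rightarrow> bool"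
    and A :: "('k, 'r) module" and \<psi> :: "('v \<Rightarrow> 'v \<Rightarrow> 'k) \<Rightarrow> 'r" +
  fixes T :: "'s set" and w :: "'s \<Rightarrow> 'v" and e :: "'s \<Rightarrow> 'r"
  assumes \<psi>_smult: "\<lbrakk>k \<in> carrier K; m \<in> carrier (incidence_algebra K V leq)\<rbrakk>
      \<Longrightarrow> \<psi> (k \<odot>\<^bsub>incidence_algebra K V leq\<^esub> m) = k \<odot>\<^bsub>A\<^esub> \<psi> m"
    and finite_T: "finite T"
    and w_mem: "D \<in> T \<Longrightarrow> w D \<in> V"
    and e_eq: "D \<in> T \<Longrightarrow> e D = E (w D) (w D)"
begin

sublocale inc_T: incidence K T "\<lambda>D D'. leq (w D) (w D')"
  by unfold_locales (auto intro: finite_T leq_refl w_mem leq_trans[OF w_mem w_mem w_mem])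

abbreviation "J \<equiv> inc_T.I"

abbreviation "P \<equiv> direct_sum_module T (\<lambda>D. principal_right_module A (e D))"

lemma e_closed: "D \<in> T \<Longrightarrow> e D \<in> carrier A"
  by (simp add: e_eq E_closed)

lemma e_idem: "D \<in> T \<Longrightarrow> e D \<otimes>\<^bsub>A\<^esub> e D = e D"
  by (simp add: e_eq E_mult w_mem leq_refl)

lemma right_module_P: "right_module A P"
  by (intro right_module_direct_sum R.ring_axioms finite_T right_module_principal e_closed)

sublocale P: right_module A P by (rule right_module_P)

lemma P_memI:
  assumes "x \<in> extensional T" "\<And>D. D \<in> T \<Longrightarrow> x D \<in> carrier A" "\<And>D. D \<in> T \<Longrightarrow> e D \<otimes>\<^bsub>A\<^esub> x D = x D"
  shows "x \<in> carrier P"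
  unfolding direct_sum_module_simps(1)[OF finite_T] principal_right_module_simps
proof (rule PiE_I)
  fix D assume D: "D \<in> T"
  show "x D \<in> {e D \<otimes>\<^bsub>A\<^esub> a | a. a \<in> carrier A}"
    using assms(2,3)[OF D] by (metis (mono_tags, lifting) mem_Collect_eq)
qed (use assms(1) in \<open>auto simp: extensional_def\<close>)

lemma P_memD:
  assumes "x \<in> carrier P"
  shows "x \<in> extensional T" "D \<in> T \<Longrightarrow> x D \<in> carrier A" "D \<in> T \<Longrightarrow> e D \<otimes>\<^bsub>A\<^esub> x D = x D"
proof -
  have x: "x \<in> (\<Pi>\<^sub>E D\<in>T. {e D \<otimes>\<^bsub>A\<^esub> a | a. a \<in> carrier A})"
    using assms unfolding direct_sum_module_simps(1)[OF finite_T] principal_right_module_simps .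
  then show "x \<in> extensional T" by (simp add: PiE_def)
  assume D: "D \<in> T"
  then obtain a where a: "a \<in> carrier A" "x D = e D \<otimes>\<^bsub>A\<^esub> a" using x by blast
  show "x D \<in> carrier A" using a D by (simp add: e_closed)
  show "e D \<otimes>\<^bsub>A\<^esub> x D = x D" using a D by (simp add: e_closed e_idem flip: R.m_assoc)
qed

lemma P_simps:
  "\<zero>\<^bsub>P\<^esub> = (\<lambda>D\<in>T. \<zero>\<^bsub>A\<^esub>)" "x \<oplus>\<^bsub>P\<^esub> y = (\<lambda>D\<in>T. x D \<oplus>\<^bsub>A\<^esub> y D)"
  "a \<odot>\<^bsub>P\<^esub> x = (\<lambda>D\<in>T. x D \<otimes>\<^bsub>A\<^esub> a)"
  unfolding direct_sum_module_simps(2-4)[OF finite_T] principal_right_module_simps by rule+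

lemma P_eqI: "x \<in> carrier P \<Longrightarrow> y \<in> carrier P \<Longrightarrow> (\<And>D. D \<in> T \<Longrightarrow> x D = y D) \<Longrightarrow> x = y"
  by (rule extensionalityI[OF P_memD(1) P_memD(1)])

lemma E_mult_other:
  assumes "y \<noteq> u"
  shows "E v y \<otimes>\<^bsub>A\<^esub> E u x = \<zero>\<^bsub>A\<^esub>"
proof -
  have "(unit_matrix v y \<otimes>\<^bsub>I\<^esub> unit_matrix u x) a b = \<zero>" for a b
    unfolding I_simps using assms by (intro K.add.finprod_one_eqI) (auto simp: unit_matrix_def)
  then have "unit_matrix v y \<otimes>\<^bsub>I\<^esub> unit_matrix u x = \<zero>\<^bsub>I\<^esub>" by (intro ext) (simp add: I_simps(1))
  then show ?thesis
    unfolding E_def by (simp add: unit_matrix_closed \<psi>_zero flip: \<psi>_mult)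
qed

text \<open>The corner of \<open>A\<close> between the idempotents at \<open>v\<close> and \<open>u\<close> is \<open>K \<sqdot> E v u\<close>.\<close>

lemma E_corner:
  assumes "v \<in> V" "u \<in> V" and r: "r \<in> carrier A"
  shows "E v v \<otimes>\<^bsub>A\<^esub> r \<otimes>\<^bsub>A\<^esub> E u u = \<kappa> (coef r v u) \<otimes>\<^bsub>A\<^esub> E v u"
proof -
  have cl: "\<kappa> (coef r v y) \<otimes>\<^bsub>A\<^esub> E v y \<in> carrier A" for y
    by (simp add: \<kappa>_closed coef_entry r E_closed)
  have "E v v \<otimes>\<^bsub>A\<^esub> r \<otimes>\<^bsub>A\<^esub> E u u = (\<Oplus>\<^bsub>A\<^esub>y\<in>V. \<kappa> (coef r v y) \<otimes>\<^bsub>A\<^esub> E v y \<otimes>\<^bsub>A\<^esub> E u u)"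
    using assms by (simp add: E_row_mult leq_refl R.finsum_ldistr finite_V E_closed cl)
  also have "\<dots> = \<kappa> (coef r v u) \<otimes>\<^bsub>A\<^esub> E v u \<otimes>\<^bsub>A\<^esub> E u u"
    using assms
    by (intro R.finsum_single finite_V)
      (simp_all add: cl E_closed, simp add: R.m_assoc \<kappa>_closed coef_entry r E_closed E_mult_other)
  also have "\<dots> = \<kappa> (coef r v u) \<otimes>\<^bsub>A\<^esub> E v u"
  proof (cases "leq v u")
    case True
    then show ?thesis
      using assms by (simp add: R.m_assoc \<kappa>_closed coef_entry E_closed E_mult leq_refl)
  next
    case False
    then show ?thesis using r by (simp add: E_zero E_closed \<kappa>_closed coef_entry)
  qed
  finally show ?thesis .
qed

text \<open>A matrix indexed by \<open>T\<close> is turned into a matrix of elements of the corners \<open>e D A e F\<close>.\<close>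

definition block :: "('s \<Rightarrow> 's \<Rightarrow> 'k) \<Rightarrow> 's \<Rightarrow> 's \<Rightarrow> 'r" where
  "block m D F = \<kappa> (m D F) \<otimes>\<^bsub>A\<^esub> E (w D) (w F)"

lemma block_closed: "m \<in> carrier J \<Longrightarrow> block m D F \<in> carrier A"
  by (simp add: block_def \<kappa>_closed inc_T.entry_closed E_closed)

lemma block_add:
  assumes "m \<in> carrier J" "m' \<in> carrier J"
  shows "block (m \<oplus>\<^bsub>J\<^esub> m') D F = block m D F \<oplus>\<^bsub>A\<^esub> block m' D F"
  using inc_T.entry_closed[OF assms(1)] inc_T.entry_closed[OF assms(2)]
  by (simp add: block_def inc_T.I_simps(3) ring_hom_add[OF \<kappa>_hom] R.l_distr \<kappa>_closed E_closed)

lemma block_smult: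
  assumes "k \<in> carrier K" "m \<in> carrier J"
  shows "block (k \<odot>\<^bsub>J\<^esub> m) D F = \<kappa> k \<otimes>\<^bsub>A\<^esub> block m D F"
  using assms inc_T.entry_closed[OF assms(2)]
  by (simp add: block_def inc_T.I_simps(5) ring_hom_mult[OF \<kappa>_hom] R.m_assoc \<kappa>_closed E_closed)

lemma block_zero: "block \<zero>\<^bsub>J\<^esub> D F = \<zero>\<^bsub>A\<^esub>"
  by (simp add: block_def inc_T.I_simps(1) \<kappa>_zero E_closed)

lemma block_one:
  assumes "D \<in> T"
  shows "block \<one>\<^bsub>J\<^esub> D F = (if D = F then e D else \<zero>\<^bsub>A\<^esub>)"
  using assms by (auto simp: block_def inc_T.I_simps(2) \<kappa>_zero ring_hom_one[OF \<kappa>_hom] E_closed e_eq)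

lemma block_e:
  assumes "m \<in> carrier J" "D \<in> T" "F \<in> T"
  shows "e D \<otimes>\<^bsub>A\<^esub> block m D F = block m D F" "block m D F \<otimes>\<^bsub>A\<^esub> e F = block m D F"
proof -
  note k = inc_T.entry_closed[OF assms(1), of D F]
  have DE: "E (w D) (w D) \<otimes>\<^bsub>A\<^esub> E (w D) (w F) = E (w D) (w F)"
    using assms by (simp add: E_mult w_mem leq_refl E_zero)
  have "e D \<otimes>\<^bsub>A\<^esub> block m D F = \<kappa> (m D F) \<otimes>\<^bsub>A\<^esub> (E (w D) (w D) \<otimes>\<^bsub>A\<^esub> E (w D) (w F))"
    using k assms by (simp add: block_def e_eq \<kappa>_closed E_closed \<kappa>_central R.m_assoc)
  then show "e D \<otimes>\<^bsub>A\<^esub> block m D F = block m D F" by (simp add: DE block_def)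
  have "E (w D) (w F) \<otimes>\<^bsub>A\<^esub> E (w F) (w F) = E (w D) (w F)"
    using assms by (cases "leq (w D) (w F)") (simp_all add: E_mult w_mem leq_refl E_zero E_closed)
  then show "block m D F \<otimes>\<^bsub>A\<^esub> e F = block m D F"
    using k assms by (simp add: block_def e_eq \<kappa>_closed E_closed R.m_assoc)
qed

lemma block_mult:
  assumes m: "m \<in> carrier J" and m': "m' \<in> carrier J" and DF: "D \<in> T" "F \<in> T"
  shows "block (m \<otimes>\<^bsub>J\<^esub> m') D F = (\<Oplus>\<^bsub>A\<^esub>G\<in>T. block m D G \<otimes>\<^bsub>A\<^esub> block m' G F)"
proof -
  note k = inc_T.entry_closed[OF m] and k' = inc_T.entry_closed[OF m']
  have step: "block m D G \<otimes>\<^bsub>A\<^esub> block m' G F = \<kappa> (m D G \<otimes> m' G F) \<otimes>\<^bsub>A\<^esub> E (w D) (w F)" if G: "G \<in> T" for G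
  proof (cases "leq (w D) (w G) \<and> leq (w G) (w F)")
    case True
    have "block m D G \<otimes>\<^bsub>A\<^esub> block m' G F
        = \<kappa> (m D G) \<otimes>\<^bsub>A\<^esub> (E (w D) (w G) \<otimes>\<^bsub>A\<^esub> \<kappa> (m' G F)) \<otimes>\<^bsub>A\<^esub> E (w G) (w F)"
      using k k' by (simp add: block_def R.m_assoc \<kappa>_closed E_closed)
    also have "\<dots> = \<kappa> (m D G) \<otimes>\<^bsub>A\<^esub> (\<kappa> (m' G F) \<otimes>\<^bsub>A\<^esub> E (w D) (w G)) \<otimes>\<^bsub>A\<^esub> E (w G) (w F)"
      using k' by (simp add: \<kappa>_central E_closed)
    also have "\<dots> = \<kappa> (m D G) \<otimes>\<^bsub>A\<^esub> \<kappa> (m' G F) \<otimes>\<^bsub>A\<^esub> (E (w D) (w G) \<otimes>\<^bsub>A\<^esub> E (w G) (w F))"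
      using k k' by (simp add: R.m_assoc \<kappa>_closed E_closed)
    also have "E (w D) (w G) \<otimes>\<^bsub>A\<^esub> E (w G) (w F) = E (w D) (w F)"
      using True G by (simp add: E_mult w_mem)
    finally show ?thesis using k k' by (simp add: ring_hom_mult[OF \<kappa>_hom])
  next
    case False
    then have "m D G = \<zero> \<or> m' G F = \<zero>" using inc_T.entry_zero[OF m] inc_T.entry_zero[OF m'] by blast
    then show ?thesis
      using k[of D G] k'[of G F] by (elim disjE) (simp_all add: block_def \<kappa>_zero E_closed \<kappa>_closed)
  qed
  have sum: "\<kappa> (\<Oplus>G\<in>S. f G) = (\<Oplus>\<^bsub>A\<^esub>G\<in>S. \<kappa> (f G))" if "\<And>G. f G \<in> carrier K" for f and S :: "'s set"
  proof (induction S rule: infinite_finite_induct)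
    case (insert G S)
    then show ?case using that by (simp add: ring_hom_add[OF \<kappa>_hom] \<kappa>_closed K.finsum_closed)
  qed (simp_all add: \<kappa>_zero)
  have "block (m \<otimes>\<^bsub>J\<^esub> m') D F = (\<Oplus>\<^bsub>A\<^esub>G\<in>T. \<kappa> (m D G \<otimes> m' G F)) \<otimes>\<^bsub>A\<^esub> E (w D) (w F)"
    unfolding block_def inc_T.I_simps(4) by (subst sum) (simp_all add: k k')
  also have "\<dots> = (\<Oplus>\<^bsub>A\<^esub>G\<in>T. \<kappa> (m D G \<otimes> m' G F) \<otimes>\<^bsub>A\<^esub> E (w D) (w F))"
    by (rule R.finsum_ldistr[OF finite_T E_closed]) (simp add: k k' \<kappa>_closed)
  also have "\<dots> = (\<Oplus>\<^bsub>A\<^esub>G\<in>T. block m D G \<otimes>\<^bsub>A\<^esub> block m' G F)"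
    by (rule R.finsum_cong') (simp_all add: step block_closed[OF m] block_closed[OF m'] flip: step)
  finally show ?thesis .
qed

text \<open>Elements of \<open>P\<close> are columns with entries in the ideals \<open>e F A\<close>, and \<open>\<xi> m\<close> multiplies them from the left by
  the matrix of blocks.\<close>

definition \<xi> :: "('s \<Rightarrow> 's \<Rightarrow> 'k) \<Rightarrow> ('s \<Rightarrow> 'r) \<Rightarrow> 's \<Rightarrow> 'r" where
  "\<xi> m = (\<lambda>x\<in>carrier P. \<lambda>D\<in>T. \<Oplus>\<^bsub>A\<^esub>F\<in>T. block m D F \<otimes>\<^bsub>A\<^esub> x F)"

lemma \<xi>_apply:
  "x \<in> carrier P \<Longrightarrow> D \<in> T \<Longrightarrow> \<xi> m x D = (\<Oplus>\<^bsub>A\<^esub>F\<in>T. block m D F \<otimes>\<^bsub>A\<^esub> x F)"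
  by (simp add: \<xi>_def)

lemma \<xi>_closed:
  assumes m: "m \<in> carrier J" and x: "x \<in> carrier P"
  shows "\<xi> m x \<in> carrier P"
proof (rule P_memI)
  note xD = P_memD[OF x]
  have cl: "(\<lambda>F. block m D F \<otimes>\<^bsub>A\<^esub> x F) \<in> T \<rightarrow> carrier A" for D
    using xD by (simp add: block_closed[OF m])
  show "\<xi> m x \<in> extensional T" using x by (simp add: \<xi>_def)
  fix D assume D: "D \<in> T"
  show "\<xi> m x D \<in> carrier A" unfolding \<xi>_apply[OF x D] by (rule R.finsum_closed[OF cl])
  have "e D \<otimes>\<^bsub>A\<^esub> \<xi> m x D = (\<Oplus>\<^bsub>A\<^esub>F\<in>T. e D \<otimes>\<^bsub>A\<^esub> (block m D F \<otimes>\<^bsub>A\<^esub> x F))"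
    unfolding \<xi>_apply[OF x D] by (rule R.finsum_rdistr[OF finite_T e_closed[OF D] cl])
  also have "\<dots> = \<xi> m x D"
    unfolding \<xi>_apply[OF x D]
  proof (rule R.finsum_cong'[OF refl cl])
    fix F assume F: "F \<in> T"
    show "e D \<otimes>\<^bsub>A\<^esub> (block m D F \<otimes>\<^bsub>A\<^esub> x F) = block m D F \<otimes>\<^bsub>A\<^esub> x F"
      using block_e(1)[OF m D F] R.m_assoc[OF e_closed[OF D] block_closed[OF m] xD(2)[OF F], of D F] by simp
  qed
  finally show "e D \<otimes>\<^bsub>A\<^esub> \<xi> m x D = \<xi> m x D" .
qed

lemma \<xi>_hom:
  assumes m: "m \<in> carrier J"
  shows "\<xi> m \<in> right_hom A P P"
proof (rule right_homI)
  fix x assume x: "x \<in> carrier P"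
  show "\<xi> m x \<in> carrier P" by (rule \<xi>_closed[OF m x])
  note xD = P_memD[OF x]
  fix y assume y: "y \<in> carrier P"
  note yD = P_memD[OF y]
  show "\<xi> m (x \<oplus>\<^bsub>P\<^esub> y) = \<xi> m x \<oplus>\<^bsub>P\<^esub> \<xi> m y"
  proof (rule P_eqI)
    fix D assume D: "D \<in> T"
    have "\<xi> m (x \<oplus>\<^bsub>P\<^esub> y) D = (\<Oplus>\<^bsub>A\<^esub>F\<in>T. block m D F \<otimes>\<^bsub>A\<^esub> x F \<oplus>\<^bsub>A\<^esub> block m D F \<otimes>\<^bsub>A\<^esub> y F)"
      unfolding \<xi>_apply[OF P.a_closed[OF x y] D]
      by (rule R.finsum_cong') (simp_all add: P_simps R.r_distr block_closed[OF m] xD yD)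
    also have "\<dots> = \<xi> m x D \<oplus>\<^bsub>A\<^esub> \<xi> m y D"
      unfolding \<xi>_apply[OF x D] \<xi>_apply[OF y D]
      by (rule R.finsum_addf) (simp_all add: block_closed[OF m] xD yD)
    finally show "\<xi> m (x \<oplus>\<^bsub>P\<^esub> y) D = (\<xi> m x \<oplus>\<^bsub>P\<^esub> \<xi> m y) D" using D by (simp add: P_simps)
  qed (intro \<xi>_closed m P.a_closed x y)+
next
  fix a x assume a: "a \<in> carrier A" and x: "x \<in> carrier P"
  note xD = P_memD[OF x]
  show "\<xi> m (a \<odot>\<^bsub>P\<^esub> x) = a \<odot>\<^bsub>P\<^esub> \<xi> m x"
  proof (rule P_eqI)
    fix D assume D: "D \<in> T"
    have "\<xi> m (a \<odot>\<^bsub>P\<^esub> x) D = (\<Oplus>\<^bsub>A\<^esub>F\<in>T. block m D F \<otimes>\<^bsub>A\<^esub> x F \<otimes>\<^bsub>A\<^esub> a)"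
      unfolding \<xi>_apply[OF P.rsmult_closed[OF a x] D]
      by (rule R.finsum_cong') (simp_all add: P_simps R.m_assoc block_closed[OF m] xD a)
    also have "\<dots> = \<xi> m x D \<otimes>\<^bsub>A\<^esub> a"
      unfolding \<xi>_apply[OF x D]
      by (rule R.finsum_ldistr[OF finite_T a, symmetric]) (simp add: block_closed[OF m] xD)
    finally show "\<xi> m (a \<odot>\<^bsub>P\<^esub> x) D = (a \<odot>\<^bsub>P\<^esub> \<xi> m x) D" using D by (simp add: P_simps)
  qed (intro \<xi>_closed m P.rsmult_closed a x)+
qed

abbreviation "S \<equiv> End_algebra A P"

lemma S_simps:
  "carrier S = right_hom A P P \<inter> extensional (carrier P)"
  "f \<otimes>\<^bsub>S\<^esub> g = compose (carrier P) f g"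
  "\<one>\<^bsub>S\<^esub> = (\<lambda>x\<in>carrier P. x)"
  "\<zero>\<^bsub>S\<^esub> = (\<lambda>x\<in>carrier P. \<zero>\<^bsub>P\<^esub>)"
  "f \<oplus>\<^bsub>S\<^esub> g = (\<lambda>x\<in>carrier P. f x \<oplus>\<^bsub>P\<^esub> g x)"
  "k \<odot>\<^bsub>S\<^esub> f = (\<lambda>x\<in>carrier P. (k \<odot>\<^bsub>A\<^esub> \<one>\<^bsub>A\<^esub>) \<odot>\<^bsub>P\<^esub> f x)"
  by (simp_all add: End_algebra_def)

lemma \<xi>_mem: "m \<in> carrier J \<Longrightarrow> \<xi> m \<in> carrier S"
  unfolding S_simps using \<xi>_hom by (simp add: \<xi>_def)

lemma \<xi>_mult:
  assumes m: "m \<in> carrier J" and m': "m' \<in> carrier J"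
  shows "\<xi> (m \<otimes>\<^bsub>J\<^esub> m') = \<xi> m \<otimes>\<^bsub>S\<^esub> \<xi> m'"
proof (rule extensionalityI[of _ "carrier P"])
  note mm = inc_T.mult_closed[OF m m']
  fix x assume x: "x \<in> carrier P"
  note xD = P_memD[OF x]
  have "\<xi> (m \<otimes>\<^bsub>J\<^esub> m') x = \<xi> m (\<xi> m' x)"
  proof (rule P_eqI)
    fix D assume D: "D \<in> T"
    have "\<xi> m (\<xi> m' x) D = (\<Oplus>\<^bsub>A\<^esub>G\<in>T. \<Oplus>\<^bsub>A\<^esub>F\<in>T. block m D G \<otimes>\<^bsub>A\<^esub> block m' G F \<otimes>\<^bsub>A\<^esub> x F)"
      unfolding \<xi>_apply[OF \<xi>_closed[OF m' x] D]
    proof (rule R.finsum_cong')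
      fix G assume G: "G \<in> T"
      show "block m D G \<otimes>\<^bsub>A\<^esub> \<xi> m' x G = (\<Oplus>\<^bsub>A\<^esub>F\<in>T. block m D G \<otimes>\<^bsub>A\<^esub> block m' G F \<otimes>\<^bsub>A\<^esub> x F)"
        unfolding \<xi>_apply[OF x G]
        by (subst R.finsum_rdistr[OF finite_T block_closed[OF m]])
          (simp_all add: block_closed[OF m] block_closed[OF m'] xD R.m_assoc Pi_iff cong: R.finsum_cong)
    qed (simp_all add: block_closed[OF m] block_closed[OF m'] xD Pi_iff)
    also have "\<dots> = (\<Oplus>\<^bsub>A\<^esub>F\<in>T. \<Oplus>\<^bsub>A\<^esub>G\<in>T. block m D G \<otimes>\<^bsub>A\<^esub> block m' G F \<otimes>\<^bsub>A\<^esub> x F)"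
      by (rule R.add.finprod_finprod_swap[OF finite_T finite_T])
        (simp add: block_closed[OF m] block_closed[OF m'] xD)
    also have "\<dots> = \<xi> (m \<otimes>\<^bsub>J\<^esub> m') x D"
      unfolding \<xi>_apply[OF x D]
    proof (rule R.finsum_cong')
      fix F assume F: "F \<in> T"
      show "(\<Oplus>\<^bsub>A\<^esub>G\<in>T. block m D G \<otimes>\<^bsub>A\<^esub> block m' G F \<otimes>\<^bsub>A\<^esub> x F) = block (m \<otimes>\<^bsub>J\<^esub> m') D F \<otimes>\<^bsub>A\<^esub> x F"
        unfolding block_mult[OF m m' D F]
        by (rule R.finsum_ldistr[OF finite_T xD(2)[OF F], symmetric])
          (simp add: block_closed[OF m] block_closed[OF m'])
    qed (simp_all add: block_closed[OF mm] xD)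
    finally show "\<xi> (m \<otimes>\<^bsub>J\<^esub> m') x D = \<xi> m (\<xi> m' x) D" ..
  qed (intro \<xi>_closed m m' mm x)+
  then show "\<xi> (m \<otimes>\<^bsub>J\<^esub> m') x = (\<xi> m \<otimes>\<^bsub>S\<^esub> \<xi> m') x"
    using x by (simp add: S_simps compose_def)
qed (simp_all add: \<xi>_def S_simps compose_def)

lemma \<xi>_add:
  assumes m: "m \<in> carrier J" and m': "m' \<in> carrier J"
  shows "\<xi> (m \<oplus>\<^bsub>J\<^esub> m') = \<xi> m \<oplus>\<^bsub>S\<^esub> \<xi> m'"
proof (rule extensionalityI[of _ "carrier P"])
  fix x assume x: "x \<in> carrier P"
  note xD = P_memD[OF x]
  have mm: "m \<oplus>\<^bsub>J\<^esub> m' \<in> carrier J"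
    by (rule abelian_monoid.a_closed[OF abelian_group.axioms(1)[OF inc_T.abelian_group_I] m m'])
  have "\<xi> (m \<oplus>\<^bsub>J\<^esub> m') x = \<xi> m x \<oplus>\<^bsub>P\<^esub> \<xi> m' x"
  proof (rule P_eqI)
    fix D assume D: "D \<in> T"
    have "\<xi> (m \<oplus>\<^bsub>J\<^esub> m') x D = (\<Oplus>\<^bsub>A\<^esub>F\<in>T. block m D F \<otimes>\<^bsub>A\<^esub> x F \<oplus>\<^bsub>A\<^esub> block m' D F \<otimes>\<^bsub>A\<^esub> x F)"
      unfolding \<xi>_apply[OF x D] block_add[OF m m']
      by (rule R.finsum_cong') (simp_all add: R.l_distr block_closed[OF m] block_closed[OF m'] xD)
    also have "\<dots> = \<xi> m x D \<oplus>\<^bsub>A\<^esub> \<xi> m' x D"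
      unfolding \<xi>_apply[OF x D]
      by (rule R.finsum_addf) (simp_all add: block_closed[OF m] block_closed[OF m'] xD)
    finally show "\<xi> (m \<oplus>\<^bsub>J\<^esub> m') x D = (\<xi> m x \<oplus>\<^bsub>P\<^esub> \<xi> m' x) D" using D by (simp add: P_simps)
  qed (intro \<xi>_closed P.a_closed m m' mm x)+
  then show "\<xi> (m \<oplus>\<^bsub>J\<^esub> m') x = (\<xi> m \<oplus>\<^bsub>S\<^esub> \<xi> m') x" using x by (simp add: S_simps)
qed (simp_all add: \<xi>_def S_simps)

lemma \<xi>_one: "\<xi> \<one>\<^bsub>J\<^esub> = \<one>\<^bsub>S\<^esub>"
proof (rule extensionalityI[of _ "carrier P"])
  interpret J: ring J by (rule inc_T.ring_I)
  fix x assume x: "x \<in> carrier P"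
  note xD = P_memD[OF x]
  have "\<xi> \<one>\<^bsub>J\<^esub> x = x"
  proof (rule P_eqI)
    fix D assume D: "D \<in> T"
    have "\<xi> \<one>\<^bsub>J\<^esub> x D = block \<one>\<^bsub>J\<^esub> D D \<otimes>\<^bsub>A\<^esub> x D"
      unfolding \<xi>_apply[OF x D] using D xD
      by (intro R.finsum_single finite_T) (simp_all add: block_closed, simp add: block_one)
    then show "\<xi> \<one>\<^bsub>J\<^esub> x D = x D" using D xD by (simp add: block_one)
  qed (intro \<xi>_closed J.one_closed x)+
  then show "\<xi> \<one>\<^bsub>J\<^esub> x = \<one>\<^bsub>S\<^esub> x" using x by (simp add: S_simps)
qed (simp_all add: \<xi>_def S_simps)

lemma \<xi>_zero: "\<xi> \<zero>\<^bsub>J\<^esub> = \<zero>\<^bsub>S\<^esub>"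
proof (rule extensionalityI[of _ "carrier P"])
  fix x assume x: "x \<in> carrier P"
  have "(\<Oplus>\<^bsub>A\<^esub>F\<in>T. block \<zero>\<^bsub>J\<^esub> D F \<otimes>\<^bsub>A\<^esub> x F) = \<zero>\<^bsub>A\<^esub>" for D
    using P_memD(2)[OF x] by (intro R.add.finprod_one_eqI) (simp add: block_zero)
  then show "\<xi> \<zero>\<^bsub>J\<^esub> x = \<zero>\<^bsub>S\<^esub> x" using x by (simp add: \<xi>_def S_simps P_simps)
qed (simp_all add: \<xi>_def S_simps)

lemma smult_one: "k \<in> carrier K \<Longrightarrow> k \<odot>\<^bsub>A\<^esub> \<one>\<^bsub>A\<^esub> = \<kappa> k"
proof -
  assume k: "k \<in> carrier K"
  have "scalar_matrix k = k \<odot>\<^bsub>I\<^esub> \<one>\<^bsub>I\<^esub>" using k by (auto simp: I_simps scalar_matrix_def fun_eq_iff)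
  then show ?thesis using \<psi>_smult[OF k I.one_closed] by (simp add: \<kappa>_def \<psi>_one)
qed

lemma \<xi>_smult:
  assumes k: "k \<in> carrier K" and m: "m \<in> carrier J"
  shows "\<xi> (k \<odot>\<^bsub>J\<^esub> m) = k \<odot>\<^bsub>S\<^esub> \<xi> m"
proof (rule extensionalityI[of _ "carrier P"])
  fix x assume x: "x \<in> carrier P"
  note xD = P_memD[OF x] and \<kappa> = \<kappa>_closed[OF k]
  have "\<xi> (k \<odot>\<^bsub>J\<^esub> m) x = \<kappa> k \<odot>\<^bsub>P\<^esub> \<xi> m x"
  proof (rule P_eqI)
    fix D assume D: "D \<in> T"
    have "\<xi> (k \<odot>\<^bsub>J\<^esub> m) x D = (\<Oplus>\<^bsub>A\<^esub>F\<in>T. \<kappa> k \<otimes>\<^bsub>A\<^esub> (block m D F \<otimes>\<^bsub>A\<^esub> x F))"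
      unfolding \<xi>_apply[OF x D] block_smult[OF k m]
      by (rule R.finsum_cong') (simp_all add: R.m_assoc block_closed[OF m] xD \<kappa>)
    also have "\<dots> = \<kappa> k \<otimes>\<^bsub>A\<^esub> \<xi> m x D"
      unfolding \<xi>_apply[OF x D]
      by (rule R.finsum_rdistr[OF finite_T \<kappa>, symmetric]) (simp add: block_closed[OF m] xD)
    also have "\<dots> = \<xi> m x D \<otimes>\<^bsub>A\<^esub> \<kappa> k"
      by (rule \<kappa>_central[OF k P_memD(2)[OF \<xi>_closed[OF m x] D]])
    finally show "\<xi> (k \<odot>\<^bsub>J\<^esub> m) x D = (\<kappa> k \<odot>\<^bsub>P\<^esub> \<xi> m x) D" using D by (simp add: P_simps)
  qed (intro \<xi>_closed P.rsmult_closed \<kappa> inc_T.smult_closed k m x)+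
  then show "\<xi> (k \<odot>\<^bsub>J\<^esub> m) x = (k \<odot>\<^bsub>S\<^esub> \<xi> m) x" using x by (simp add: S_simps smult_one[OF k])
qed (simp_all add: \<xi>_def S_simps)

text \<open>The idempotent \<open>e F\<close>, placed in the summand of \<open>F\<close>; these elements generate \<open>P\<close>.\<close>

definition gen :: "'s \<Rightarrow> 's \<Rightarrow> 'r" where
  "gen F = (\<lambda>D\<in>T. if D = F then e F else \<zero>\<^bsub>A\<^esub>)"

lemma gen_closed: "F \<in> T \<Longrightarrow> gen F \<in> carrier P"
  by (rule P_memI) (auto simp: gen_def e_closed e_idem)

lemma \<xi>_gen:
  assumes m: "m \<in> carrier J" and D: "D \<in> T" and F: "F \<in> T"
  shows "\<xi> m (gen F) D = block m D F"
proof -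
  have "\<xi> m (gen F) D = block m D F \<otimes>\<^bsub>A\<^esub> gen F F"
    unfolding \<xi>_apply[OF gen_closed[OF F] D] using F
    by (intro R.finsum_single finite_T) (simp_all add: gen_def block_closed[OF m] e_closed)
  then show ?thesis using F by (simp add: gen_def block_e(2)[OF m D F])
qed

lemma coef_tm:
  assumes m: "m \<in> carrier J" and DF: "D \<in> T" "F \<in> T"
  shows "coef (block m D F) (w D) (w F) = m D F"
proof (cases "leq (w D) (w F)")
  case True
  note k = inc_T.entry_closed[OF m, of D F]
  have "coef (block m D F) (w D) (w F)
      = (\<Oplus>x\<in>V. scalar_matrix (m D F) (w D) x \<otimes> unit_matrix (w D) (w F) x (w F))"
    unfolding block_def coef_mult[OF \<kappa>_closed[OF k] E_closed] coef_\<kappa>[OF k] coef_E ..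
  also have "\<dots> = scalar_matrix (m D F) (w D) (w D) \<otimes> unit_matrix (w D) (w F) (w D) (w F)"
    using k DF w_mem by (intro K.finsum_single finite_V) (auto simp: scalar_matrix_def unit_matrix_def)
  finally show ?thesis using True k DF by (simp add: scalar_matrix_def unit_matrix_def w_mem)
next
  case False
  then have zero: "m D F = \<zero>" using inc_T.entry_zero[OF m] by blast
  show ?thesis
    unfolding zero using False entry_zero[OF coef_closed[OF block_closed[OF m]]] by blast
qed

lemma \<xi>_inj: "inj_on \<xi> (carrier J)"
proof (rule inj_onI, intro ext)
  fix m m' D F assume m: "m \<in> carrier J" and m': "m' \<in> carrier J" and eq: "\<xi> m = \<xi> m'"
  show "m D F = m' D F"
  proof (cases "D \<in> T \<and> F \<in> T")
    case True
    then have "block m D F = block m' D F" using \<xi>_gen[OF m, of D F] \<xi>_gen[OF m', of D F] eq by simp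
    then show ?thesis using coef_tm[OF m, of D F] coef_tm[OF m', of D F] True by simp
  next
    case False
    then show ?thesis using inc_T.entry_zero[OF m, of D F] inc_T.entry_zero[OF m', of D F] by auto
  qed
qed

lemma finsum_P_apply:
  assumes "\<And>F. F \<in> T \<Longrightarrow> g F \<in> carrier P" and D: "D \<in> T"
  shows "(\<Oplus>\<^bsub>P\<^esub>F\<in>T. g F) D = (\<Oplus>\<^bsub>A\<^esub>F\<in>T. g F D)"
proof -
  have "(\<Oplus>\<^bsub>P\<^esub>F\<in>T. g F) D = (\<Oplus>\<^bsub>principal_right_module A (e D)\<^esub>F\<in>T. g F D)"
    by (rule finsum_direct_sum_module[OF R.ring_axioms finite_T right_module_principal[OF R.ring_axioms e_closed] D assms(1)])
  also have "\<dots> = (\<Oplus>\<^bsub>A\<^esub>F\<in>T. g F D)"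
  proof (rule finsum_principal_right_module[OF R.ring_axioms e_closed[OF D]])
    show "g F D \<in> carrier (principal_right_module A (e D))" if "F \<in> T" for F
      using assms(1)[OF that] D unfolding direct_sum_module_simps(1)[OF finite_T] by blast
  qed
  finally show ?thesis .
qed

lemma P_expansion:
  assumes x: "x \<in> carrier P"
  shows "(\<Oplus>\<^bsub>P\<^esub>F\<in>T. x F \<odot>\<^bsub>P\<^esub> gen F) = x"
proof (rule P_eqI)
  note xD = P_memD[OF x]
  have cl: "x F \<odot>\<^bsub>P\<^esub> gen F \<in> carrier P" if "F \<in> T" for F
    by (rule P.rsmult_closed[OF xD(2)[OF that] gen_closed[OF that]])
  show "(\<Oplus>\<^bsub>P\<^esub>F\<in>T. x F \<odot>\<^bsub>P\<^esub> gen F) \<in> carrier P" using cl by (intro P.finsum_closed) simp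
  fix D assume D: "D \<in> T"
  have "(\<Oplus>\<^bsub>P\<^esub>F\<in>T. x F \<odot>\<^bsub>P\<^esub> gen F) D = (\<Oplus>\<^bsub>A\<^esub>F\<in>T. (x F \<odot>\<^bsub>P\<^esub> gen F) D)"
    by (rule finsum_P_apply[OF cl D])
  also have "\<dots> = (x D \<odot>\<^bsub>P\<^esub> gen D) D"
    using D xD by (intro R.finsum_single finite_T) (simp_all add: P_simps gen_def e_closed)
  also have "\<dots> = x D" using D xD by (simp add: P_simps gen_def)
  finally show "(\<Oplus>\<^bsub>P\<^esub>F\<in>T. x F \<odot>\<^bsub>P\<^esub> gen F) D = x D" .
qed (rule x)

text \<open>An endomorphism \<open>f\<close> is determined by the values \<open>f (gen F)\<close>. As \<open>gen F\<close> is fixed by \<open>e F\<close>, the component of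
  \<open>f (gen F)\<close> in the summand of \<open>D\<close> lies in the corner \<open>e D A e F\<close>, so it is a scalar multiple of a matrix
  unit. These scalars form the required matrix.\<close>

lemma \<xi>_surj:
  assumes f: "f \<in> carrier S"
  shows "\<exists>m \<in> carrier J. \<xi> m = f"
proof -
  have hom: "f \<in> right_hom A P P" and ext: "f \<in> extensional (carrier P)" using f by (simp_all add: S_simps)
  define a where "a D F = f (gen F) D" for D F
  have fg: "f (gen F) \<in> carrier P" if "F \<in> T" for F by (rule right_hom_closed[OF hom gen_closed[OF that]])
  have a_closed: "a D F \<in> carrier A" if "D \<in> T" "F \<in> T" for D F
    unfolding a_def by (rule P_memD(2)[OF fg[OF that(2)] that(1)])
  have a_corner: "e D \<otimes>\<^bsub>A\<^esub> a D F \<otimes>\<^bsub>A\<^esub> e F = a D F" if D: "D \<in> T" and F: "F \<in> T" for D F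
  proof -
    have "e F \<odot>\<^bsub>P\<^esub> gen F = gen F"
      using F by (auto simp: P_simps gen_def e_idem e_closed fun_eq_iff restrict_def)
    then have "e F \<odot>\<^bsub>P\<^esub> f (gen F) = f (gen F)"
      using right_hom_smult[OF hom e_closed[OF F] gen_closed[OF F]] by simp
    then have "a D F \<otimes>\<^bsub>A\<^esub> e F = a D F"
      using D by (simp add: a_def P_simps fun_eq_iff restrict_def) (metis)
    then show ?thesis using P_memD(3)[OF fg[OF F] D] by (simp add: a_def)
  qed
  define m where "m D F = (if D \<in> T \<and> F \<in> T then coef (a D F) (w D) (w F) else \<zero>)" for D F
  have m: "m \<in> carrier J"
  proof (rule inc_T.I_memI)
    show "m D F \<in> carrier K" for D F by (simp add: m_def coef_entry a_closed)
    show "m D F = \<zero>" if "\<not> (D \<in> T \<and> F \<in> T \<and> leq (w D) (w F))" for D F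
    proof (cases "D \<in> T \<and> F \<in> T")
      case True
      then have "\<not> leq (w D) (w F)" using that by blast
      then show ?thesis
        using True entry_zero[OF coef_closed[OF a_closed[of D F]], of "w D" "w F"] by (simp add: m_def)
    qed (auto simp: m_def)
  qed
  have block: "block m D F = a D F" if "D \<in> T" "F \<in> T" for D F
    using E_corner[OF w_mem[OF that(1)] w_mem[OF that(2)] a_closed[OF that]] a_corner[OF that] that
    by (simp add: block_def m_def e_eq)
  have "\<xi> m = f"
  proof (rule extensionalityI[OF _ ext])
    show "\<xi> m \<in> extensional (carrier P)" by (simp add: \<xi>_def)
    fix x assume x: "x \<in> carrier P"
    note xD = P_memD[OF x]
    have "f x = f (\<Oplus>\<^bsub>P\<^esub>F\<in>T. x F \<odot>\<^bsub>P\<^esub> gen F)" by (simp add: P_expansion[OF x])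
    also have "\<dots> = (\<Oplus>\<^bsub>P\<^esub>F\<in>T. f (x F \<odot>\<^bsub>P\<^esub> gen F))"
      by (rule P.right_hom_finsum[OF right_module_P hom]) (simp add: P.rsmult_closed xD gen_closed)
    finally have fx: "f x = (\<Oplus>\<^bsub>P\<^esub>F\<in>T. f (x F \<odot>\<^bsub>P\<^esub> gen F))" .
    have fcl: "f (x F \<odot>\<^bsub>P\<^esub> gen F) \<in> carrier P" if "F \<in> T" for F
      by (rule right_hom_closed[OF hom P.rsmult_closed[OF xD(2)[OF that] gen_closed[OF that]]])
    show "\<xi> m x = f x"
    proof (rule P_eqI[OF \<xi>_closed[OF m x] right_hom_closed[OF hom x]])
      fix D assume D: "D \<in> T"
      have "f x D = (\<Oplus>\<^bsub>A\<^esub>F\<in>T. f (x F \<odot>\<^bsub>P\<^esub> gen F) D)"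
        unfolding fx by (rule finsum_P_apply[OF fcl D])
      also have "\<dots> = (\<Oplus>\<^bsub>A\<^esub>F\<in>T. block m D F \<otimes>\<^bsub>A\<^esub> x F)"
      proof (rule R.finsum_cong')
        fix F assume F: "F \<in> T"
        show "f (x F \<odot>\<^bsub>P\<^esub> gen F) D = block m D F \<otimes>\<^bsub>A\<^esub> x F"
          unfolding right_hom_smult[OF hom xD(2)[OF F] gen_closed[OF F]] block[OF D F] a_def
          using D by (simp add: P_simps)
      qed (simp_all add: block_closed[OF m] xD)
      finally show "\<xi> m x D = f x D" by (simp add: \<xi>_apply[OF x D])
    qed
  qed
  with m show ?thesis by (intro bexI[of _ m])
qed

theorem \<xi>_iso: "\<xi> \<in> ring_iso J S"
proof (rule ring_iso_memI)
  show "bij_betw \<xi> (carrier J) (carrier S)"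
    unfolding bij_betw_def using \<xi>_inj \<xi>_mem \<xi>_surj by (auto simp: image_iff)
qed (simp_all add: \<xi>_mem \<xi>_mult \<xi>_add \<xi>_one)

theorem fin_dim_algebra_End: "fin_dim_algebra K S"
  by (rule fin_dim_algebra_transport[OF inc_T.fin_dim_algebra_I \<xi>_iso]) (rule \<xi>_zero, rule \<xi>_smult)

end

section \<open>Global dimension of the commuting algebra and of the skeleton\<close>

context finite_quiver
begin

abbreviation "comps \<equiv> path_components Q"

definition component :: "'v \<Rightarrow> 'v set" where
  "component v = {u \<in> verts Q. joined_by_path Q v u \<and> joined_by_path Q u v}"

lemma path_components_eq: "comps = component ` verts Q"
  by (auto simp: path_components_def quotient_def component_def)

lemma finite_components: "finite comps"
  by (simp add: path_components_eq)

lemma component_eq: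
  assumes "u \<in> verts Q" "v \<in> verts Q" "joined_by_path Q u v" "joined_by_path Q v u"
  shows "component u = component v"
  using assms joined_by_path_trans unfolding component_def by blast

end

locale finite_quiver_with_choice = finite_quiver K Q
  for K :: "('k, 'e) ring_scheme" (structure) and Q :: "('v, 'a) pre_digraph" +
  fixes w :: "'v set \<Rightarrow> 'v"
  assumes w_choice: "D \<in> path_components Q \<Longrightarrow> w D \<in> D"
begin

abbreviation "sk_le \<equiv> skeleton_le Q w"

lemma w_component:
  assumes "v \<in> verts Q"
  shows "w (component v) \<in> verts Q" "joined_by_path Q v (w (component v))"
    "joined_by_path Q (w (component v)) v"
  using w_choice[of "component v"] assms by (auto simp: path_components_eq component_def)

lemma w_mem: "D \<in> comps \<Longrightarrow> w D \<in> verts Q"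
  using w_component(1) by (auto simp: path_components_eq)

lemma component_w:
  assumes "D \<in> comps"
  shows "component (w D) = D"
proof -
  obtain v where v: "v \<in> verts Q" "D = component v" using assms by (auto simp: path_components_eq)
  show ?thesis
    unfolding v(2) using w_component[OF v(1)] v(1) by (intro component_eq)
qed

lemma sk_le_refl: "D \<in> comps \<Longrightarrow> sk_le D D"
  by (simp add: skeleton_le_def joined_by_path_refl w_mem)

lemma sk_le_trans: "sk_le D F \<Longrightarrow> sk_le F G \<Longrightarrow> sk_le D G"
  unfolding skeleton_le_def by (rule joined_by_path_trans)

lemma sk_le_antisym:
  assumes "D \<in> comps" "F \<in> comps" "sk_le D F" "sk_le F D"
  shows "D = F"
  using component_eq[OF w_mem[OF assms(1)] w_mem[OF assms(2)]] assms component_w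
  by (simp add: skeleton_le_def)

lemma sk_height_less:
  assumes "D \<in> comps" "F \<in> comps" "sk_le D F" "D \<noteq> F"
  shows "height comps sk_le D < height comps sk_le F"
  by (rule height_less[where leq = sk_le, OF finite_components assms sk_le_refl[OF assms(2)]])
    (erule (1) sk_le_trans, erule (3) sk_le_antisym)

lemma sk_height_pos: "D \<in> comps \<Longrightarrow> 0 < height comps sk_le D"
  by (rule height_pos[where leq = sk_le, OF finite_components _ sk_le_refl])

text \<open>Every vertex is represented by the chosen vertex of its component, and its height is that of the
  component in the partial order of the skeleton.\<close>

sublocale A: stratified_incidence_ring K "verts Q" "joined_by_path Q" A \<psi>
  "\<lambda>v. w (component v)" "\<lambda>v. height comps sk_le (component v)"
proof (intro stratified_incidence_ring.intro incidence_ring.intro stratified_incidence_ring_axioms.intro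
    incidence_ring_axioms.intro inc.incidence_axioms ring_A \<psi>_iso)
  fix v assume v: "v \<in> verts Q"
  show "w (component v) \<in> verts Q" "joined_by_path Q v (w (component v))"
    "joined_by_path Q (w (component v)) v" using w_component[OF v] .
  fix d assume "d \<in> (\<lambda>v. w (component v)) ` verts Q" and le: "joined_by_path Q d v"
    and ne: "d \<noteq> w (component v)"
  then obtain u where u: "u \<in> verts Q" "d = w (component u)" by blast
  have comps: "component u \<in> comps" "component v \<in> comps" using u v by (auto simp: path_components_eq)
  have "sk_le (component u) (component v)"
    unfolding skeleton_le_def using joined_by_path_trans[OF le w_component(2)[OF v]] u by simp
  moreover have "component u \<noteq> component v" using ne u by auto
  ultimately have "height comps sk_le (component u) < height comps sk_le (component v)"
    by (intro sk_height_less comps)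
  then show "height comps sk_le (component d) < height comps sk_le (component v)"
    by (simp add: u(2) component_w comps)
qed

theorem gl_dim_A:
  "gl_dim TYPE('m) A \<le> enat (longest_chain_length (skeleton_verts Q) (skeleton_le Q w))"
  unfolding skeleton_verts_def
proof (rule A.gl_dim_le)
  fix v assume "v \<in> verts Q"
  then show "0 < height comps sk_le (component v)" by (intro sk_height_pos) (simp add: path_components_eq)
  show "height comps sk_le (component v) \<le> longest_chain_length comps sk_le"
    by (rule height_le[OF finite_components])
qed

sublocale End: idempotent_family K "verts Q" "joined_by_path Q" A \<psi> comps w
  "\<lambda>D. commuting_proj K Q (path_elem K (vertex_path (w D)))"
proof (intro idempotent_family.intro idempotent_family_axioms.intro A.incidence_ring_axioms)
  fix D assume D: "D \<in> comps"
  show "commuting_proj K Q (path_elem K (vertex_path (w D))) = A.E (w D) (w D)"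
    unfolding A.E_def by (rule \<psi>_unit_matrix[OF w_mem[OF D], symmetric])
qed (simp_all add: \<psi>_smult finite_components w_mem)

lemma skeleton_eq: "skeleton K Q w = End.S"
  by (simp add: skeleton_def)

theorem fin_dim_algebra_skeleton: "fin_dim_algebra K (skeleton K Q w)"
  unfolding skeleton_eq by (rule End.fin_dim_algebra_End)

text \<open>The preorder of the skeleton is a partial order already, so every component represents itself.\<close>

sublocale Sk: stratified_incidence_ring K comps "\<lambda>D F. joined_by_path Q (w D) (w F)" End.S End.\<xi>
  "\<lambda>D. D" "height comps sk_le"
proof (intro stratified_incidence_ring.intro incidence_ring.intro stratified_incidence_ring_axioms.intro
    incidence_ring_axioms.intro End.inc_T.incidence_axioms End.\<xi>_iso)
  show "ring End.S" using End.fin_dim_algebra_End by (simp add: fin_dim_algebra_def)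
  show "height comps sk_le D < height comps sk_le F"
    if "D \<in> (\<lambda>D. D) ` comps" "F \<in> comps" "joined_by_path Q (w D) (w F)" "D \<noteq> F" for D F
    using that by (intro sk_height_less) (auto simp: skeleton_le_def)
qed (simp_all add: joined_by_path_refl w_mem)

theorem gl_dim_skeleton:
  "gl_dim TYPE('m) (skeleton K Q w) \<le> enat (longest_chain_length (skeleton_verts Q) (skeleton_le Q w))"
  unfolding skeleton_verts_def skeleton_eq
  by (rule Sk.gl_dim_le) (simp_all add: sk_height_pos height_le finite_components)

end

theorem theorem6p4:
  fixes K :: "('k, 'e) ring_scheme"
    and Q :: "('v, 'a) pre_digraph"
    and w :: "'v set \<Rightarrow> 'v"
  assumes "field K"
    and "fin_digraph Q"
    and "\<And>D. D \<in> path_components Q \<Longrightarrow> w D \<in> D"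
  shows "fin_dim_algebra K (commuting_algebra K Q) \<and>
    gl_dim TYPE('m) (commuting_algebra K Q)
      \<le> enat (longest_chain_length (skeleton_verts Q) (skeleton_le Q w)) \<and>
    fin_dim_algebra K (skeleton K Q w) \<and>
    gl_dim TYPE('m) (skeleton K Q w)
      \<le> enat (longest_chain_length (skeleton_verts Q) (skeleton_le Q w))"
proof -
  interpret finite_quiver_with_choice K Q w
    using assms by (intro finite_quiver_with_choice.intro finite_quiver.intro finite_quiver_with_choice_axioms.intro)
  show ?thesis
    by (intro conjI fin_dim_algebra_A gl_dim_A fin_dim_algebra_skeleton gl_dim_skeleton)
qed

end
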